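(* Let $n>1$, $I=[1,n]$ and let $\sigma:I\to I$, $\sigma(i)=n+1-i$. (Forward direction.) Let $K\subsetneq I$ be an interval with $|K|>1$ and let $I\setminus K=I'(K)\sqcup I''(K)$ be the unique partition of $I\setminus K$ into self-orthogonal subsets such that $I'(K)$ and $K$ are orthogonal. Then the assignments $$\widehat T_1\mapsto T_{w_\circ^{I'(K)\cup K}},\qquad \widehat T_2\mapsto T_{w_\circ^{I''(K)}}$$ define an optimal (disjoint standard) homomorphism $\mathrm{Br}^+(I_2(2m(K)))\to\mathrm{Br}^+_{n+1}$ where $$m(K)=\begin{cases}\frac12(n-|K|)+1,&\sigma(K)=K,\\ n-|K|+2,&\text{otherwise.}\end{cases}$$ (Converse.) Let $3\le N<\infty$ and suppose that $\Phi:\mathrm{Br}^+(I_2(N))\to\mathrm{Br}^+_{n+1}$ is an optimal disjoint fully supported standard homomorphism such that $[\Phi](i)\neq\emptyset$ for $i\in\{1,2\}$. Then: (a) either both $[\Phi](1)$ and $[\Phi](2)$ are self-orthogonal, or exactly one of them contains a unique connected component of cardinality $>1$; (b) if $[\Phi](1)$ and $[\Phi](2)$ are self-orthogonal, then $N=n+1$ and $\Phi(\widehat T_k)=\prod_{j\in I_k}T_j$, $k\in\{1,2\}$, where $\{I_1,I_2\}$ consists of the set of odd and the set of even elements of $[1,n]$; (c) if precisely one of the $[\Phi](i)$, $i\in\{1,2\}$, contains a unique connected component $K$ with $|K|>1$, then $N=2m(K)$.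
   Context: $\mathrm{Br}^+_{n+1}$ is the braid monoid (Artin monoid of type $A_n$): generators $T_1,\dots,T_n$, relations $T_iT_{i+1}T_i=T_{i+1}T_iT_{i+1}$, $T_iT_j=T_jT_i$ for $|i-j|>1$. $\mathrm{Br}^+(I_2(N))$ is generated by $\widehat T_1,\widehat T_2$ subject to $\widehat T_1\widehat T_2\widehat T_1\cdots=\widehat T_2\widehat T_1\widehat T_2\cdots$ ($N$ factors on each side). For $w\in S_{n+1}$ with reduced expression $w=s_{i_1}\cdots s_{i_k}$ (in simple transpositions $s_i=(i,i+1)$), $T_w=T_{i_1}\cdots T_{i_k}$. For $J\subset[1,n]$, $w_\circ^J$ is the longest element of the subgroup $\langle s_j:j\in J\rangle$. For integers $a\le b$, $[a,b]=\{a,a+1,\dots,b\}$; intervals are sets of this form. Subsets $J,K\subset[1,n]$ are orthogonal if $|j-k|>1$ for all $j\in J,k\in K$; $J$ is self-orthogonal if it contains no two consecutive integers; the connected components of $J$ are its maximal subintervals. A homomorphism $\Phi:\mathrm{Br}^+(I_2(N))\to\mathrm{Br}_{n+1}^+$ is standard if $\Phi(\widehat T_i)=T_{w_\circ^{[\Phi](i)}}$, $i\in\{1,2\}$, for some subsets $[\Phi](i)\subset[1,n]$ (so $[\Phi](i)$ is the set of indices of generators occurring in $\Phi(\widehat T_i)$). It is disjoint if $[\Phi](1)\cap[\Phi](2)=\emptyset$, fully supported if $[\Phi](1)\cup[\Phi](2)=[1,n]$. It is optimal if, whenever $X_1=\Phi(\widehat T_1)$ and $X_2=\Phi(\widehat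 T_2)$ are distinct, $N$ is the smallest positive integer $k$ such that $X_1X_2X_1\cdots=X_2X_1X_2\cdots$ ($k$ factors on each side). *)

theory Defs
  imports "HOL-Algebra.Sym_Groups"
begin

section \<open>Monoids given by generators and relations\<close>

definition list_prod :: "('a, 'b) monoid_scheme \<Rightarrow> 'a list \<Rightarrow> 'a" where
  "list_prod G xs = foldr (mult G) xs (one G)"

inductive_set word_cong :: "'a set \<Rightarrow> ('a list \<times> 'a list) set \<Rightarrow> ('a list \<times> 'a list) set"
  for S :: "'a set" and R :: "('a list \<times> 'a list) set" where
  rel: "(u, v) \<in> R \<Longrightarrow> set u \<subseteq> S \<Longrightarrow> set v \<subseteq> S \<Longrightarrow> set x \<subseteq> S \<Longrightarrow> set y \<subseteq> S
          \<Longrightarrow> (x @ u @ y, x @ v @ y) \<in> word_cong S R"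
| refl: "set u \<subseteq> S \<Longrightarrow> (u, u) \<in> word_cong S R"
| sym: "(u, v) \<in> word_cong S R \<Longrightarrow> (v, u) \<in> word_cong S R"
| trans: "(u, v) \<in> word_cong S R \<Longrightarrow> (v, w) \<in> word_cong S R \<Longrightarrow> (u, w) \<in> word_cong S R"

text \<open>Elements are congruence classes of words.\<close>

definition presented_monoid :: "'a set \<Rightarrow> ('a list \<times> 'a list) set \<Rightarrow> 'a list set monoid" where
  "presented_monoid S R =
     \<lparr> carrier = lists S // word_cong S R,
       mult = (\<lambda>A B. \<Union>u\<in>A. \<Union>v\<in>B. word_cong S R `` {u @ v}),
       one = word_cong S R `` {[]} \<rparr>"

lemma word_cong_in_lists:
  assumes "(u, v) \<in> word_cong S R"
  shows "u \<in> lists S" and "v \<in> lists S"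
proof -
  have "set u \<subseteq> S \<and> set v \<subseteq> S"
    using assms by (induction rule: word_cong.induct) auto
  then show "u \<in> lists S" "v \<in> lists S" by auto
qed

lemma equiv_word_cong: "equiv (lists S) (word_cong S R)"
proof (rule equivI)
  show "word_cong S R \<subseteq> lists S \<times> lists S"
    by (intro subrelI SigmaI) (erule word_cong_in_lists)+
  show "refl_on (lists S) (word_cong S R)"
    by (rule refl_onI) (auto intro: word_cong.refl)
  show "Relation.sym (word_cong S R)"
    by (rule symI) (rule word_cong.sym)
  show "Relation.trans (word_cong S R)"
    by (rule transI) (rule word_cong.trans)
qed

lemma word_cong_context:
  assumes "(u, v) \<in> word_cong S R" and "set x \<subseteq> S" and "set y \<subseteq> S"
  shows "(x @ u @ y, x @ v @ y) \<in> word_cong S R"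
  using assms(1)
proof (induction rule: word_cong.induct)
  case (rel u v x' y')
  have "((x @ x') @ u @ (y' @ y), (x @ x') @ v @ (y' @ y)) \<in> word_cong S R"
    by (rule word_cong.rel) (use rel assms(2,3) in auto)
  then show ?case by simp
next
  case (refl u)
  then show ?case using assms(2,3) by (intro word_cong.refl) auto
next
  case (sym u v)
  then show ?case by (blast intro: word_cong.sym)
next
  case (trans u v w)
  then show ?case by (blast intro: word_cong.trans)
qed

lemma word_cong_append:
  assumes "(u, u') \<in> word_cong S R" and "(v, v') \<in> word_cong S R"
  shows "(u @ v, u' @ v') \<in> word_cong S R"
proof -
  have l: "set u' \<subseteq> S" "set v \<subseteq> S"
    using word_cong_in_lists(2)[OF assms(1)] word_cong_in_lists(1)[OF assms(2)] by auto
  have "(u @ v, u' @ v) \<in> word_cong S R"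
    using word_cong_context[OF assms(1), of "[]" v] l by simp
  moreover have "(u' @ v, u' @ v') \<in> word_cong S R"
    using word_cong_context[OF assms(2), of u' "[]"] l by simp
  ultimately show ?thesis by (rule word_cong.trans)
qed

lemma presented_mult_class:
  assumes "u \<in> lists S" and "v \<in> lists S"
  shows "(word_cong S R `` {u}) \<otimes>\<^bsub>presented_monoid S R\<^esub> (word_cong S R `` {v})
           = word_cong S R `` {u @ v}"
proof -
  have "congruent2 (word_cong S R) (word_cong S R) (\<lambda>u v. word_cong S R `` {u @ v})"
    by (rule congruent2I') (rule equiv_class_eq[OF equiv_word_cong], rule word_cong_append)
  from UN_equiv_class2[OF equiv_word_cong equiv_word_cong this assms]
  show ?thesis by (simp add: presented_monoid_def)
qed

lemma monoid_presented_monoid: "monoid (presented_monoid S R)"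
proof -
  let ?M = "presented_monoid S R"
  let ?c = "\<lambda>u. word_cong S R `` {u}"
  have carr: "x \<in> carrier ?M \<longleftrightarrow> (\<exists>u\<in>lists S. x = ?c u)" for x
    by (auto simp: presented_monoid_def quotient_def)
  have one: "\<one>\<^bsub>?M\<^esub> = ?c []" by (simp add: presented_monoid_def)
  note m = presented_mult_class[of _ S _ R]
  show ?thesis
  proof (rule monoidI)
    fix x y assume "x \<in> carrier ?M" "y \<in> carrier ?M"
    then obtain u v where "u \<in> lists S" "v \<in> lists S" "x = ?c u" "y = ?c v"
      unfolding carr by blast
    then have "u @ v \<in> lists S" and "x \<otimes>\<^bsub>?M\<^esub> y = ?c (u @ v)"
      by (simp_all add: m)
    then show "x \<otimes>\<^bsub>?M\<^esub> y \<in> carrier ?M"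
      unfolding carr by blast
  next
    show "\<one>\<^bsub>?M\<^esub> \<in> carrier ?M" unfolding carr one by blast
  next
    fix x y z assume "x \<in> carrier ?M" "y \<in> carrier ?M" "z \<in> carrier ?M"
    then obtain u v w where "u \<in> lists S" "v \<in> lists S" "w \<in> lists S"
        "x = ?c u" "y = ?c v" "z = ?c w"
      unfolding carr by blast
    then show "x \<otimes>\<^bsub>?M\<^esub> y \<otimes>\<^bsub>?M\<^esub> z = x \<otimes>\<^bsub>?M\<^esub> (y \<otimes>\<^bsub>?M\<^esub> z)"
      by (simp add: m)
  next
    fix x assume "x \<in> carrier ?M"
    then obtain u where "u \<in> lists S" "x = ?c u" unfolding carr by blast
    then show "\<one>\<^bsub>?M\<^esub> \<otimes>\<^bsub>?M\<^esub> x = x" "x \<otimes>\<^bsub>?M\<^esub> \<one>\<^bsub>?M\<^esub> = x"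
      unfolding one by (simp_all add: m)
  qed
qed

definition monoid_homs :: "('a, 'c) monoid_scheme \<Rightarrow> ('b, 'd) monoid_scheme \<Rightarrow> ('a \<Rightarrow> 'b) set" where
  "monoid_homs G H = {f \<in> hom G H. f \<one>\<^bsub>G\<^esub> = \<one>\<^bsub>H\<^esub>}"


section \<open>The braid monoid and the dihedral Artin monoids\<close>

text \<open>The word \<open>x y x \<dots>\<close> with \<open>k\<close> letters.\<close>

primrec alternating :: "nat \<Rightarrow> 'a \<Rightarrow> 'a \<Rightarrow> 'a list" where
  "alternating 0 x y = []"
| "alternating (Suc k) x y = x # alternating k y x"

text \<open>The parameter \<open>n\<close> is the number of generators (the rank), so that \<open>braid_monoid n\<close> is
  \<open>Br\<^sup>+\<close> on \<open>n + 1\<close> strands and the corresponding Coxeter group is \<open>sym_group (Suc n)\<close>.\<close>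

definition braid_rels :: "nat \<Rightarrow> (nat list \<times> nat list) set" where
  "braid_rels n =
     {([i, Suc i, i], [Suc i, i, Suc i]) | i. i \<in> {1..n} \<and> Suc i \<in> {1..n}} \<union>
     {([i, j], [j, i]) | i j. i \<in> {1..n} \<and> j \<in> {1..n} \<and> \<bar>int i - int j\<bar> > 1}"

definition braid_monoid :: "nat \<Rightarrow> nat list set monoid" where
  "braid_monoid n = presented_monoid {1..n} (braid_rels n)"

definition braid_gen :: "nat \<Rightarrow> nat \<Rightarrow> nat list set" where
  "braid_gen n i = word_cong {1..n} (braid_rels n) `` {[i]}"

definition dihedral_rels :: "nat \<Rightarrow> (nat list \<times> nat list) set" where
  "dihedral_rels N = {(alternating N 1 2, alternating N 2 1)}"

definition dihedral_monoid :: "nat \<Rightarrow> nat list set monoid" where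
  "dihedral_monoid N = presented_monoid {1, 2} (dihedral_rels N)"

definition dihedral_gen :: "nat \<Rightarrow> nat \<Rightarrow> nat list set" where
  "dihedral_gen N i = word_cong {1, 2} (dihedral_rels N) `` {[i]}"


section \<open>Reduced expressions and longest elements\<close>

definition simple_transposition :: "nat \<Rightarrow> nat \<Rightarrow> nat" where
  "simple_transposition i = transpose i (Suc i)"

definition is_expression :: "nat \<Rightarrow> (nat \<Rightarrow> nat) \<Rightarrow> nat list \<Rightarrow> bool" where
  "is_expression n w is \<longleftrightarrow>
     set is \<subseteq> {1..n} \<and> list_prod (sym_group (Suc n)) (map simple_transposition is) = w"

definition perm_length :: "nat \<Rightarrow> (nat \<Rightarrow> nat) \<Rightarrow> nat" where
  "perm_length n w = (LEAST k. \<exists>is. is_expression n w is \<and> length is = k)"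

definition is_reduced_expression :: "nat \<Rightarrow> (nat \<Rightarrow> nat) \<Rightarrow> nat list \<Rightarrow> bool" where
  "is_reduced_expression n w is \<longleftrightarrow> is_expression n w is \<and> length is = perm_length n w"

text \<open>By Matsumoto's theorem the choice of the reduced expression is immaterial.\<close>

definition braid_lift :: "nat \<Rightarrow> (nat \<Rightarrow> nat) \<Rightarrow> nat list set" where
  "braid_lift n w =
     list_prod (braid_monoid n) (map (braid_gen n) (SOME is. is_reduced_expression n w is))"

definition parabolic_subgroup :: "nat \<Rightarrow> nat set \<Rightarrow> (nat \<Rightarrow> nat) set" where
  "parabolic_subgroup n J = generate (sym_group (Suc n)) (simple_transposition ` J)"

definition longest_element :: "nat \<Rightarrow> nat set \<Rightarrow> nat \<Rightarrow> nat" where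
  "longest_element n J = (ARG_MAX (perm_length n) w. w \<in> parabolic_subgroup n J)"


section \<open>Subsets of the index set\<close>

definition orthogonal_sets :: "nat set \<Rightarrow> nat set \<Rightarrow> bool" where
  "orthogonal_sets J K \<longleftrightarrow> (\<forall>j\<in>J. \<forall>k\<in>K. \<bar>int j - int k\<bar> > 1)"

definition self_orthogonal :: "nat set \<Rightarrow> bool" where
  "self_orthogonal J \<longleftrightarrow> (\<forall>j\<in>J. Suc j \<notin> J)"

definition is_interval_set :: "nat set \<Rightarrow> bool" where
  "is_interval_set K \<longleftrightarrow> (\<exists>a b. a \<le> b \<and> K = {a..b})"

definition is_component :: "nat set \<Rightarrow> nat set \<Rightarrow> bool" where
  "is_component J K \<longleftrightarrow> is_interval_set K \<and> K \<subseteq> J \<and>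
     (\<forall>K'. is_interval_set K' \<and> K \<subseteq> K' \<and> K' \<subseteq> J \<longrightarrow> K' = K)"

definition is_big_component :: "nat set \<Rightarrow> nat set \<Rightarrow> bool" where
  "is_big_component J K \<longleftrightarrow> is_component J K \<and> card K > 1"

text \<open>\<open>(A, B)\<close> is the partition \<open>(I'(K), I''(K))\<close> of the complement of \<open>K\<close> in \<open>[1,n]\<close>;
  either part may be empty.\<close>

definition is_complement_partition :: "nat \<Rightarrow> nat set \<Rightarrow> nat set \<times> nat set \<Rightarrow> bool" where
  "is_complement_partition n K = (\<lambda>(A, B).
     A \<union> B = {1..n} - K \<and> A \<inter> B = {} \<and>
     self_orthogonal A \<and> self_orthogonal B \<and> orthogonal_sets A K)"

definition diagram_flip :: "nat \<Rightarrow> nat \<Rightarrow> nat" where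
  "diagram_flip n i = n + 1 - i"

text \<open>An interval \<open>K\<close> in \<open>[1,n]\<close> fixed by the flip has \<open>n - card K\<close> even, so \<open>div\<close> is exact.\<close>

definition m_of :: "nat \<Rightarrow> nat set \<Rightarrow> nat" where
  "m_of n K = (if diagram_flip n ` K = K then (n - card K) div 2 + 1 else n - card K + 2)"


section \<open>Standard homomorphisms\<close>

definition standard_hom :: "nat \<Rightarrow> nat \<Rightarrow> (nat list set \<Rightarrow> nat list set) \<Rightarrow> bool" where
  "standard_hom N n \<Phi> \<longleftrightarrow>
     \<Phi> \<in> monoid_homs (dihedral_monoid N) (braid_monoid n) \<and>
     (\<forall>i\<in>{1, 2}. \<exists>J \<subseteq> {1..n}. \<Phi> (dihedral_gen N i) = braid_lift n (longest_element n J))"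

text \<open>\<open>hom_support N \<Phi> i\<close> is \<open>[\<Phi>](i)\<close>: the indices of the generators occurring in the image
  of the \<open>i\<close>-th generator. Elements are classes of words, hence the union.\<close>

definition hom_support :: "nat \<Rightarrow> (nat list set \<Rightarrow> nat list set) \<Rightarrow> nat \<Rightarrow> nat set" where
  "hom_support N \<Phi> i = (\<Union>is\<in>\<Phi> (dihedral_gen N i). set is)"

definition disjoint_hom :: "nat \<Rightarrow> (nat list set \<Rightarrow> nat list set) \<Rightarrow> bool" where
  "disjoint_hom N \<Phi> \<longleftrightarrow> hom_support N \<Phi> 1 \<inter> hom_support N \<Phi> 2 = {}"

definition fully_supported_hom :: "nat \<Rightarrow> nat \<Rightarrow> (nat list set \<Rightarrow> nat list set) \<Rightarrow> bool" where
  "fully_supported_hom N n \<Phi> \<longleftrightarrow> hom_support N \<Phi> 1 \<union> hom_support N \<Phi> 2 = {1..n}"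

definition alternating_relation :: "nat \<Rightarrow> nat \<Rightarrow> nat list set \<Rightarrow> nat list set \<Rightarrow> bool" where
  "alternating_relation n k X Y \<longleftrightarrow>
     list_prod (braid_monoid n) (alternating k X Y) = list_prod (braid_monoid n) (alternating k Y X)"

definition optimal_hom :: "nat \<Rightarrow> nat \<Rightarrow> (nat list set \<Rightarrow> nat list set) \<Rightarrow> bool" where
  "optimal_hom N n \<Phi> \<longleftrightarrow>
     (let X1 = \<Phi> (dihedral_gen N 1); X2 = \<Phi> (dihedral_gen N 2) in
      X1 \<noteq> X2 \<longrightarrow>
        0 < N \<and> alternating_relation n N X1 X2 \<and>
        (\<forall>k. 0 < k \<and> k < N \<longrightarrow> \<not> alternating_relation n k X1 X2))"

end

theory Submission
  imports Defs
begin

text \<open>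
  Read a positive word as a motion of strands. A word in which no two strands cross twice is
  determined, as a braid, by its crossings (Matsumoto), so the image of a generator is a half
  twist: it turns over every block of positions. Under two alternating disjoint half twists
  with only one large block \<open>K = {p..p + f}\<close>, the \<open>f\<close> strands in the interior of \<open>K\<close> stay there, as
  one fat strand, while the \<open>M = n + 1 - f\<close> thin strands bounce between the two ends.

  Lower bounds. The leftmost thin strand shows that a relation of length \<open>k < 2 M\<close> has \<open>k = M\<close>;
  if \<open>K\<close> is not in the middle, the number of crossings of a thin neighbour with the fat strand
  excludes this too. If there are two fat strands, a strand between them meets
  one of them first, and which one depends on the half twist that comes first, so there is no
  relation at all.

  Upper bounds. If the fat strand is in the middle, \<open>M\<close> alternating steps, freed of the inner twists
  of the fat strand, are a half twist by Matsumoto's theorem. Moving the fat strand past a thin one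
  conjugates the two configurations; as the full twist is central and the braid monoid is
  cancellative (Garside), the resulting expression for the full twist carries over to every position
  of \<open>K\<close>.
\<close>

section \<open>Braid words and crossing numbers\<close>

text \<open>Matsumoto's theorem handles only words in which no two strands cross twice, so a
  relation of length \<open>2 * M\<close> cannot be read off from crossings; it must be assembled
  from half turns. A half turn takes the gap after \<open>p\<close> thin strands to the gap after
  \<open>M - p\<close>. If \<open>M = 2 * p\<close>, this is the same gap. If
  \<open>M = 2 * p + 1\<close>, no gap is in the middle; the braid \<open>C p\<close> that exchanges
  the thin neighbours of the fat strand is then cut in two, so that the fat strand alternates
  between the gaps \<open>p\<close> and \<open>p + 1\<close>. Two half turns give
  \<open>E p ^ M * D p ^ 2 = Delta ^ 2\<close> for this one \<open>p\<close>. Conjugation by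
  \<open>S p\<close> turns \<open>E p\<close> into \<open>E' (p + 1)\<close>, with the two factors
  in the opposite order, and conjugation by \<open>other\<close> restores the order; cancellation
  replaces inverses here. The images of the generators contain \<open>M\<close> inner twists in the
  \<open>2 * M\<close> factors: they commute with \<open>E p\<close>, two of them go into the full
  twist, and the remaining ones are common to both sides. Without a fat strand
  (\<open>f = 0\<close>) the gap \<open>p\<close> can be chosen in the middle, whence the length
  \<open>n + 1\<close> for both parities.\<close>

inductive beq :: "nat list \<Rightarrow> nat list \<Rightarrow> bool" (infix \<open>\<approx>\<close> 50) where
  far: "Suc i < j \<Longrightarrow> x @ [i, j] @ y \<approx> x @ [j, i] @ y"
| braid: "x @ [i, Suc i, i] @ y \<approx> x @ [Suc i, i, Suc i] @ y"
| refl: "u \<approx> u"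
| sym: "u \<approx> v \<Longrightarrow> v \<approx> u"
| trans: "u \<approx> v \<Longrightarrow> v \<approx> w \<Longrightarrow> u \<approx> w"

declare beq.refl [simp]

lemmas [trans] = beq.trans

lemma beq_context: "u \<approx> v \<Longrightarrow> x @ u @ y \<approx> x @ v @ y"
proof (induction rule: beq.induct)
  case (far i j x' y')
  then show ?case using beq.far[of i j "x @ x'" "y' @ y"] by simp
next
  case (braid x' i y')
  then show ?case using beq.braid[of "x @ x'" i "y' @ y"] by simp
qed (auto intro: beq.intros)

lemma beq_append: "u \<approx> u' \<Longrightarrow> v \<approx> v' \<Longrightarrow> u @ v \<approx> u' @ v'"
  by (metis append_Nil append_Nil2 beq.trans beq_context)

lemma beq_Cons: "u \<approx> v \<Longrightarrow> i # u \<approx> i # v"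
  using beq_append[of "[i]" "[i]" u v] by simp

lemma beq_far: "Suc i < j \<or> Suc j < i \<Longrightarrow> i # j # y \<approx> j # i # y"
  using beq.far[of i j "[]" y] beq.sym[OF beq.far[of j i "[]" y]] by auto

lemma beq_braid: "i # Suc i # i # y \<approx> Suc i # i # Suc i # y"
  using beq.braid[of "[]" i y] by simp

lemma beq_length: "u \<approx> v \<Longrightarrow> length u = length v"
  by (induction rule: beq.induct) auto

lemma beq_set: "u \<approx> v \<Longrightarrow> set u = set v"
  by (induction rule: beq.induct) auto

abbreviation sw :: "nat \<Rightarrow> nat \<Rightarrow> nat" where
  "sw \<equiv> simple_transposition"

lemma sw_eq: "sw i x = (if x = i then Suc i else if x = Suc i then i else x)"
  by (simp add: simple_transposition_def transpose_def)

lemma sw_sw [simp]: "sw i (sw i x) = x"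
  by (simp add: sw_eq)

lemma sw_inj [simp]: "sw i x = sw i y \<longleftrightarrow> x = y"
  by (metis sw_sw)

text \<open>\<open>act w x\<close> is the final position of the strand of the braid \<open>w\<close> that starts at position \<open>x\<close>, and
  \<open>crossings w p q\<close> counts how often the strands starting at \<open>p\<close> and \<open>q\<close> cross.\<close>

primrec act :: "nat list \<Rightarrow> nat \<Rightarrow> nat" where
  "act [] x = x"
| "act (i # w) x = act w (sw i x)"

primrec crossings :: "nat list \<Rightarrow> nat \<Rightarrow> nat \<Rightarrow> nat" where
  "crossings [] p q = 0"
| "crossings (i # w) p q =
     of_bool (p = i \<and> q = Suc i \<or> p = Suc i \<and> q = i) + crossings w (sw i p) (sw i q)"

lemma act_append [simp]: "act (u @ v) x = act v (act u x)"
  by (induction u arbitrary: x) auto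

lemma act_inj [simp]: "act w x = act w y \<longleftrightarrow> x = y"
  by (induction w arbitrary: x y) auto

lemma crossings_append [simp]:
  "crossings (u @ v) p q = crossings u p q + crossings v (act u p) (act u q)"
  by (induction u arbitrary: p q) auto

lemma crossings_commute: "crossings w p q = crossings w q p"
proof (induction w arbitrary: p q)
  case (Cons i w)
  then show ?case using Cons[of "sw i p" "sw i q"] by auto
qed simp

lemma crossings_same [simp]: "crossings w p p = 0"
  by (induction w arbitrary: p) auto

lemma odd_crossings:
  "p \<noteq> q \<Longrightarrow> odd (crossings w p q) \<longleftrightarrow> ((p < q) \<noteq> (act w p < act w q))"
proof (induction w arbitrary: p q)
  case (Cons i w)
  have "sw i p \<noteq> sw i q" using Cons.prems by simp
  note IH = Cons.IH[OF this]
  show ?case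
  proof (cases "p = i \<and> q = Suc i \<or> p = Suc i \<and> q = i")
    case True
    then show ?thesis using IH by (auto simp: sw_eq)
  next
    case False
    then have "(p < q) = (sw i p < sw i q)" using Cons.prems by (auto simp: sw_eq)
    then show ?thesis using IH False by auto
  qed
qed simp

lemma beq_act: "u \<approx> v \<Longrightarrow> act u = act v"
  by (induction rule: beq.induct) (auto simp: fun_eq_iff sw_eq)

lemma beq_crossings: "u \<approx> v \<Longrightarrow> crossings u = crossings v"
proof (induction rule: beq.induct)
  case (far i j x y)
  have "crossings [i,j] p q = crossings [j,i] p q" for p q
    using far by (auto simp: sw_eq)
  moreover have "act [i,j] p = act [j,i] p" for p
    using far by (auto simp: sw_eq)
  ultimately show ?case by (simp only: crossings_append fun_eq_iff) simp
next
  case (braid x i y)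
  have "crossings [i,Suc i,i] p q = crossings [Suc i,i,Suc i] p q" for p q
    by (auto simp: sw_eq)
  moreover have "act [i,Suc i,i] p = act [Suc i,i,Suc i] p" for p
    by (auto simp: sw_eq)
  ultimately show ?case by (simp only: crossings_append fun_eq_iff) simp
qed auto

text \<open>Until the strands cross, the interval between them loses an end point only through the
  letter at that very end, so no gap between them can be skipped.\<close>

lemma crossings_support:
  "crossings w p q \<noteq> 0 \<Longrightarrow> p < q \<Longrightarrow> {p..<q} \<subseteq> set w"
proof (induction w arbitrary: p q)
  case (Cons i w)
  show ?case
  proof (cases "p = i \<and> q = Suc i")
    case False
    have lt: "sw i p < sw i q" using Cons.prems(2) False by (auto simp: sw_eq)
    have "{sw i p..<sw i q} \<subseteq> set w"
      using Cons.prems False by (intro Cons.IH[OF _ lt]) (auto split: if_splits)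
    moreover have "{p..<q} \<subseteq> insert i {sw i p..<sw i q}"
      using Cons.prems(2) False by (auto simp: sw_eq)
    ultimately show ?thesis by auto
  qed auto
qed simp

text \<open>Every letter crosses one pair of strands, counted in both orders, hence the factor 2. A
  letter permutes the positions, so the sum for the rest of the word can be reindexed.\<close>

lemma sum_crossings:
  assumes "set w \<subseteq> {a..b}"
  shows "(\<Sum>p\<in>{a..Suc b}. \<Sum>q\<in>{a..Suc b}. crossings w p q) = 2 * length w"
  using assms
proof (induction w)
  case (Cons i w)
  let ?X = "{a..Suc b}"
  have i: "a \<le> i" "i \<le> b" using Cons.prems by auto
  have bij: "bij_betw (sw i) ?X ?X"
    by (rule bij_betwI[of _ _ _ "sw i"]) (use i in \<open>auto simp: sw_eq\<close>)
  have re: "(\<Sum>p\<in>?X. f (sw i p)) = (\<Sum>p\<in>?X. f p)" for f :: "nat \<Rightarrow> nat"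
    by (rule sum.reindex_bij_betw[OF bij])
  have "(\<Sum>p\<in>?X. \<Sum>q\<in>?X. crossings w (sw i p) (sw i q)) =
      (\<Sum>p\<in>?X. \<Sum>q\<in>?X. crossings w p (sw i q))"
    by (rule re)
  also have "\<dots> = (\<Sum>p\<in>?X. \<Sum>q\<in>?X. crossings w p q)"
    by (intro sum.cong HOL.refl re)
  also have "\<dots> = 2 * length w" using Cons by simp
  finally have 1: "(\<Sum>p\<in>?X. \<Sum>q\<in>?X. crossings w (sw i p) (sw i q)) = 2 * length w" .
  have "(\<Sum>q\<in>?X. of_bool (p = i \<and> q = Suc i \<or> p = Suc i \<and> q = i)) =
      (if p = i then 1 else 0) + (if p = Suc i then 1 else (0::nat))" for p
  proof -
    have "(\<Sum>q\<in>?X. of_bool (p = i \<and> q = Suc i \<or> p = Suc i \<and> q = i)) =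
       (\<Sum>q\<in>?X. (if q = Suc i then of_bool (p = i) else 0) + (if q = i then of_bool (p = Suc i) else (0::nat)))"
      by (rule sum.cong) auto
    then show ?thesis using i by (simp add: sum.distrib)
  qed
  then have 2: "(\<Sum>p\<in>?X. \<Sum>q\<in>?X. of_bool (p = i \<and> q = Suc i \<or> p = Suc i \<and> q = i)) = (2::nat)"
    using i by (simp add: sum.distrib)
  show ?case using 1 2 by (simp add: sum.distrib del: sum.cl_ivl_Suc)
qed simp

lemma crossings_eqI:
  assumes "\<And>p q. p < q \<Longrightarrow> crossings u p q = crossings v p q"
  shows "crossings u = crossings v"
proof (intro ext)
  fix p q
  show "crossings u p q = crossings v p q"
    using assms crossings_commute crossings_same by (metis linorder_neqE_nat)
qed

text \<open>Crossings add up to twice the length, so a pointwise lower bound with at least this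
  total is nowhere strict. This is how a length count determines every single crossing
  number.\<close>

lemma crossings_eq_if_length_le:
  assumes "set w \<subseteq> {a..b}" "p \<in> {a..Suc b}" "q \<in> {a..Suc b}"
    and "\<And>p q. p \<in> {a..Suc b} \<Longrightarrow> q \<in> {a..Suc b} \<Longrightarrow> c p q \<le> crossings w p q"
    and "2 * length w \<le> (\<Sum>p\<in>{a..Suc b}. \<Sum>q\<in>{a..Suc b}. c p q)"
  shows "c p q = crossings w p q"
proof (rule ccontr)
  let ?X = "{a..Suc b}"
  assume "c p q \<noteq> crossings w p q"
  then have "c p q < crossings w p q" using assms(2-4) le_neq_implies_less by blast
  then have ex: "\<exists>x\<in>?X. \<exists>y\<in>?X. c x y < crossings w x y" using assms(2,3) by blast
  have "(\<Sum>p\<in>?X. \<Sum>q\<in>?X. c p q) < (\<Sum>p\<in>?X. \<Sum>q\<in>?X. crossings w p q)"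
    unfolding sum.cartesian_product
    by (rule sum_strict_mono_ex1) (use assms(4) ex in auto)
  then show False using assms(5) sum_crossings[OF assms(1)] by linarith
qed

section \<open>Matsumoto's theorem\<close>

text \<open>These turn out to be the reduced words (\<open>reduced_expression_iff\<close>); their
  classes are Garside's permutation braids.\<close>

definition simple_word :: "nat list \<Rightarrow> bool" where
  "simple_word w \<longleftrightarrow> (\<forall>p q. crossings w p q \<le> 1)"

lemma simple_wordD: "simple_word w \<Longrightarrow> crossings w p q \<le> 1"
  by (simp add: simple_word_def)

lemma simple_word_beq: "u \<approx> v \<Longrightarrow> simple_word u \<longleftrightarrow> simple_word v"
  by (simp add: simple_word_def beq_crossings)

lemma simple_word_tl:
  assumes "simple_word (i # w)" shows "simple_word w"
  unfolding simple_word_def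
proof (intro allI)
  fix p q
  show "crossings w p q \<le> 1"
    using simple_wordD[OF assms, of "sw i p" "sw i q"] by simp
qed

lemma simple_word_Cons:
  assumes "simple_word w" "crossings w i (Suc i) = 0"
  shows "simple_word (i # w)"
  unfolding simple_word_def
proof (intro allI)
  fix p q
  show "crossings (i # w) p q \<le> 1"
    using assms(2) crossings_commute[of w i "Suc i"] simple_wordD[OF assms(1), of "sw i p" "sw i q"]
    by (auto simp: sw_eq)
qed

lemma simple_word_crossings:
  assumes "simple_word w" "p < q"
  shows "crossings w p q = of_bool (act w q < act w p)"
proof -
  have "act w p < act w q \<or> act w q < act w p"
    using assms(2) by (metis act_inj less_irrefl linorder_neqE_nat)
  then have "odd (crossings w p q) \<longleftrightarrow> act w q < act w p"
    using odd_crossings[of p q w] assms(2) by auto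
  moreover have "crossings w p q = 0 \<or> crossings w p q = 1"
    using simple_wordD[OF assms(1), of p q] by linarith
  ultimately show ?thesis by auto
qed

text \<open>The exchange condition, by induction on the length and cases on the first letter
  \<open>j\<close>. A distant \<open>j\<close> commutes with \<open>i\<close>. If \<open>j\<close>
  is adjacent to \<open>i\<close>, the order in which three strands end shows that the rest of the
  word can be rewritten to begin with the two letters that complete a braid relation.\<close>

lemma simple_word_exchange:
  "simple_word u \<Longrightarrow> crossings u i (Suc i) = 1 \<Longrightarrow> \<exists>u'. u \<approx> i # u'"
proof (induction "length u" arbitrary: u i rule: less_induct)
  case less
  show ?case
  proof (cases u)
    case Nil
    then show ?thesis using less.prems by simp
  next
    case (Cons j v)
    have sv: "simple_word v" using simple_word_tl less.prems(1) Cons by blast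
    note IH = less.hyps[of v]
    have two: "\<exists>v''. v \<approx> k # l # v''"
      if h: "crossings v k (Suc k) = 1" "crossings v (sw k l) (sw k (Suc l)) = 1" "l \<noteq> k" for k l
    proof -
      obtain v' where v': "v \<approx> k # v'" using IH[OF _ sv h(1)] Cons by auto
      have sv': "simple_word v'" using sv v' simple_word_beq simple_word_tl by blast
      have "crossings v' l (Suc l) = 1"
        using h unfolding beq_crossings[OF v'] by (auto simp: sw_eq split: if_splits)
      then obtain v'' where "v' \<approx> l # v''"
        using less.hyps[of v' l] sv' Cons beq_length[OF v'] by auto
      then show ?thesis using v' beq.trans beq_Cons by blast
    qed
    consider "j = i" | "Suc i < j \<or> Suc j < i" | "j = Suc i" | "i = Suc j" by linarith
    then show ?thesis
    proof cases
      case 1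
      then show ?thesis using Cons beq.refl by blast
    next
      case 2
      then have "crossings v i (Suc i) = 1" using less.prems(2) Cons by (auto simp: sw_eq)
      then obtain v' where v': "v \<approx> i # v'" using IH sv Cons by auto
      have "u \<approx> j # i # v'" using beq_Cons[OF v'] Cons by simp
      also have "\<dots> \<approx> i # j # v'" using 2 by (intro beq_far) auto
      finally show ?thesis by blast
    next
      case 3
      have a: "crossings v i (Suc (Suc i)) = 1" using less.prems(2) Cons 3 by (auto simp: sw_eq)
      \<comment> \<open>The letter \<open>j\<close> in front already crosses these two
        strands.\<close>
      have b: "crossings v (Suc i) (Suc (Suc i)) = 0"
        using simple_wordD[OF less.prems(1), of "Suc (Suc i)" "Suc i"] Cons 3 by (auto simp: sw_eq)
      \<comment> \<open>By \<open>b\<close> the strand at \<open>Suc i\<close> ends to the left of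
        the one at \<open>Suc (Suc i)\<close>, which by \<open>a\<close> ends to the left of the one
        at \<open>i\<close>.\<close>
      have "crossings v i (Suc i) = 1"
        using a b by (auto simp: simple_word_crossings[OF sv] of_bool_def split: if_splits)
      then obtain v'' where "v \<approx> i # Suc i # v''" using two[of i "Suc i"] a by (auto simp: sw_eq)
      then have "u \<approx> Suc i # i # Suc i # v''" using Cons 3 beq_Cons by simp
      also have "\<dots> \<approx> i # Suc i # i # v''" by (rule beq.sym[OF beq_braid])
      finally show ?thesis by blast
    next
      case 4
      have a: "crossings v j (Suc (Suc j)) = 1" using less.prems(2) Cons 4 by (auto simp: sw_eq)
      have b: "crossings v j (Suc j) = 0"
        using simple_wordD[OF less.prems(1), of j "Suc j"] Cons 4 crossings_commute[of v j "Suc j"] 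
        by (auto simp: sw_eq)
      have "act v j \<noteq> act v (Suc j)" by simp
      then have "crossings v (Suc j) (Suc (Suc j)) = 1"
        using a b by (auto simp: simple_word_crossings[OF sv] of_bool_def split: if_splits)
      then obtain v'' where "v \<approx> Suc j # j # v''" using two[of "Suc j" j] a by (auto simp: sw_eq)
      then have "u \<approx> j # Suc j # j # v''" using Cons 4 beq_Cons by simp
      also have "\<dots> \<approx> Suc j # j # Suc j # v''" by (rule beq_braid)
      finally show ?thesis using 4 by blast
    qed
  qed
qed

text \<open>The first letter \<open>i\<close> of \<open>u\<close> crosses the strands
  \<open>i\<close> and \<open>Suc i\<close>, so they cross in \<open>v\<close> as well; the exchange
  lemma brings \<open>i\<close> to the front of \<open>v\<close>, and it can be removed from both
  words.\<close>

theorem matsumoto: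
  "simple_word v \<Longrightarrow> crossings u = crossings v \<Longrightarrow> u \<approx> v"
proof (induction u arbitrary: v)
  case Nil
  have "v = []"
  proof (cases v)
    case (Cons j v')
    then have "crossings v j (Suc j) \<noteq> 0" by simp
    then show ?thesis unfolding Nil.prems(2)[symmetric] by simp
  qed
  then show ?case by simp
next
  case (Cons i u)
  have "crossings v i (Suc i) \<noteq> 0" unfolding Cons.prems(2)[symmetric] by simp
  then have "crossings v i (Suc i) = 1" using simple_wordD[OF Cons.prems(1), of i "Suc i"] by linarith
  then obtain v' where v': "v \<approx> i # v'" using simple_word_exchange Cons.prems(1) by blast
  have eq: "crossings (i # u) = crossings (i # v')" using beq_crossings[OF v'] Cons.prems(2) by (simp only:)
  have "crossings u p q = crossings v' p q" for p q
    using fun_cong[OF fun_cong[OF eq], of "sw i p" "sw i q"] by simp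
  then have "u \<approx> v'"
    using v' Cons.IH[of v'] Cons.prems(1) simple_word_beq simple_word_tl by blast
  then show ?case using v' beq_Cons beq.sym beq.trans by blast
qed

text \<open>If a letter \<open>i\<close> in front would cross two strands a second time,
  \<open>u\<close> can be rewritten to begin with \<open>i\<close>, and the two letters
  \<open>i\<close> cancel in the permutation.\<close>

lemma ex_simple_word: "\<exists>u. simple_word u \<and> act u = act w \<and> set u \<subseteq> set w"
proof (induction w)
  case Nil
  have "simple_word []" by (simp add: simple_word_def)
  then show ?case by blast
next
  case (Cons i w)
  then obtain u where u: "simple_word u" "act u = act w" "set u \<subseteq> set w" by blast
  show ?case
  proof (cases "crossings u i (Suc i) = 0")
    case True
    then show ?thesis using u by (intro exI[of _ "i # u"]) (auto simp: simple_word_Cons fun_eq_iff)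
  next
    case False
    then have "crossings u i (Suc i) = 1" using simple_wordD[OF u(1), of i "Suc i"] by linarith
    then obtain u' where u': "u \<approx> i # u'" using simple_word_exchange u(1) by blast
    have "act u' x = act (i # w) x" for x
      using fun_cong[OF beq_act[OF u'], of "sw i x"] u(2) by simp
    moreover have "simple_word u'" using u' u(1) simple_word_beq simple_word_tl by blast
    moreover have "set u' \<subseteq> set (i # w)" using beq_set[OF u'] u(3) by auto
    ultimately show ?thesis by blast
  qed
qed

text \<open>The permutation determines the parity of each crossing number, and a simple word attains
  the least number of that parity.\<close>

lemma crossings_mono_simple:
  assumes "simple_word u" "act u = act v"
  shows "crossings u p q \<le> crossings v p q"
proof (cases "p = q")
  case False
  then have "odd (crossings u p q) = odd (crossings v p q)"
    using assms(2) by (simp add: odd_crossings)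
  then show ?thesis using simple_wordD[OF assms(1), of p q] by (cases "crossings v p q = 0") auto
qed simp

section \<open>Simple words are the shortest words of their permutation\<close>

lemma ex_letters_bound: "\<exists>b. set w \<subseteq> {0..b::nat}"
  by (metis List.finite_set atLeast0AtMost finite_nat_set_iff_bounded_le atMost_iff subsetI)

lemma length_simple_le:
  assumes "simple_word u" "act u = act v"
  shows "length u \<le> length v"
proof -
  obtain b where b: "set (u @ v) \<subseteq> {0..b}" using ex_letters_bound by blast
  then have "2 * length u = (\<Sum>p\<in>{0..Suc b}. \<Sum>q\<in>{0..Suc b}. crossings u p q)"
    by (subst sum_crossings) auto
  also have "\<dots> \<le> (\<Sum>p\<in>{0..Suc b}. \<Sum>q\<in>{0..Suc b}. crossings v p q)"
    by (intro sum_mono crossings_mono_simple assms)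
  also have "\<dots> = 2 * length v" using b by (subst sum_crossings) auto
  finally show ?thesis by simp
qed

text \<open>The crossings of \<open>u\<close> bound those of \<open>v\<close> from below and the
  length of \<open>v\<close> leaves no room for more, so Matsumoto's theorem applies.\<close>

lemma simple_word_if_length_le:
  assumes "simple_word u" "act u = act v" "length v \<le> length u"
  shows "u \<approx> v"
proof -
  obtain b where b: "set (u @ v) \<subseteq> {0..b}" using ex_letters_bound by blast
  let ?X = "{0..Suc b}"
  have "2 * length v \<le> (\<Sum>p\<in>?X. \<Sum>q\<in>?X. crossings u p q)"
    using b assms(3) by (subst sum_crossings) auto
  then have eq: "crossings u p q = crossings v p q" if "p \<in> ?X" "q \<in> ?X" for p q
    by (rule crossings_eq_if_length_le[rotated -1])
       (use b that crossings_mono_simple[OF assms(1,2)] in auto)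
  have zero: "crossings w p q = 0" if "set w \<subseteq> {0..b}" "p < q" "Suc b < q" for w p q
  proof (rule ccontr)
    assume "crossings w p q \<noteq> 0"
    then have "q - 1 \<in> set w" using crossings_support that(2) by fastforce
    then show False using that by auto
  qed
  have "crossings v = crossings u"
  proof (rule crossings_eqI)
    fix p q :: nat assume "p < q"
    then show "crossings v p q = crossings u p q"
      using eq[of p q] zero[of u p q] zero[of v p q] b by (cases "q \<le> Suc b") auto
  qed
  then show ?thesis using assms(1) matsumoto beq.sym by blast
qed


section \<open>The monoid of positive braids and Garside's cancellation theorem\<close>

quotient_type braid = "nat list" / beq
  by (intro equivpI reflpI sympI transpI) (auto intro: beq.intros)

lift_definition br :: "nat list \<Rightarrow> braid" is "\<lambda>w. w" .

instantiation braid :: monoid_mult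
begin

lift_definition one_braid :: braid is "[]" .

lift_definition times_braid :: "braid \<Rightarrow> braid \<Rightarrow> braid" is "(@)"
  by (rule beq_append)

instance by standard (transfer; simp)+

end

lift_definition blen :: "braid \<Rightarrow> nat" is length
  by (rule beq_length)

lemma br_eq_iff: "br u = br v \<longleftrightarrow> u \<approx> v"
  by transfer simp

lemma br_append [simp]: "br (u @ v) = br u * br v"
  by transfer simp

lemma br_Nil [simp]: "br [] = 1"
  by transfer simp

lemma br_surj: "\<exists>w. x = br w"
  by transfer (rule exI, rule beq.refl)

lemma blen_br [simp]: "blen (br w) = length w"
  by transfer simp

lemma blen_mult [simp]: "blen (x * y) = blen x + blen y"
  by transfer simp

abbreviation gen :: "nat \<Rightarrow> braid" where
  "gen i \<equiv> br [i]"

lemma br_Cons: "br (i # w) = gen i * br w"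
  using br_append[of "[i]" w] by simp

definition adjacent :: "nat \<Rightarrow> nat \<Rightarrow> bool" where
  "adjacent i j \<longleftrightarrow> i = Suc j \<or> j = Suc i"

definition distant :: "nat \<Rightarrow> nat \<Rightarrow> bool" where
  "distant i j \<longleftrightarrow> Suc i < j \<or> Suc j < i"

lemma adjacent_sym: "adjacent i j \<Longrightarrow> adjacent j i"
  by (auto simp: adjacent_def)

lemma distant_sym: "distant i j \<Longrightarrow> distant j i"
  by (auto simp: distant_def)

lemma gen_distant: "distant i j \<Longrightarrow> gen i * gen j = gen j * gen i"
  by (simp add: br_append[symmetric] br_eq_iff distant_def beq_far del: br_append)

lemma gen_adjacent: "adjacent i j \<Longrightarrow> gen i * (gen j * gen i) = gen j * (gen i * gen j)"
  by (auto simp: br_append[symmetric] br_eq_iff adjacent_def beq_braid beq.sym[OF beq_braid] simp del: br_append)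

lemma gen_distant': "distant i j \<Longrightarrow> gen i * (gen j * z) = gen j * (gen i * z)"
  using gen_distant[of i j] by (simp add: mult.assoc[symmetric])

lemma gen_adjacent':
  "adjacent i j \<Longrightarrow> gen i * (gen j * (gen i * z)) = gen j * (gen i * (gen j * z))"
  using gen_adjacent[of i j] by (simp add: mult.assoc[symmetric])

text \<open>\<open>gen i * compl i j\<close> is the least common right multiple of \<open>gen i\<close> and \<open>gen j\<close>.\<close>

definition compl :: "nat \<Rightarrow> nat \<Rightarrow> braid" where
  "compl i j = (if i = j then 1 else if adjacent i j then gen j * gen i else gen j)"

definition lcm_eq :: "nat \<Rightarrow> nat \<Rightarrow> braid \<Rightarrow> braid \<Rightarrow> bool" where
  "lcm_eq i j x y \<longleftrightarrow> (\<exists>z. x = compl i j * z \<and> y = compl j i * z)"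

lemma lcm_eq_same: "lcm_eq i i x y \<longleftrightarrow> x = y"
  by (auto simp: lcm_eq_def compl_def)

lemma lcm_eq_adjacent:
  "adjacent i j \<Longrightarrow> lcm_eq i j x y \<longleftrightarrow> (\<exists>z. x = gen j * (gen i * z) \<and> y = gen i * (gen j * z))"
  by (auto simp: lcm_eq_def compl_def adjacent_def mult.assoc)

lemma lcm_eq_distant:
  "distant i j \<Longrightarrow> lcm_eq i j x y \<longleftrightarrow> (\<exists>z. x = gen j * z \<and> y = gen i * z)"
  by (auto simp: lcm_eq_def compl_def distant_def adjacent_def)

lemma lcm_eq_sym: "lcm_eq i j x y \<Longrightarrow> lcm_eq j i y x"
  by (auto simp: lcm_eq_def)

text \<open>The cube condition: one case for each relative position of \<open>i\<close>, \<open>j\<close>, \<open>k\<close>, up to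
  exchanging \<open>i\<close> and \<open>k\<close>.\<close>

lemma lcm_eq_trans:
  assumes IH: "\<And>i j x y. blen x < blen v \<Longrightarrow> gen i * x = gen j * y \<Longrightarrow> lcm_eq i j x y"
    and "lcm_eq i j u v" "lcm_eq j k v w"
  shows "lcm_eq i k u w"
proof -
  \<comment> \<open>\<open>IH\<close> is available only for factors shorter than \<open>v\<close>;
    these two facts provide the bound for what is left of \<open>v\<close> after one or two
    generators.\<close>
  have L: "blen x < blen v" if "v = gen i * x" for i x using that by simp
  have L2: "blen x < blen v" if "v = gen i * (gen j * x)" for i j x using that by simp
  have E: "x = y" if "gen i * x = gen i * y" "blen x < blen v" for i x y
    using IH[OF that(2,1)] by (simp add: lcm_eq_same)
  have A: "\<exists>z. x = gen j * (gen i * z) \<and> y = gen i * (gen j * z)"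
    if "gen i * x = gen j * y" "blen x < blen v" "adjacent i j" for i j x y
    using IH[OF that(2,1)] that(3) by (simp add: lcm_eq_adjacent)
  have D: "\<exists>z. x = gen j * z \<and> y = gen i * z"
    if "gen i * x = gen j * y" "blen x < blen v" "distant i j" for i j x y
    using IH[OF that(2,1)] that(3) by (simp add: lcm_eq_distant)
  \<comment> \<open>The diagram is an edge from \<open>i\<close> to \<open>j\<close> and an isolated
    vertex \<open>k\<close>.\<close>
  have two: "lcm_eq i k u w"
    if h: "adjacent i j" "distant i k" "distant j k" "lcm_eq i j u v" "lcm_eq j k v w" for i k u w
  proof -
    note * = h(2,3)
    obtain a where a: "u = gen j * (gen i * a)" "v = gen i * (gen j * a)"
      using h lcm_eq_adjacent by blast
    obtain b where b: "v = gen k * b" "w = gen j * b" using h lcm_eq_distant by blast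
    have "gen i * (gen j * a) = gen k * b" using a b by simp
    then obtain c where c: "gen j * a = gen k * c" "b = gen i * c"
      using D[OF _ L[OF a(2)] *(1)] by blast
    obtain d where d: "a = gen k * d" "c = gen j * d"
      using D[OF c(1) L2[OF a(2)] *(2)] by blast
    have "u = gen k * (gen j * (gen i * d))"
      using a d by (simp only: gen_distant'[OF *(1)] gen_distant'[OF *(2)])
    moreover have "w = gen i * (gen j * (gen i * d))"
      using b c d by (simp only: gen_adjacent'[OF h(1)])
    ultimately show ?thesis using h(2) lcm_eq_distant by blast
  qed
  \<comment> \<open>The diagram is a path with \<open>i\<close> in the middle.\<close>
  have six: "lcm_eq i k u w"
    if h: "adjacent i j" "adjacent i k" "distant j k" "lcm_eq i j u v" "lcm_eq j k v w" for i k u w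
  proof -
    note * = h(2,3)
    obtain a where a: "u = gen j * (gen i * a)" "v = gen i * (gen j * a)"
      using h lcm_eq_adjacent by blast
    obtain b where b: "v = gen k * b" "w = gen j * b" using h lcm_eq_distant by blast
    have "gen i * (gen j * a) = gen k * b" using a b by simp
    then obtain c where c: "gen j * a = gen k * (gen i * c)" "b = gen i * (gen k * c)"
      using A[OF _ L[OF a(2)] *(1)] by blast
    obtain d where d: "a = gen k * d" "gen i * c = gen j * d"
      using D[OF c(1) L2[OF a(2)] *(2)] by blast
    have "blen c < blen v" unfolding b c by simp
    then obtain e where e: "c = gen j * (gen i * e)" "d = gen i * (gen j * e)"
      using A[OF d(2) _ h(1)] by blast
    note ij = gen_adjacent'[OF h(1)] and ik = gen_adjacent'[OF h(2)] and jk = gen_distant'[OF h(3)]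
    have "u = gen j * (gen i * (gen k * (gen i * (gen j * e))))" using a d e by simp
    also have "\<dots> = gen k * (gen j * (gen i * (gen j * (gen k * e))))" by (simp only: ik jk)
    also have "\<dots> = gen k * (gen i * (gen j * (gen i * (gen k * e))))" by (simp only: ij)
    finally have u: "u = gen k * (gen i * (gen j * (gen i * (gen k * e))))" .
    have "w = gen j * (gen i * (gen k * (gen j * (gen i * e))))" using b c e by simp
    also have "\<dots> = gen j * (gen i * (gen j * (gen k * (gen i * e))))" by (simp only: jk)
    also have "\<dots> = gen i * (gen j * (gen i * (gen k * (gen i * e))))" by (simp only: ij)
    also have "\<dots> = gen i * (gen j * (gen k * (gen i * (gen k * e))))" by (simp only: ik)
    also have "\<dots> = gen i * (gen k * (gen j * (gen i * (gen k * e))))" by (simp only: jk)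
    finally show ?thesis using u h(2) lcm_eq_adjacent by blast
  qed
  have tri: "x = y \<or> adjacent x y \<or> distant x y" for x y
    unfolding adjacent_def distant_def by linarith
  \<comment> \<open>The Coxeter diagram is a path and contains no triangle.\<close>
  have no: "\<not> (adjacent i j \<and> adjacent j k \<and> adjacent i k)"
    unfolding adjacent_def by auto
  have sym: "adjacent x y = adjacent y x" "distant x y = distant y x" for x y
    using adjacent_sym distant_sym by blast+
  consider "i = j" | "j = k" | "i = k" "i \<noteq> j"
    | "distant i j" "distant j k" "distant i k"
    | "adjacent i j" "distant i k" "distant j k"
    | "adjacent k j" "distant k i" "distant j i"
    | "adjacent i k" "distant i j" "distant j k"
    | "adjacent i j" "adjacent j k" "distant i k"
    | "adjacent i j" "adjacent i k" "distant j k"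
    | "adjacent k j" "adjacent k i" "distant j i"
    using tri[of i j] tri[of j k] tri[of i k] no sym[of i j] sym[of k j] sym[of k i] by argo
  then show ?thesis
  proof cases
    case 1
    then show ?thesis using assms lcm_eq_same by simp
  next
    case 2
    then show ?thesis using assms lcm_eq_same by simp
  next
    case 3
    then consider "adjacent j i" | "distant j i" unfolding adjacent_def distant_def by linarith
    then have "u = w"
    proof cases
      case 1
      obtain a where a: "u = gen j * (gen i * a)" "v = gen i * (gen j * a)"
        using assms(2) 1 adjacent_sym lcm_eq_adjacent by blast
      obtain b where b: "v = gen i * (gen j * b)" "w = gen j * (gen i * b)"
        using assms(3) 1 3 lcm_eq_adjacent by blast
      have "gen i * (gen j * a) = gen i * (gen j * b)" using a b by simp
      then have "gen j * a = gen j * b" using E L[OF a(2)] by blast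
      then have "a = b" using E L2[OF a(2)] by blast
      then show ?thesis using a b by simp
    next
      case 2
      obtain a where a: "u = gen j * a" "v = gen i * a"
        using assms(2) 2 distant_sym lcm_eq_distant by blast
      obtain b where b: "v = gen i * b" "w = gen j * b"
        using assms(3) 2 3 lcm_eq_distant by blast
      have "gen i * a = gen i * b" using a b by simp
      then have "a = b" using E L[OF a(2)] by blast
      then show ?thesis using a b by simp
    qed
    then show ?thesis using 3 lcm_eq_same by simp
  next
    case 4
    obtain a where a: "u = gen j * a" "v = gen i * a" using assms(2) 4 lcm_eq_distant by blast
    obtain b where b: "v = gen k * b" "w = gen j * b" using assms(3) 4 lcm_eq_distant by blast
    have "gen i * a = gen k * b" using a b by simp
    then obtain c where c: "a = gen k * c" "b = gen i * c"
      using D[OF _ L[OF a(2)] 4(3)] by blast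
    have "u = gen k * (gen j * c)" using a c by (simp only: gen_distant'[OF 4(2)])
    moreover have "w = gen i * (gen j * c)" using b c by (simp only: gen_distant'[OF 4(1)])
    ultimately show ?thesis using 4(3) lcm_eq_distant by blast
  next
    case 5
    then show ?thesis using two[of i k u w] assms by blast
  next
    case 6
    then show ?thesis using two[of k i w u] assms lcm_eq_sym by blast
  next
    case 7
    obtain a where a: "u = gen j * a" "v = gen i * a" using assms(2) 7 lcm_eq_distant by blast
    obtain b where b: "v = gen k * b" "w = gen j * b" using assms(3) 7 lcm_eq_distant by blast
    have "gen i * a = gen k * b" using a b by simp
    then obtain c where c: "a = gen k * (gen i * c)" "b = gen i * (gen k * c)"
      using A[OF _ L[OF a(2)] 7(1)] by blast
    note far = gen_distant'[OF 7(2)] gen_distant'[OF 7(3)]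
    have "u = gen k * (gen i * (gen j * c))" using a c by (simp only: far)
    moreover have "w = gen i * (gen k * (gen j * c))" using b c
      by (simp only: gen_distant'[OF distant_sym[OF 7(2)]] gen_distant'[OF 7(3)])
    ultimately show ?thesis using 7(1) lcm_eq_adjacent by blast
  next
    case 8
    obtain a where a: "u = gen j * (gen i * a)" "v = gen i * (gen j * a)"
      using assms(2) 8 lcm_eq_adjacent by blast
    obtain b where b: "v = gen k * (gen j * b)" "w = gen j * (gen k * b)"
      using assms(3) 8 lcm_eq_adjacent by blast
    have l: "blen a = blen b" using arg_cong[OF a(2), of blen] arg_cong[OF b(1), of blen] by simp
    have "gen i * (gen j * a) = gen k * (gen j * b)" using a b by simp
    then obtain c where c: "gen j * a = gen k * c" "gen j * b = gen i * c"
      using D[OF _ L[OF a(2)] 8(3)] by blast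
    obtain d where d: "a = gen k * (gen j * d)" "c = gen j * (gen k * d)"
      using A[OF c(1) L2[OF a(2)] 8(2)] by blast
    obtain e where e: "b = gen i * (gen j * e)" "c = gen j * (gen i * e)"
      using A[OF c(2) _ adjacent_sym[OF 8(1)]] L2[OF a(2)] l by auto
    have "gen j * (gen k * d) = gen j * (gen i * e)" using d e by simp
    moreover have dv: "blen (gen k * d) < blen v" using a(2) d(1) by simp
    moreover have dv2: "blen d < blen v" using a(2) d(1) by simp
    ultimately have "gen k * d = gen i * e" using E by blast
    then obtain f where f: "d = gen i * f" "e = gen k * f"
      using D[OF _ _ distant_sym[OF 8(3)]] dv2 by blast
    note ij = gen_adjacent'[OF 8(1)] and jk = gen_adjacent'[OF 8(2)] and ik = gen_distant'[OF 8(3)]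
    have "u = gen j * (gen i * (gen k * (gen j * (gen i * f))))" using a d f by simp
    also have "\<dots> = gen j * (gen k * (gen i * (gen j * (gen i * f))))" by (simp only: ik)
    also have "\<dots> = gen j * (gen k * (gen j * (gen i * (gen j * f))))" by (simp only: ij)
    also have "\<dots> = gen k * (gen j * (gen k * (gen i * (gen j * f))))" by (simp only: jk)
    finally have u: "u = gen k * (gen j * (gen k * (gen i * (gen j * f))))" .
    have "w = gen j * (gen k * (gen i * (gen j * (gen k * f))))" using b e f by simp
    also have "\<dots> = gen j * (gen i * (gen k * (gen j * (gen k * f))))" by (simp only: ik)
    also have "\<dots> = gen j * (gen i * (gen j * (gen k * (gen j * f))))" by (simp only: jk)
    also have "\<dots> = gen i * (gen j * (gen i * (gen k * (gen j * f))))" by (simp only: ij)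
    also have "\<dots> = gen i * (gen j * (gen k * (gen i * (gen j * f))))" by (simp only: ik)
    finally show ?thesis using u 8(3) lcm_eq_distant by blast
  next
    case 9
    then show ?thesis using six[of i k u w] assms by blast
  next
    case 10
    then show ?thesis using six[of k i w u] assms lcm_eq_sym by blast
  qed
qed

text \<open>Induction over the derivation of \<open>u \<approx> v\<close>: a relation at the front
  exhibits the common multiple, one further right keeps the first letter, and composing two
  derivations is the cube condition, fed with the theorem for shorter words.\<close>

lemma garside_aux:
  assumes "\<And>i j x y. blen x < n \<Longrightarrow> gen i * x = gen j * y \<Longrightarrow> lcm_eq i j x y"
  shows "u \<approx> v \<Longrightarrow> length u = Suc n \<Longrightarrow> lcm_eq (hd u) (hd v) (br (tl u)) (br (tl v))"
proof (induction rule: beq.induct)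
  case (far i j x y)
  show ?case
  proof (cases x)
    case Nil
    have "distant i j" using far by (simp add: distant_def)
    then show ?thesis using Nil br_Cons[of i y] br_Cons[of j y] by (auto simp: lcm_eq_distant)
  next
    case (Cons k x')
    then show ?thesis using beq.far[OF far(1), of x' y]
      by (simp add: lcm_eq_same br_eq_iff del: br_append)
  qed
next
  case (braid x i y)
  show ?case
  proof (cases x)
    case Nil
    have "adjacent i (Suc i)" by (simp add: adjacent_def)
    then show ?thesis
      using Nil br_Cons[of i "Suc i # y"] br_Cons[of "Suc i" "i # y"] br_Cons[of i y]
        br_Cons[of "Suc i" y] br_Cons[of i "i # y"] br_Cons[of "Suc i" "Suc i # y"]
      by (auto simp: lcm_eq_adjacent mult.assoc)
  next
    case (Cons k x')
    then show ?thesis using beq.braid[of x' i y]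
      by (simp add: lcm_eq_same br_eq_iff del: br_append)
  qed
next
  case (refl u)
  then show ?case by (simp add: lcm_eq_same)
next
  case (sym u v)
  then show ?case using beq_length lcm_eq_sym by metis
next
  case (trans u v w)
  have lv: "length v = Suc n" using beq_length[OF trans.hyps(1)] trans.prems by simp
  have n: "blen (br (tl v)) = n" using lv by simp
  show ?case
    using lcm_eq_trans[of "br (tl v)" "hd u" "hd v" "br (tl u)" "hd w" "br (tl w)"] 
      trans.IH trans.prems lv assms unfolding n by blast
qed

theorem garside: "gen i * x = gen j * y \<Longrightarrow> lcm_eq i j x y"
proof (induction "blen x" arbitrary: i j x y rule: less_induct)
  case less
  obtain u v where uv: "x = br u" "y = br v" using br_surj by metis
  have "i # u \<approx> j # v" using less.prems uv by (simp add: br_eq_iff flip: br_Cons)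
  from garside_aux[OF less.hyps this] show ?case using uv by simp
qed

section \<open>Cancellation on both sides\<close>

lemma gen_left_cancel: "gen i * x = gen i * y \<Longrightarrow> x = y"
  using garside[of i x i y] by (simp add: lcm_eq_same)

lemma braid_left_cancel: 
  fixes x y z :: braid
  shows "z * x = z * y \<Longrightarrow> x = y"
proof -
  obtain w where "z = br w" using br_surj by blast
  moreover have "br w * x = br w * y \<Longrightarrow> x = y"
  proof (induction w)
    case (Cons i w)
    then show ?case using gen_left_cancel[of i "br w * x" "br w * y"]
      by (simp add: br_Cons[of i w] mult.assoc)
  qed simp
  ultimately show "z * x = z * y \<Longrightarrow> x = y" by simp
qed

text \<open>The defining relations are invariant under reversal, which carries left cancellation
  over to the right.\<close>

lemma beq_rev: "u \<approx> v \<Longrightarrow> rev u \<approx> rev v"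
proof (induction rule: beq.induct)
  case (far i j x y)
  then show ?case using beq.sym[OF beq.far[OF far, of "rev y" "rev x"]] by simp
next
  case (braid x i y)
  then show ?case using beq.braid[of "rev y" i "rev x"] by simp
qed (auto intro: beq.intros)

lemma braid_right_cancel:
  fixes x y z :: braid
  assumes "x * z = y * z"
  shows "x = y"
proof -
  obtain u v w where uvw: "x = br u" "y = br v" "z = br w" using br_surj by metis
  then have "u @ w \<approx> v @ w" using assms by (simp add: br_eq_iff flip: br_append)
  from beq_rev[OF this] have "br (rev w) * br (rev u) = br (rev w) * br (rev v)"
    by (simp add: br_eq_iff flip: br_append)
  then have "rev u \<approx> rev v" using braid_left_cancel br_eq_iff by blast
  from beq_rev[OF this] show ?thesis using uvw by (simp add: br_eq_iff)
qed


section \<open>Half twists\<close>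

text \<open>A word for the lift of the longest element of the parabolic subgroup of \<open>J\<close>, recognised
  by its crossings: two strands cross, once, iff they start in the same block of \<open>J\<close>.\<close>

definition half_twist_word :: "nat set \<Rightarrow> nat list \<Rightarrow> bool" where
  "half_twist_word J w \<longleftrightarrow> (\<forall>p q. p < q \<longrightarrow> crossings w p q = of_bool ({p..<q} \<subseteq> J))"

text \<open>For finite \<open>J\<close> such a word exists (\<open>half_twist_word_ex\<close>), and
  any two of them are equivalent (\<open>half_twist_word_unique\<close>).\<close>

definition half_twist :: "nat set \<Rightarrow> braid" where
  "half_twist J = br (SOME w. half_twist_word J w)"

lemma half_twist_wordD:
  "half_twist_word J w \<Longrightarrow> p < q \<Longrightarrow> crossings w p q = of_bool ({p..<q} \<subseteq> J)"
  by (simp add: half_twist_word_def)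

lemma half_twist_word_simple: "half_twist_word J w \<Longrightarrow> simple_word w"
  unfolding half_twist_word_def simple_word_def
proof (intro allI)
  fix p q
  assume h: "\<forall>p q. p < q \<longrightarrow> crossings w p q = of_bool ({p..<q} \<subseteq> J)"
  show "crossings w p q \<le> 1"
    using h[rule_format, of p q] h[rule_format, of q p] crossings_commute[of w p q]
    by (cases p q rule: linorder_cases) simp_all
qed

lemma half_twist_word_unique:
  assumes "half_twist_word J u" "half_twist_word J v"
  shows "u \<approx> v"
proof (rule matsumoto)
  show "simple_word v" using assms(2) by (rule half_twist_word_simple)
  show "crossings u = crossings v"
    using assms by (intro crossings_eqI) (simp add: half_twist_word_def)
qed

lemma half_twist_word_beq: "u \<approx> v \<Longrightarrow> half_twist_word J u \<longleftrightarrow> half_twist_word J v"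
  by (simp add: half_twist_word_def beq_crossings)

lemma half_twist_eqI: "half_twist_word J w \<Longrightarrow> half_twist J = br w"
  unfolding half_twist_def br_eq_iff
  by (rule half_twist_word_unique[of J]) (auto intro: someI)

text \<open>A descent at each \<open>j\<close> in \<open>J\<close> makes the final positions
  decrease along every run of \<open>J\<close>, so all pairs in a run cross; pairs separated by a
  missing letter cannot cross.\<close>

lemma half_twist_word_if_descents:
  assumes "simple_word w" "set w \<subseteq> J" "\<And>j. j \<in> J \<Longrightarrow> crossings w j (Suc j) \<noteq> 0"
  shows "half_twist_word J w"
  unfolding half_twist_word_def
proof (intro allI impI)
  fix p q :: nat
  assume "p < q"
  have desc: "act w (Suc j) < act w j" if "j \<in> J" for j
    using assms(3)[OF that] by (simp add: simple_word_crossings[OF assms(1)] split: if_splits)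
  show "crossings w p q = of_bool ({p..<q} \<subseteq> J)"
  proof (cases "{p..<q} \<subseteq> J")
    case True
    have "act w k < act w p" if "p < k" "k \<le> q" for k
      using that
    proof (induction k)
      case (Suc k)
      then have "act w (Suc k) < act w k" using True by (intro desc) auto
      then show ?case using Suc by (cases "p = k") auto
    qed simp
    then show ?thesis
      using True \<open>p < q\<close> by (simp add: simple_word_crossings[OF assms(1)])
  next
    case False
    then show ?thesis using crossings_support[of w p q] \<open>p < q\<close> assms(2) by auto
  qed
qed

lemma simple_word_length_le:
  assumes "simple_word w" "set w \<subseteq> {a..b}"
  shows "length w \<le> (b + 2) * (b + 2)"
proof -
  have "2 * length w = (\<Sum>p\<in>{0..Suc b}. \<Sum>q\<in>{0..Suc b}. crossings w p q)"
    using assms(2) by (subst sum_crossings) auto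
  also have "\<dots> \<le> (\<Sum>p\<in>{0..Suc b}. \<Sum>q\<in>{0..Suc b}. 1)"
    by (intro sum_mono simple_wordD assms(1))
  also have "\<dots> = (b + 2) * (b + 2)" by (simp del: sum.cl_ivl_Suc)
  finally show ?thesis by simp
qed

text \<open>A longest simple word in the letters of \<open>J\<close> works: if some \<open>j\<close>
  in \<open>J\<close> were not a descent, \<open>j\<close> could be put in front of it.\<close>

lemma half_twist_word_ex:
  assumes "finite J" shows "\<exists>w. half_twist_word J w \<and> set w \<subseteq> J"
proof -
  obtain b where b: "J \<subseteq> {0..b}" using assms
    by (metis atLeast0AtMost finite_nat_set_iff_bounded_le atMost_iff subsetI)
  let ?P = "\<lambda>k. \<exists>w. simple_word w \<and> set w \<subseteq> J \<and> length w = k"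
  have bound: "k \<le> (b + 2) * (b + 2)" if "?P k" for k
    using that simple_word_length_le b by (meson order_trans)
  have "?P 0" by (intro exI[of _ "[]"]) (auto simp: simple_word_def)
  then have "?P (Greatest ?P)"
    by (rule GreatestI_nat) (rule bound)
  moreover have le: "l \<le> Greatest ?P" if "?P l" for l
    using that by (rule Greatest_le_nat) (rule bound)
  ultimately obtain w where w: "simple_word w" "set w \<subseteq> J" "length w = Greatest ?P"
    by blast
  have max: "length v \<le> length w" if "simple_word v" "set v \<subseteq> J" for v
    unfolding w(3) by (rule le) (use that in blast)
  have "crossings w j (Suc j) \<noteq> 0" if "j \<in> J" for j
  proof
    assume "crossings w j (Suc j) = 0"
    then have "simple_word (j # w)" using w(1) by (rule simple_word_Cons[rotated])
    moreover have "set (j # w) \<subseteq> J" using w(2) that by simp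
    ultimately have "length (j # w) \<le> length w" by (rule max)
    then show False by simp
  qed
  then show ?thesis using half_twist_word_if_descents[OF w(1,2)] w(2) by blast
qed

lemma act_le_iff: "c \<notin> set w \<Longrightarrow> act w x \<le> c \<longleftrightarrow> x \<le> c"
proof (induction w arbitrary: x)
  case (Cons i w)
  have "sw i x \<le> c \<longleftrightarrow> x \<le> c" using Cons.prems by (auto simp: sw_eq)
  then show ?case using Cons by simp
qed simp

lemma half_twist_word_set:
  assumes "half_twist_word J w" "finite J"
  shows "set w = J"
proof
  show "J \<subseteq> set w"
  proof
    fix j assume "j \<in> J"
    then show "j \<in> set w"
      using crossings_support[of w j "Suc j"] assms(1) by (simp add: half_twist_word_def)
  qed
  show "set w \<subseteq> J"
    using half_twist_word_ex[OF assms(2)] half_twist_word_unique[OF assms(1)] beq_set by blast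
qed

lemma obtain_half_twist_word:
  assumes "finite J"
  obtains w where "half_twist_word J w" "half_twist J = br w" "set w = J"
  using assms half_twist_word_ex half_twist_eqI half_twist_word_set by metis

lemma act_ge_iff: "c = 0 \<or> c - 1 \<notin> set w \<Longrightarrow> c \<le> act w x \<longleftrightarrow> c \<le> x"
  using act_le_iff[of "c - 1" w x] by (cases c) auto

lemma act_fixed: "c = 0 \<or> c - 1 \<notin> set w \<Longrightarrow> c \<notin> set w \<Longrightarrow> act w c = c"
  using act_le_iff[of c w c] act_ge_iff[of c w c] by simp

text \<open>Final positions strictly decrease along the block and remain between \<open>a\<close>
  and \<open>c\<close>, because \<open>a - 1\<close> and \<open>c\<close> are not letters; only the
  reflection is left. The case \<open>a = 0\<close> guards the truncated
  \<open>a - 1\<close>.\<close>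

lemma half_twist_word_act:
  assumes "half_twist_word J w" "finite J" "{a..<c} \<subseteq> J" "a = 0 \<or> a - 1 \<notin> J" "c \<notin> J"
    and "a \<le> x" "x \<le> c"
  shows "act w x = a + c - x"
proof -
  have J: "set w = J" using half_twist_word_set assms by blast
  have desc: "act w (Suc j) < act w j" if "j \<in> J" for j
    using half_twist_wordD[OF assms(1), of j "Suc j"] that
    by (simp add: simple_word_crossings[OF half_twist_word_simple[OF assms(1)]] of_bool_def split: if_splits)
  have 1: "a + (c - x) \<le> act w x" if "a \<le> x" "x \<le> c" for x
    using that
  proof (induction "c - x" arbitrary: x)
    case 0
    then show ?case using act_ge_iff[of a w x] assms(4) J by auto
  next
    case (Suc d)
    then have "a + (c - Suc x) \<le> act w (Suc x)" by simp
    moreover have "act w (Suc x) < act w x" using Suc assms(3) by (intro desc) auto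
    ultimately show ?case using Suc by linarith
  qed
  have "act w x + (x - a) \<le> c" if "a \<le> x" "x \<le> c" for x
    using that
  proof (induction "x - a" arbitrary: x)
    case 0
    then show ?case using act_le_iff[of c w x] assms(5) J by auto
  next
    case (Suc d)
    then have "act w (x - 1) + (x - 1 - a) \<le> c" by (intro Suc.hyps(1)) auto
    moreover have "x - 1 \<in> {a..<c}" using Suc.hyps(2) Suc.prems by auto
    then have "act w (Suc (x - 1)) < act w (x - 1)" using assms(3) by (intro desc) blast
    ultimately show ?case using Suc.hyps(2) Suc.prems by simp
  qed
  from this[OF assms(6,7)] 1[OF assms(6,7)] show ?thesis using assms(6,7) by linarith
qed

text \<open>The reflection forces every pair to cross at least once. The bound is the number of
  ordered pairs of distinct positions among \<open>b + 2 - a\<close>, so there is no further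
  crossing.\<close>

lemma half_twist_word_intervalI:
  assumes "set w \<subseteq> {a..<Suc b}" "a \<le> b" "\<And>x. a \<le> x \<Longrightarrow> x \<le> Suc b \<Longrightarrow> act w x = a + Suc b - x"
    and "2 * length w \<le> (b + 2 - a) * (b + 1 - a)"
  shows "half_twist_word {a..<Suc b} w"
proof -
  let ?X = "{a..Suc b}"
  have ge: "of_bool (p \<noteq> q) \<le> crossings w p q" if "p \<in> ?X" "q \<in> ?X" for p q
  proof (cases "p = q")
    case False
    have "(p < q) \<noteq> (act w p < act w q)" using that False assms(3) by auto
    then have "odd (crossings w p q)" using odd_crossings[OF False] by simp
    then show ?thesis by (cases "crossings w p q = 0") auto
  qed simp
  have card: "(\<Sum>p\<in>?X. \<Sum>q\<in>?X. of_bool (p \<noteq> q)) = (b + 2 - a) * (b + 1 - a)"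
  proof -
    have "(\<Sum>q\<in>?X. of_bool (p \<noteq> q)) = card (?X - {p})" if "p \<in> ?X" for p
    proof -
      have "(\<Sum>q\<in>?X. of_bool (p \<noteq> q)) = (\<Sum>q\<in>?X - {p}. (1::nat))"
        by (rule sum.mono_neutral_cong_right) auto
      then show ?thesis by simp
    qed
    then have "(\<Sum>p\<in>?X. \<Sum>q\<in>?X. of_bool (p \<noteq> q)) = (\<Sum>p\<in>?X. b + 1 - a)"
      by (intro sum.cong) (auto simp del: sum.cl_ivl_Suc)
    then show ?thesis by (simp del: sum.cl_ivl_Suc)
  qed
  have eq: "of_bool (p \<noteq> q) = crossings w p q" if "p \<in> ?X" "q \<in> ?X" for p q
    by (rule crossings_eq_if_length_le[of w a b p q "\<lambda>p q. of_bool (p \<noteq> q)"])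
       (use assms(1) that ge card assms(4) in auto)
  show ?thesis
    unfolding half_twist_word_def
  proof (intro allI impI)
    fix p q :: nat assume pq: "p < q"
    show "crossings w p q = of_bool ({p..<q} \<subseteq> {a..<Suc b})"
    proof (cases "{p..<q} \<subseteq> {a..<Suc b}")
      case True
      then have "p \<in> ?X" "q \<in> ?X" using pq by auto
      then show ?thesis using eq[of p q] True pq by simp
    next
      case False
      then have "\<not> {p..<q} \<subseteq> set w" using assms(1) by blast
      then show ?thesis using crossings_support[of w p q] pq False by auto
    qed
  qed
qed

lemma half_twist_word_length:
  assumes "half_twist_word {a..<Suc b} w" "a \<le> b"
  shows "2 * length w = (b + 2 - a) * (b + 1 - a)"
proof -
  let ?X = "{a..Suc b}"
  have "(\<Sum>q\<in>?X. crossings w p q) = b + 1 - a" if "p \<in> ?X" for p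
  proof -
    have "crossings w p q = 1" if "q \<in> ?X - {p}" for q
      using that \<open>p \<in> ?X\<close> assms(1) crossings_commute[of w p q]
      by (cases p q rule: linorder_cases) (auto simp: half_twist_word_def)
    then have "(\<Sum>q\<in>?X. crossings w p q) = (\<Sum>q\<in>?X - {p}. (1::nat))"
      by (intro sum.mono_neutral_cong_right) auto
    then show ?thesis using that by simp
  qed
  then have "(\<Sum>p\<in>?X. \<Sum>q\<in>?X. crossings w p q) = (\<Sum>p\<in>?X. b + 1 - a)"
    by (rule sum.cong[OF HOL.refl])
  moreover have "set w \<subseteq> {a..b}" using half_twist_word_set[OF assms(1)] by auto
  ultimately show ?thesis using sum_crossings[of w a b] by (simp del: sum.cl_ivl_Suc)
qed

lemma half_twist_Un_word:
  assumes "orthogonal_sets J K" "half_twist_word J u" "half_twist_word K v" "finite J" "finite K"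
  shows "half_twist_word (J \<union> K) (u @ v)"
  unfolding half_twist_word_def
proof (intro allI impI)
  fix p q :: nat assume pq: "p < q"
  have u: "set u = J" and v: "set v = K" using half_twist_word_set assms by blast+
  have o: "j \<notin> J" "j - 1 \<notin> J" "Suc j \<notin> J" if "j \<in> K" for j
    using assms(1) that unfolding orthogonal_sets_def by fastforce+
  have fix1: "act u j = j" "act u (Suc j) = Suc j" if "j \<in> K" for j
    using act_fixed[of j u] act_fixed[of "Suc j" u] o[OF that] u by auto
  \<comment> \<open>Neighbouring letters never belong to different ones of the two sets, so a run of
    the union lies in one of them.\<close>
  have iv: "{p..<q} \<subseteq> J \<or> {p..<q} \<subseteq> K" if sub: "{p..<q} \<subseteq> J \<union> K"
  proof (rule ccontr)
    assume "\<not> ?thesis"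
    then obtain x y where xy: "x \<in> {p..<q}" "x \<notin> K" "y \<in> {p..<q}" "y \<notin> J" by blast
    have mem: "z \<in> J \<union> K" if "p \<le> z" "z < q" for z
      using sub that by (meson atLeastLessThan_iff subsetD)
    have A: "z \<in> J" if "x \<le> z" "z < q" for z
      using that
    proof (induction z rule: dec_induct)
      case base
      then show ?case using xy mem by auto
    next
      case (step z)
      then show ?case using mem[of "Suc z"] xy o[of "Suc z"] by auto
    qed
    have B: "z \<in> K" if "y \<le> z" "z < q" for z
      using that
    proof (induction z rule: dec_induct)
      case base
      then show ?case using xy mem by auto
    next
      case (step z)
      then show ?case using mem[of "Suc z"] xy o[of z] by auto
    qed
    have "q - 1 \<in> J" "q - 1 \<in> K" using A[of "q - 1"] B[of "q - 1"] xy by auto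
    then show False using o by blast
  qed
  show "crossings (u @ v) p q = of_bool ({p..<q} \<subseteq> J \<union> K)"
  proof (cases "{p..<q} \<subseteq> J")
    case True
    have cu: "crossings u p q = 1" using True half_twist_wordD[OF assms(2) pq] by simp
    then have lt: "act u q < act u p"
      using pq by (simp add: simple_word_crossings[OF half_twist_word_simple[OF assms(2)]] of_bool_def split: if_splits)
    have "crossings v (act u p) (act u q) = 0"
    proof (rule ccontr)
      assume "crossings v (act u p) (act u q) \<noteq> 0"
      then have "{act u q..<act u p} \<subseteq> K"
        using crossings_support[of v "act u q" "act u p"] lt crossings_commute[of v "act u p"] v by simp
      then have "act u q \<notin> J" using o lt by auto
      then have "q \<le> act u q" using act_le_iff[of "act u q" u q] u by simp
      then show False using act_le_iff[of "act u q" u p] u \<open>act u q \<notin> J\<close> pq lt by simp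
    qed
    then show ?thesis using cu True by auto
  next
    case False
    then have cu: "crossings u p q = 0" using half_twist_wordD[OF assms(2) pq] by simp
    then have "\<not> act u q < act u p"
      using pq by (simp add: simple_word_crossings[OF half_twist_word_simple[OF assms(2)]])
    then have lt: "act u p < act u q" using pq by (metis act_inj linorder_neqE_nat less_irrefl)
    have "{act u p..<act u q} \<subseteq> K \<longleftrightarrow> {p..<q} \<subseteq> K"
    proof
      assume h: "{act u p..<act u q} \<subseteq> K"
      then have "act u p \<in> K" "act u q - 1 \<in> K" using lt by auto
      then have "act u (act u p) = act u p" "act u (act u q) = act u q"
        using fix1[of "act u p"] fix1[of "act u q - 1"] lt by auto
      then show "{p..<q} \<subseteq> K" using h by simp
    next
      assume h: "{p..<q} \<subseteq> K"
      then have "p \<in> K" "q - 1 \<in> K" using pq by auto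
      then have "act u p = p" "act u q = q" using fix1[of p] fix1[of "q - 1"] pq by auto
      then show "{act u p..<act u q} \<subseteq> K" using h by simp
    qed
    then show ?thesis using cu half_twist_wordD[OF assms(3) lt] iv False by auto
  qed
qed

lemma half_twist_Un:
  assumes "orthogonal_sets J K" "finite J" "finite K"
  shows "half_twist (J \<union> K) = half_twist J * half_twist K"
proof -
  obtain u v where uv: "half_twist_word J u" "half_twist J = br u" 
      "half_twist_word K v" "half_twist K = br v"
    using obtain_half_twist_word assms by metis
  show ?thesis
    using half_twist_eqI[OF half_twist_Un_word[OF assms(1) uv(1,3) assms(2,3)]] uv by simp
qed

lemma half_twist_empty [simp]: "half_twist {} = 1"
  using half_twist_eqI[of "{}" "[]"] by (simp add: half_twist_word_def)

lemma half_twist_singleton [simp]: "half_twist {j} = gen j"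
proof (rule half_twist_eqI)
  show "half_twist_word {j} [j]"
    unfolding half_twist_word_def
  proof (intro allI impI)
    fix p q :: nat assume "p < q"
    have "p = j \<and> q = Suc j" if "{p..<q} \<subseteq> {j}"
    proof -
      have "p \<in> {p..<q}" "q - 1 \<in> {p..<q}" using \<open>p < q\<close> by auto
      then have "p \<in> {j}" "q - 1 \<in> {j}" using that by blast+
      then show ?thesis using \<open>p < q\<close> by auto
    qed
    then have "{p..<q} \<subseteq> {j} \<longleftrightarrow> p = j \<and> q = Suc j" by auto
    then show "crossings [j] p q = of_bool ({p..<q} \<subseteq> {j})" using \<open>p < q\<close> by auto
  qed
qed

lemma br_self_orthogonal:
  "distinct w \<Longrightarrow> self_orthogonal (set w) \<Longrightarrow> br w = half_twist (set w)"
proof (induction w)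
  case (Cons i w)
  have "orthogonal_sets {i} (set w)"
    unfolding orthogonal_sets_def
  proof (intro ballI)
    fix j k assume "j \<in> {i}" "k \<in> set w"
    then have "j \<noteq> k" "Suc j \<noteq> k" "Suc k \<noteq> j"
      using Cons.prems unfolding self_orthogonal_def by auto
    then show "1 < \<bar>int j - int k\<bar>" by linarith
  qed
  then have "half_twist (set (i # w)) = gen i * half_twist (set w)"
    using half_twist_Un[of "{i}" "set w"] by simp
  moreover have "br w = half_twist (set w)"
    using Cons by (auto simp: self_orthogonal_def)
  ultimately show ?case by (metis br_Cons)
qed simp

text \<open>Removing \<open>i\<close> from the front of a word for the half twist and appending the
  mirror letter changes neither its reflection of the block nor its length, so the result is again a
  half twist.\<close>

lemma half_twist_flip:
  assumes "a \<le> i" "i \<le> b"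
  shows "gen i * half_twist {a..<Suc b} = half_twist {a..<Suc b} * gen (a + b - i)"
proof -
  obtain w where w: "half_twist_word {a..<Suc b} w" "half_twist {a..<Suc b} = br w" "set w = {a..<Suc b}"
    using obtain_half_twist_word by blast
  have ab: "a \<le> b" using assms by simp
  have act: "act w x = a + Suc b - x" if "a \<le> x" "x \<le> Suc b" for x
    by (rule half_twist_word_act[OF w(1)]) (use that in auto)
  have "crossings w i (Suc i) = 1" using half_twist_wordD[OF w(1), of i "Suc i"] assms by simp
  then obtain u where u: "w \<approx> i # u"
    using simple_word_exchange half_twist_word_simple w(1) by blast
  have actu: "act u x = act w (sw i x)" for x
    using fun_cong[OF beq_act[OF u], of "sw i x"] by simp
  let ?j = "a + b - i"
  have "half_twist_word {a..<Suc b} (u @ [?j])"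
  proof (rule half_twist_word_intervalI[OF _ ab])
    have "set u \<subseteq> set w" unfolding beq_set[OF u] by auto
    then show "set (u @ [?j]) \<subseteq> {a..<Suc b}" using w(3) assms by auto
    show "2 * length (u @ [?j]) \<le> (b + 2 - a) * (b + 1 - a)"
      using beq_length[OF u] half_twist_word_length[OF w(1) ab] by simp
    fix x assume x: "a \<le> x" "x \<le> Suc b"
    have "a \<le> sw i x" "sw i x \<le> Suc b" using x assms by (auto simp: sw_eq)
    then have "act u x = a + Suc b - sw i x" using actu act by simp
    then show "act (u @ [?j]) x = a + Suc b - x" using x assms by (auto simp: sw_eq)
  qed
  then have "br u * gen ?j = half_twist {a..<Suc b}" using half_twist_eqI by fastforce
  moreover have "half_twist {a..<Suc b} = gen i * br u"
    using u w(2) by (metis br_Cons br_eq_iff)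
  ultimately show ?thesis by (metis mult.assoc)
qed


section \<open>The presented braid monoid\<close>

definition word_class :: "nat \<Rightarrow> nat list \<Rightarrow> nat list set" where
  "word_class n w = word_cong {1..n} (braid_rels n) `` {w}"

lemma word_cong_imp_beq: "(u, v) \<in> word_cong {1..n} (braid_rels n) \<Longrightarrow> u \<approx> v"
proof (induction rule: word_cong.induct)
  case (rel u v x y)
  consider i where "u = [i, Suc i, i]" "v = [Suc i, i, Suc i]"
    | i j where "u = [i, j]" "v = [j, i]" "\<bar>int i - int j\<bar> > 1"
    using rel(1) unfolding braid_rels_def by blast
  then show ?case
  proof cases
    case 1
    then show ?thesis using beq.braid by simp
  next
    case 2
    then consider "Suc i < j" | "Suc j < i" by linarith
    then show ?thesis using 2 beq.far[of i j x y] beq.sym[OF beq.far[of j i x y]] by cases auto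
  qed
qed (auto intro: beq.intros)

lemma beq_imp_word_cong:
  "u \<approx> v \<Longrightarrow> set u \<subseteq> {1..n} \<Longrightarrow> (u, v) \<in> word_cong {1..n} (braid_rels n)"
proof (induction rule: beq.induct)
  case (far i j x y)
  have "([i, j], [j, i]) \<in> braid_rels n" using far by (auto simp: braid_rels_def)
  then show ?case using far by (intro word_cong.rel) auto
next
  case (braid x i y)
  have "([i, Suc i, i], [Suc i, i, Suc i]) \<in> braid_rels n" using braid by (auto simp: braid_rels_def)
  then show ?case using braid by (intro word_cong.rel) auto
next
  case (sym u v)
  show ?case
    by (rule word_cong.sym, rule sym.IH) (use sym.prems beq_set[OF sym.hyps] in simp)
next
  case (trans u v w)
  then show ?case using beq_set[OF trans.hyps(1)] by (blast intro: word_cong.trans)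
qed (auto intro: word_cong.refl)

text \<open>The relation \<open>\<approx>\<close> puts no bound on the letters. As its relations
  preserve the set of letters, it restricts to the presented congruence in every rank at
  once.\<close>

lemma word_cong_iff_beq:
  "set u \<subseteq> {1..n} \<Longrightarrow> (u, v) \<in> word_cong {1..n} (braid_rels n) \<longleftrightarrow> u \<approx> v"
  using word_cong_imp_beq beq_imp_word_cong by blast

lemma word_class_eq_iff:
  assumes "set u \<subseteq> {1..n}" "set v \<subseteq> {1..n}"
  shows "word_class n u = word_class n v \<longleftrightarrow> u \<approx> v"
proof -
  have "word_class n u = word_class n v \<longleftrightarrow> (u, v) \<in> word_cong {1..n} (braid_rels n)"
    unfolding word_class_def by (rule eq_equiv_class_iff[OF equiv_word_cong]) (use assms in auto)
  then show ?thesis using word_cong_iff_beq[OF assms(1)] by simp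
qed

lemma list_prod_word_class:
  "\<forall>w\<in>set ws. set w \<subseteq> {1..n} \<Longrightarrow>
    list_prod (braid_monoid n) (map (word_class n) ws) = word_class n (concat ws)"
proof (induction ws)
  case Nil
  then show ?case
    by (simp add: list_prod_def braid_monoid_def presented_monoid_def word_class_def)
next
  case (Cons w ws)
  have "list_prod (braid_monoid n) (map (word_class n) (w # ws)) =
      word_class n w \<otimes>\<^bsub>braid_monoid n\<^esub> word_class n (concat ws)"
    using Cons by (simp add: list_prod_def)
  also have "\<dots> = word_class n (w @ concat ws)"
    unfolding braid_monoid_def word_class_def
    by (rule presented_mult_class) (use Cons.prems in \<open>simp_all add: in_lists_conv_set subset_iff\<close>)
  finally show ?case by simp
qed

lemma list_prod_braid_gen:
  assumes "set w \<subseteq> {1..n}"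
  shows "list_prod (braid_monoid n) (map (braid_gen n) w) = word_class n w"
proof -
  have "map (braid_gen n) w = map (word_class n) (map (\<lambda>i. [i]) w)"
    by (simp add: braid_gen_def word_class_def)
  moreover have "list_prod (braid_monoid n) (map (word_class n) (map (\<lambda>i. [i]) w)) =
      word_class n (concat (map (\<lambda>i. [i]) w))"
    by (rule list_prod_word_class) (use assms in auto)
  moreover have "concat (map (\<lambda>i. [i]) w) = w" by simp
  ultimately show ?thesis by (simp only:)
qed

section \<open>Reduced expressions and longest elements\<close>

definition perm_of :: "nat list \<Rightarrow> nat \<Rightarrow> nat" where
  "perm_of w = foldr (\<circ>) (map sw w) id"

lemma perm_of_simps [simp]: "perm_of [] = id" "perm_of (i # w) = sw i \<circ> perm_of w"
  by (simp_all add: perm_of_def)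

lemma perm_of_append: "perm_of (u @ v) = perm_of u \<circ> perm_of v"
  by (induction u) auto

lemma is_expression_iff: "is_expression n f w \<longleftrightarrow> set w \<subseteq> {1..n} \<and> perm_of w = f"
  by (simp add: is_expression_def list_prod_def perm_of_def sym_group_def)

text \<open>As a composition of functions \<open>perm_of\<close> applies the last letter first,
  whereas \<open>act\<close> begins with the first one; the two permutations are inverse to each
  other.\<close>

lemma act_perm_of: "act w (perm_of w x) = x"
  by (induction w) auto

lemma perm_of_act: "perm_of w (act w x) = x"
  using act_perm_of[of w "act w x"] by simp

lemma perm_of_eq_iff: "perm_of u = perm_of v \<longleftrightarrow> act u = act v"
proof
  assume h: "perm_of u = perm_of v"
  show "act u = act v"
  proof
    fix x show "act u x = act v x"
      using act_perm_of[of u "act v x"] perm_of_act[of v x] h by simp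
  qed
next
  assume h: "act u = act v"
  show "perm_of u = perm_of v"
  proof
    fix x show "perm_of u x = perm_of v x"
      using perm_of_act[of u "perm_of v x"] act_perm_of[of v x] h by simp
  qed
qed

lemma perm_length_simple:
  assumes "simple_word u" "set u \<subseteq> {1..n}"
  shows "perm_length n (perm_of u) = length u"
  unfolding perm_length_def
proof (rule Least_equality)
  show "\<exists>is. is_expression n (perm_of u) is \<and> length is = length u"
    using assms by (auto simp: is_expression_iff)
  fix k assume "\<exists>is. is_expression n (perm_of u) is \<and> length is = k"
  then obtain v where "perm_of v = perm_of u" "length v = k" by (auto simp: is_expression_iff)
  then show "length u \<le> k" using length_simple_le[OF assms(1), of v] by (simp add: perm_of_eq_iff)
qed

text \<open>This makes the choice of a reduced expression in \<open>braid_lift\<close>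
  harmless.\<close>

lemma reduced_expression_iff:
  assumes "simple_word u" "set u \<subseteq> {1..n}"
  shows "is_reduced_expression n (perm_of u) v \<longleftrightarrow> u \<approx> v"
proof
  assume "is_reduced_expression n (perm_of u) v"
  then have "act u = act v" "length v \<le> length u"
    using perm_length_simple[OF assms]
    by (auto simp: is_reduced_expression_def is_expression_iff perm_of_eq_iff)
  then show "u \<approx> v" using simple_word_if_length_le[OF assms(1)] by blast
next
  assume h: "u \<approx> v"
  then show "is_reduced_expression n (perm_of u) v"
    using perm_length_simple[OF assms] beq_set[OF h] beq_length[OF h] beq_act[OF h] assms(2)
    by (simp add: is_reduced_expression_def is_expression_iff perm_of_eq_iff)
qed

text \<open>The generators are involutions, so inverses contribute no new products.\<close>

lemma parabolic_subgroup_eq: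
  assumes "J \<subseteq> {1..n}"
  shows "parabolic_subgroup n J = perm_of ` lists J"
proof
  have inv: "inv\<^bsub>sym_group (Suc n)\<^esub> (sw i) = sw i" if "i \<in> J" for i
  proof (rule group.inv_equality[OF sym_group_is_group])
    have "sw i permutes {1..Suc n}" unfolding simple_transposition_def
      by (rule permutes_swap_id) (use that assms in auto)
    then show "sw i \<in> carrier (sym_group (Suc n))" "sw i \<in> carrier (sym_group (Suc n))"
      by (simp_all add: sym_group_carrier)
    show "sw i \<otimes>\<^bsub>sym_group (Suc n)\<^esub> sw i = \<one>\<^bsub>sym_group (Suc n)\<^esub>"
      by (simp add: sym_group_def fun_eq_iff)
  qed
  have one: "sw i \<in> perm_of ` lists J" if "i \<in> J" for i
    using that by (intro image_eqI[of _ _ "[i]"]) auto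
  show "parabolic_subgroup n J \<subseteq> perm_of ` lists J"
  proof
    fix f assume "f \<in> parabolic_subgroup n J"
    then show "f \<in> perm_of ` lists J"
      unfolding parabolic_subgroup_def
    proof (induction rule: generate.induct)
      case one
      show ?case by (intro image_eqI[of _ _ "[]"]) (auto simp: sym_group_def)
    next
      case (incl h)
      then show ?case using one by blast
    next
      case (inv h)
      then show ?case using one \<open>\<And>i. i \<in> J \<Longrightarrow> inv\<^bsub>sym_group (Suc n)\<^esub> (sw i) = sw i\<close> by auto
    next
      case (eng g h)
      then obtain u v where "g = perm_of u" "u \<in> lists J" "h = perm_of v" "v \<in> lists J" by blast
      then show ?case
        by (intro image_eqI[of _ _ "u @ v"]) (auto simp: sym_group_def perm_of_append)
    qed
  qed
  show "perm_of ` lists J \<subseteq> parabolic_subgroup n J"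
  proof
    fix f assume "f \<in> perm_of ` lists J"
    then obtain w where "f = perm_of w" "set w \<subseteq> J" by auto
    moreover have "set w \<subseteq> J \<Longrightarrow> perm_of w \<in> parabolic_subgroup n J" for w
    proof (induction w)
      case Nil
      show ?case unfolding perm_of_simps parabolic_subgroup_def
        by (rule generate.one[of "sym_group (Suc n)", unfolded sym_group_one])
    next
      case (Cons i w)
      then show ?case
        using generate.eng[OF generate.incl[of "sw i" "sw ` J" "sym_group (Suc n)"], of "perm_of w"]
        by (simp add: parabolic_subgroup_def sym_group_mult del: comp_apply)
    qed
    ultimately show "f \<in> parabolic_subgroup n J" by blast
  qed
qed

text \<open>An element of maximal length has a descent at each \<open>j\<close> in \<open>J\<close>,
  as otherwise \<open>j\<close> could be put in front. The bound on lengths guarantees that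
  \<open>ARG_MAX\<close> picks an actual maximum.\<close>

lemma longest_element_eq:
  assumes "J \<subseteq> {1..n}"
  shows "\<exists>u. half_twist_word J u \<and> set u = J \<and> longest_element n J = perm_of u"
proof -
  have rep: "\<exists>u. simple_word u \<and> set u \<subseteq> J \<and> perm_of u = f" if "f \<in> parabolic_subgroup n J" for f
  proof -
    obtain v where "f = perm_of v" "set v \<subseteq> J" using \<open>f \<in> _\<close> unfolding parabolic_subgroup_eq[OF assms] by auto
    then show ?thesis using ex_simple_word[of v] perm_of_eq_iff by (metis order_trans)
  qed
  have bound: "\<forall>f. f \<in> parabolic_subgroup n J \<longrightarrow> perm_length n f < Suc ((n + 2) * (n + 2))"
  proof (intro allI impI)
    fix f assume "f \<in> parabolic_subgroup n J"
    then obtain u where "simple_word u" "set u \<subseteq> J" "perm_of u = f" using rep by blast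
    moreover from this have "set u \<subseteq> {1..n}" using assms by blast
    ultimately show "perm_length n f < Suc ((n + 2) * (n + 2))"
      using perm_length_simple[of u n] simple_word_length_le[of u 1 n] by simp
  qed
  have "perm_of [] \<in> parabolic_subgroup n J"
    unfolding parabolic_subgroup_eq[OF assms] by (intro image_eqI[of _ _ "[]"]) auto
  then have mem: "longest_element n J \<in> parabolic_subgroup n J"
    and max: "\<And>f. f \<in> parabolic_subgroup n J \<Longrightarrow> perm_length n f \<le> perm_length n (longest_element n J)"
    unfolding longest_element_def using arg_max_nat_lemma[OF _ bound] by blast+
  obtain u where u: "simple_word u" "set u \<subseteq> J" "perm_of u = longest_element n J"
    using rep[OF mem] by blast
  have "half_twist_word J u"
  proof (rule half_twist_word_if_descents[OF u(1,2)])
    fix j assume j: "j \<in> J"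
    show "crossings u j (Suc j) \<noteq> 0"
    proof
      assume "crossings u j (Suc j) = 0"
      then have s: "simple_word (j # u)" by (rule simple_word_Cons[OF u(1)])
      have sub: "set (j # u) \<subseteq> J" using u(2) j by simp
      then have "perm_of (j # u) \<in> parabolic_subgroup n J"
        unfolding parabolic_subgroup_eq[OF assms] by (intro imageI) auto
      from max[OF this] have "length (j # u) \<le> length u"
        unfolding u(3)[symmetric] perm_length_simple[OF s order_trans[OF sub assms]]
          perm_length_simple[OF u(1) order_trans[OF u(2) assms]] .
      then show False by simp
    qed
  qed
  then show ?thesis using u(3) half_twist_word_set assms finite_subset by (metis finite_atLeastAtMost)
qed

lemma braid_lift_longest:
  assumes "J \<subseteq> {1..n}"
  obtains u where "half_twist_word J u" "set u = J"
    "braid_lift n (longest_element n J) = word_class n u"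
proof -
  obtain v where v: "half_twist_word J v" "set v = J" "longest_element n J = perm_of v"
    using longest_element_eq[OF assms] by blast
  let ?u = "SOME is. is_reduced_expression n (longest_element n J) is"
  have iff: "is_reduced_expression n (longest_element n J) w \<longleftrightarrow> v \<approx> w" for w
    unfolding v(3) by (rule reduced_expression_iff) (use v assms half_twist_word_simple in auto)
  have vu: "v \<approx> ?u" unfolding iff by (rule someI[of _ v]) simp
  show ?thesis
  proof (rule that)
    show "half_twist_word J ?u" using half_twist_word_beq[OF vu] v(1) by blast
    show "set ?u = J" using beq_set[OF vu] v(2) by simp
    then show "braid_lift n (longest_element n J) = word_class n ?u"
      unfolding braid_lift_def by (intro list_prod_braid_gen) (use assms in simp)
  qed
qed

lemma Union_word_class:
  assumes "set u \<subseteq> {1..n}" shows "(\<Union>w\<in>word_class n u. set w) = set u"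
proof
  show "(\<Union>w\<in>word_class n u. set w) \<subseteq> set u"
    using word_cong_imp_beq beq_set unfolding word_class_def by fastforce
  have "u \<in> word_class n u" using word_cong.refl[OF assms] by (simp add: word_class_def)
  then show "set u \<subseteq> (\<Union>w\<in>word_class n u. set w)" by blast
qed

section \<open>Homomorphisms from the dihedral monoid\<close>

primrec alt_prod :: "nat \<Rightarrow> 'a::monoid_mult \<Rightarrow> 'a \<Rightarrow> 'a" where
  "alt_prod 0 x y = 1"
| "alt_prod (Suc k) x y = x * alt_prod k y x"

lemma map_alternating: "map f (alternating k x y) = alternating k (f x) (f y)"
  by (induction k arbitrary: x y) auto

lemma set_alternating: "set (alternating k x y) \<subseteq> {x, y}"
  by (induction k arbitrary: x y) auto

lemma br_concat_alternating: "br (concat (alternating k u v)) = alt_prod k (br u) (br v)"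
  by (induction k arbitrary: u v) auto

lemma alternating_relation_iff:
  assumes "set u \<subseteq> {1..n}" "set v \<subseteq> {1..n}"
  shows "alternating_relation n k (word_class n u) (word_class n v) \<longleftrightarrow>
    alt_prod k (br u) (br v) = alt_prod k (br v) (br u)"
proof -
  have s: "set w \<subseteq> {1..n}" if "w \<in> set (alternating k u v) \<or> w \<in> set (alternating k v u)" for w
    using that set_alternating[of k u v] set_alternating[of k v u] assms by auto
  have "set (concat (alternating k u v)) \<subseteq> {1..n}" "set (concat (alternating k v u)) \<subseteq> {1..n}"
    using s by (simp_all add: UN_least)
  note * = word_class_eq_iff[OF this]
  have "list_prod (braid_monoid n) (alternating k (word_class n u) (word_class n v)) =
      word_class n (concat (alternating k u v))"
    unfolding map_alternating[symmetric] by (rule list_prod_word_class) (use s in blast)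
  moreover have "list_prod (braid_monoid n) (alternating k (word_class n v) (word_class n u)) =
      word_class n (concat (alternating k v u))"
    unfolding map_alternating[symmetric] by (rule list_prod_word_class) (use s in blast)
  ultimately show ?thesis
    unfolding alternating_relation_def using *
    by (simp add: br_eq_iff[symmetric] br_concat_alternating)
qed

text \<open>The universal property of the presentation: substituting \<open>u\<close> and
  \<open>v\<close> for the generators respects the only relation, so the substitution may be
  evaluated on a chosen representative of each class.\<close>

lemma dihedral_hom_ex:
  assumes "set u \<subseteq> {1..n}" "set v \<subseteq> {1..n}" "alt_prod N (br u) (br v) = alt_prod N (br v) (br u)"
  shows "\<exists>\<Phi>\<in>monoid_homs (dihedral_monoid N) (braid_monoid n).
    \<Phi> (dihedral_gen N 1) = word_class n u \<and> \<Phi> (dihedral_gen N 2) = word_class n v"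
proof -
  let ?g = "\<lambda>i::nat. if i = 1 then u else v"
  let ?f = "\<lambda>w. concat (map ?g w)"
  let ?R = "word_cong {1, 2} (dihedral_rels N)"
  have sf: "set (?f w) \<subseteq> {1..n}" for w using assms by (auto split: if_splits)
  have resp: "?f w \<approx> ?f w'" if "(w, w') \<in> ?R" for w w'
    using that
  proof (induction rule: word_cong.induct)
    case (rel a b x y)
    have ab: "a = alternating N 1 2" "b = alternating N 2 1"
      using rel(1) by (auto simp: dihedral_rels_def)
    have "?f a \<approx> ?f b" unfolding ab map_alternating br_eq_iff[symmetric] br_concat_alternating
      using assms(3) by simp
    then show ?case using beq_context by simp
  next
    case (refl w)
    show ?case by (rule beq.refl)
  next
    case (sym a b)
    then show ?case by (blast intro: beq.sym)
  next
    case (trans a b c)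
    then show ?case by (blast intro: beq.trans)
  qed
  define \<Phi> where "\<Phi> C = word_class n (?f (SOME w. w \<in> C))" for C
  have \<Phi>: "\<Phi> (?R `` {w}) = word_class n (?f w)" if "w \<in> lists {1, 2}" for w
  proof -
    have "w \<in> ?R `` {w}" using that by (auto intro: word_cong.refl)
    then have "(w, SOME w'. w' \<in> ?R `` {w}) \<in> ?R"
      using someI[of "\<lambda>w'. w' \<in> ?R `` {w}" w] by blast
    from resp[OF this] show ?thesis
      unfolding \<Phi>_def using word_class_eq_iff sf beq.sym by metis
  qed
  have hom: "\<Phi> \<in> hom (dihedral_monoid N) (braid_monoid n)"
  proof (rule homI)
    have carr: "C \<in> carrier (dihedral_monoid N) \<longleftrightarrow> (\<exists>w\<in>lists {1, 2}. C = ?R `` {w})" for C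
      by (auto simp: dihedral_monoid_def presented_monoid_def quotient_def)
    fix C assume "C \<in> carrier (dihedral_monoid N)"
    then obtain w where w: "w \<in> lists {1, 2}" "C = ?R `` {w}" using carr by blast
    have "?f w \<in> lists {1..n}" using sf by blast
    then show "\<Phi> C \<in> carrier (braid_monoid n)"
      unfolding w(2) \<Phi>[OF w(1)] word_class_def braid_monoid_def presented_monoid_def
      by (simp add: quotientI)
    fix D assume "D \<in> carrier (dihedral_monoid N)"
    then obtain w' where w': "w' \<in> lists {1, 2}" "D = ?R `` {w'}" using carr by blast
    have "C \<otimes>\<^bsub>dihedral_monoid N\<^esub> D = ?R `` {w @ w'}"
      unfolding w w' dihedral_monoid_def by (rule presented_mult_class[OF w(1) w'(1)])
    moreover have "\<Phi> C \<otimes>\<^bsub>braid_monoid n\<^esub> \<Phi> D = word_class n (?f w @ ?f w')"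
      unfolding w(2) w'(2) \<Phi>[OF w(1)] \<Phi>[OF w'(1)] braid_monoid_def word_class_def
      by (rule presented_mult_class) (use sf in blast)+
    ultimately show "\<Phi> (C \<otimes>\<^bsub>dihedral_monoid N\<^esub> D) = \<Phi> C \<otimes>\<^bsub>braid_monoid n\<^esub> \<Phi> D"
      using \<Phi>[of "w @ w'"] w(1) w'(1) by simp
  qed
  have "\<Phi> \<one>\<^bsub>dihedral_monoid N\<^esub> = \<one>\<^bsub>braid_monoid n\<^esub>"
    using \<Phi>[of "[]"] by (simp add: word_class_def dihedral_monoid_def braid_monoid_def presented_monoid_def)
  then have "\<Phi> \<in> monoid_homs (dihedral_monoid N) (braid_monoid n)"
    using hom by (simp add: monoid_homs_def)
  moreover have "\<Phi> (dihedral_gen N 1) = word_class n u" "\<Phi> (dihedral_gen N 2) = word_class n v"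
    unfolding dihedral_gen_def using \<Phi>[of "[1]"] \<Phi>[of "[2]"] by simp_all
  ultimately show ?thesis by blast
qed


section \<open>Bouncing strands\<close>

text \<open>On \<open>M\<close> points, alternately exchange the pairs \<open>(r, r + 1)\<close> with \<open>r\<close> even and with \<open>r\<close>
  odd. A point moves one step per move and pauses once at either end: unfolding the path
  turns this into the rotation of a cycle of length \<open>2 M\<close>.\<close>

definition swap_step :: "nat \<Rightarrow> nat \<Rightarrow> nat \<Rightarrow> nat" where
  "swap_step M e r =
     (if r < M \<and> even (r + e) then r + 1 else if 1 < r \<and> odd (r + e) then r - 1 else r)"

text \<open>The phases \<open>0\<close> to \<open>M - 1\<close> climb through the ranks and the
  phases \<open>M\<close> to \<open>2 * M - 1\<close> descend. At each end two consecutive phases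
  share a rank: this is the pause.\<close>

definition fold_cycle :: "nat \<Rightarrow> nat \<Rightarrow> nat" where
  "fold_cycle M m = (if m mod (2 * M) < M then m mod (2 * M) + 1 else 2 * M - m mod (2 * M))"

lemma fold_cycle_range:
  assumes "0 < M" shows "1 \<le> fold_cycle M m" "fold_cycle M m \<le> M"
proof -
  have "m mod (2 * M) < 2 * M" using assms by simp
  then show "1 \<le> fold_cycle M m" "fold_cycle M m \<le> M" by (auto simp: fold_cycle_def)
qed

text \<open>On the way up the rank is \<open>m + 1\<close>, on the way down \<open>2 * M - m\<close>
  (modulo \<open>2 * M\<close>); the parity condition says that the exchange moves the point forward
  along its path and not back.\<close>

lemma swap_step_fold_cycle:
  assumes "0 < M" "even (m + 1 + e)"
  shows "swap_step M e (fold_cycle M m) = fold_cycle M (m + 1)"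
proof -
  define k where "k = m mod (2 * M)"
  have k: "k < 2 * M" using assms(1) by (simp add: k_def)
  have par: "even k \<longleftrightarrow> even m" unfolding k_def by (simp add: dvd_mod_iff)
  have nxt: "(m + 1) mod (2 * M) = (if k + 1 = 2 * M then 0 else k + 1)"
    unfolding k_def by (simp add: mod_Suc)
  consider "k + 1 < M" | "k + 1 = M" | "M \<le> k" "k + 1 < 2 * M" | "k + 1 = 2 * M"
    using k by linarith
  then show ?thesis
  proof cases
    case 1
    then show ?thesis using assms par nxt
      by (simp add: swap_step_def fold_cycle_def flip: k_def)
  next
    case 2
    then have "even M \<longleftrightarrow> odd k" by presburger
    then show ?thesis using 2 assms par nxt
      by (simp add: swap_step_def fold_cycle_def flip: k_def)
  next
    case 3
    then have "even (2 * M - k) \<longleftrightarrow> even k" by simp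
    then show ?thesis using 3 assms par nxt
      by (auto simp add: swap_step_def fold_cycle_def simp flip: k_def)
  next
    case 4
    then have "odd k" by presburger
    then show ?thesis using 4 assms par nxt
      by (auto simp add: swap_step_def fold_cycle_def simp flip: k_def)
  qed
qed

lemma fold_cycle_surj:
  assumes "1 \<le> r" "r \<le> M"
  obtains m where "fold_cycle M m = r" "even (m + 1 + e)"
proof (cases "even (r + e)")
  case True
  then show ?thesis using that[of "r - 1"] assms by (auto simp: fold_cycle_def)
next
  case False
  have "even (2 * M - r + 1 + e)" using False assms by auto
  moreover have "fold_cycle M (2 * M - r) = r" using assms by (auto simp: fold_cycle_def)
  ultimately show ?thesis using that by blast
qed

text \<open>Half a rotation of the cycle is the reflection of the ranks; hence \<open>M\<close>
  steps turn the thin strands over.\<close>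

lemma fold_cycle_half:
  assumes "0 < M" shows "fold_cycle M (m + M) = M + 1 - fold_cycle M m"
proof -
  define k where "k = m mod (2 * M)"
  have k: "k < 2 * M" using assms(1) by (simp add: k_def)
  have "(m + M) mod (2 * M) = (k + M) mod (2 * M)" unfolding k_def by (simp add: mod_add_left_eq)
  also have "\<dots> = (if k < M then k + M else k - M)"
    using k le_mod_geq[of "2 * M" "k + M"] by auto
  finally have "(m + M) mod (2 * M) = (if k < M then k + M else k - M)" .
  then show ?thesis using k by (auto simp: fold_cycle_def simp flip: k_def)
qed

text \<open>The phases on the right are congruent to \<open>k - 1\<close>, and consecutive phases
  have the same rank only at the two pauses; the bounds on \<open>k\<close> leave the one at
  \<open>M\<close>.\<close>

lemma fold_cycle_first_return:
  assumes "0 < k" "k < 2 * M" "fold_cycle M k = fold_cycle M (2 * M - 1 + k)"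
  shows "k = M"
proof -
  have e: "2 * M - 1 + k = (k - 1) + 2 * M" using assms by simp
  have "(2 * M - 1 + k) mod (2 * M) = k - 1"
    unfolding e mod_add_self2 using assms(1,2) by simp
  then show ?thesis using assms by (auto simp: fold_cycle_def split: if_splits)
qed

primrec altword :: "(bool \<Rightarrow> nat list) \<Rightarrow> bool \<Rightarrow> nat \<Rightarrow> nat list" where
  "altword u b 0 = []"
| "altword u b (Suc k) = u b @ altword u (\<not> b) k"

lemma br_altword: "br (altword u b k) = alt_prod k (br (u b)) (br (u (\<not> b)))"
  by (induction k arbitrary: b) auto

lemma set_altword: "(\<And>b. set (u b) \<subseteq> X) \<Longrightarrow> set (altword u b k) \<subseteq> X"
  by (induction k arbitrary: b) auto

text \<open>The positions \<open>P b\<close> may depend on the colour of the next step, which allows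
  the fat strand itself to move to and fro. After \<open>k\<close> steps the next colour is
  \<open>b\<close> exactly if \<open>k\<close> is even.\<close>

lemma act_altword:
  assumes "0 < M" "\<And>b. s (\<not> b) + s b = 2 * h + 1"
    and "\<And>b r. 1 \<le> r \<Longrightarrow> r \<le> M \<Longrightarrow> act (u b) (P b r) = P (\<not> b) (swap_step M (s b) r)"
  shows "even (m + 1 + s b) \<Longrightarrow>
    act (altword u b k) (P b (fold_cycle M m)) = P (b = even k) (fold_cycle M (m + k))"
proof (induction k arbitrary: b m)
  case 0
  then show ?case by simp
next
  case (Suc k)
  have "odd (s (\<not> b) + s b)" by (simp add: assms(2))
  then have "even (m + 1 + 1 + s (\<not> b))" using Suc.prems by auto
  moreover have "((\<not> b) = even k) = (b = odd k)" by auto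
  ultimately show ?case
    using Suc.IH[of "m + 1" "\<not> b"] assms(3)[OF fold_cycle_range[OF assms(1)]] swap_step_fold_cycle[OF assms(1) Suc.prems]
    by simp
qed

text \<open>The position of the thin strand of rank \<open>r\<close> when \<open>f\<close> positions are inserted after
  the \<open>p\<close>-th one.\<close>

definition thin :: "nat \<Rightarrow> nat \<Rightarrow> nat \<Rightarrow> nat" where
  "thin f p r = (if r \<le> p then r else r + f)"

lemma thin_inj [simp]: "thin f p r = thin f p r' \<longleftrightarrow> r = r'"
  by (auto simp: thin_def)

lemma thin_cover:
  assumes "1 \<le> p" "p < M" "1 \<le> x" "x < M + f" "x \<notin> {p..p + f}"
  shows "\<exists>r. 1 \<le> r \<and> r < M \<and> r \<noteq> p \<and> x = thin f p r"
proof (cases "x < p")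
  case True
  then show ?thesis using assms by (intro exI[of _ x]) (auto simp: thin_def)
next
  case False
  then show ?thesis using assms by (intro exI[of _ "x - f"]) (auto simp: thin_def)
qed

section \<open>Two disjoint half twists\<close>

locale two_half_twists =
  fixes n :: nat and J :: "bool \<Rightarrow> nat set" and u :: "bool \<Rightarrow> nat list"
  assumes full: "J True \<union> J False = {1..n}"
    and disj: "J True \<inter> J False = {}"
    and twist: "half_twist_word (J b) (u b)"
begin

lemma cover: "1 \<le> j \<Longrightarrow> j \<le> n \<Longrightarrow> j \<in> J (\<not> b) \<longleftrightarrow> j \<notin> J b"
  using full disj by (cases b) auto

lemma not_both: "j \<in> J b \<Longrightarrow> j \<notin> J (\<not> b)"
  using disj by (cases b) auto

lemma J_range: "j \<in> J b \<Longrightarrow> 1 \<le> j \<and> j \<le> n"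
  using full by (cases b) auto

lemma finite_J: "finite (J b)"
  using J_range by (meson finite_atLeastAtMost finite_subset atLeastAtMost_iff subsetI)

lemma set_u: "set (u b) = J b"
  using half_twist_word_set[OF twist finite_J] .

text \<open>A fat position lies in the interior of a block of one of the two half twists.\<close>

definition fat :: "nat \<Rightarrow> bool" where
  "fat x \<longleftrightarrow> (\<exists>b. x - 1 \<in> J b \<and> x \<in> J b)"

lemma act_block:
  assumes "{a..<c} \<subseteq> J b" "a - 1 \<notin> J b" "c \<notin> J b" "a \<le> x" "x \<le> c"
  shows "act (u b) x = a + c - x"
  by (rule half_twist_word_act[OF twist finite_J]) (use assms in auto)

lemma act_fix: "x - 1 \<notin> J b \<Longrightarrow> x \<notin> J b \<Longrightarrow> act (u b) x = x"
  using act_fixed[of x "u b"] set_u by simp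

lemma crossings_u: "x < y \<Longrightarrow> crossings (u b) x y = of_bool ({x..<y} \<subseteq> J b)"
  by (rule half_twist_wordD[OF twist])

end

text \<open>The value \<open>f = 0\<close> is allowed: it describes two self-orthogonal sets, and
  \<open>p\<close> is then an arbitrary element of \<open>J c\<close>.\<close>

locale one_fat_strand = two_half_twists +
  fixes c :: bool and p f :: nat
  assumes K: "{p..p + f} \<subseteq> J c"
    and fat_iff: "fat x \<longleftrightarrow> p < x \<and> x \<le> p + f"
begin

definition M :: nat where "M = n + 1 - f"

text \<open>The parity at which \<open>u b\<close> exchanges thin strands (\<open>thin_mem\<close>),
  normalised by the gap \<open>p\<close>, which contains \<open>K\<close> and hence has colour
  \<open>c\<close>.\<close>

definition shift :: "bool \<Rightarrow> nat" where
  "shift b = (if b = c then p else p + 1)"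

lemma K_mem: "p \<in> J c" "p + f \<in> J c"
  by (auto intro!: subsetD[OF K])

lemma p_range: "1 \<le> p" "p + f \<le> n"
  using J_range[OF K_mem(1)] J_range[OF K_mem(2)] by auto

lemma p_less_M: "p < M"
  using p_range by (simp add: M_def)

lemma thin_range: "1 \<le> r \<Longrightarrow> r < M \<Longrightarrow> 1 \<le> thin f p r \<and> thin f p r \<le> n"
  using p_range by (auto simp: thin_def M_def)

lemma thin_pred_mem:
  assumes "1 \<le> r"
  shows "thin f p (Suc r) - 1 \<in> J b \<longleftrightarrow> thin f p r \<in> J b"
proof (cases "r = p")
  case True
  have "p + f \<in> J b \<longleftrightarrow> p \<in> J b"
    using K_mem not_both[of p c] not_both[of "p + f" c] by (cases "b = c") auto
  then show ?thesis using True by (simp add: thin_def)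
next
  case False
  then show ?thesis by (auto simp: thin_def)
qed

lemma not_fat_thin: "\<not> fat (thin f p r)"
  by (auto simp: fat_iff thin_def)

text \<open>Two neighbouring gaps of the same colour would make the position between them
  fat.\<close>

lemma thin_alternate:
  assumes "1 \<le> r" "Suc r < M"
  shows "thin f p (Suc r) \<in> J b \<longleftrightarrow> thin f p r \<notin> J b"
proof -
  have "\<not> (thin f p (Suc r) \<in> J b \<and> thin f p r \<in> J b)" for b
    using not_fat_thin[of "Suc r"] thin_pred_mem[OF assms(1)] unfolding fat_def by blast
  from this[of b] this[of "\<not> b"] show ?thesis
    using cover[of "thin f p r" b] cover[of "thin f p (Suc r)" b]
      thin_range[of r] thin_range[of "Suc r"] assms by auto
qed

lemma thin_mem:
  assumes "1 \<le> r" "r < M"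
  shows "thin f p r \<in> J b \<longleftrightarrow> even (r + shift b)"
proof -
  have base: "thin f p p \<in> J b \<longleftrightarrow> even (p + shift b)"
    using K_mem(1) not_both[of p c] by (cases "b = c") (auto simp: thin_def shift_def)
  show ?thesis
  proof (cases "p \<le> r")
    case True
    then show ?thesis using assms(2)
    proof (induction r rule: dec_induct)
      case (step r)
      then show ?case using thin_alternate[of r b] p_range by simp
    qed (rule base)
  next
    case False
    then have "r \<le> p" by simp
    then show ?thesis using assms(1)
    proof (induction r rule: inc_induct)
      case (step r)
      have "thin f p (Suc r) \<in> J b \<longleftrightarrow> thin f p r \<notin> J b"
        using thin_alternate[of r b] step p_less_M by simp
      moreover have "thin f p (Suc r) \<in> J b \<longleftrightarrow> even (Suc r + shift b)" using step by simp
      moreover have "even (Suc r + shift b) \<longleftrightarrow> odd (r + shift b)" by simp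
      ultimately show ?case by blast
    qed (rule base)
  qed
qed

lemma thin_gap:
  assumes "1 \<le> r" "thin f p r \<in> J b"
  shows "{thin f p r..<thin f p (Suc r)} \<subseteq> J b"
proof (cases "r = p")
  case True
  then have "b = c" using assms(2) K_mem(1) not_both[of p c] by (cases "b = c") (auto simp: thin_def)
  then show ?thesis using True K by (auto simp: thin_def)
next
  case False
  then have "{thin f p r..<thin f p (Suc r)} = {thin f p r}" by (auto simp: thin_def)
  then show ?thesis using assms(2) by simp
qed

text \<open>A block of \<open>u b\<close> fills exactly one gap between consecutive thin strands,
  and its reflection exchanges these two; for \<open>r = p\<close> the block is
  \<open>K\<close>.\<close>

lemma act_thin:
  assumes "1 \<le> r" "r \<le> M"
  shows "act (u b) (thin f p r) = thin f p (swap_step M (shift b) r)"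
proof -
  have up: "act (u b) (thin f p r) = thin f p (Suc r) \<and> act (u b) (thin f p (Suc r)) = thin f p r"
    if r: "1 \<le> r" "r < M" "even (r + shift b)" for r
  proof -
    have mem: "thin f p r \<in> J b" using thin_mem r by blast
    have "thin f p r - 1 \<notin> J b" using mem not_fat_thin[of r] unfolding fat_def by blast
    moreover have "thin f p (Suc r) \<notin> J b"
    proof (cases "Suc r < M")
      case True
      then show ?thesis using thin_alternate r mem by blast
    next
      case False
      then have "thin f p (Suc r) = n + 1" using r p_less_M p_range by (auto simp: thin_def M_def)
      then show ?thesis using J_range by fastforce
    qed
    moreover have "thin f p r \<le> thin f p (Suc r)" by (auto simp: thin_def)
    ultimately show ?thesis
      using act_block[OF thin_gap[OF r(1) mem], of "thin f p r"]
        act_block[OF thin_gap[OF r(1) mem], of "thin f p (Suc r)"] by auto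
  qed
  consider "r < M" "even (r + shift b)" | "1 < r" "odd (r + shift b)"
    | "\<not> (r < M \<and> even (r + shift b))" "\<not> (1 < r \<and> odd (r + shift b))" by blast
  then show ?thesis
  proof cases
    case 1
    then show ?thesis using up[of r] assms by (simp add: swap_step_def)
  next
    case 2
    then have "even (r - 1 + shift b)" by (cases r) auto
    then show ?thesis using 2 up[of "r - 1"] assms by (auto simp: swap_step_def)
  next
    case 3
    have "thin f p r \<notin> J b"
    proof (cases "r < M")
      case True
      then show ?thesis using 3 assms thin_mem by blast
    next
      case False
      then have "thin f p r = n + 1" using assms p_less_M p_range by (auto simp: thin_def M_def)
      then show ?thesis using J_range by fastforce
    qed
    moreover have "thin f p r - 1 \<notin> J b"
    proof (cases "1 < r")
      case True
      then have "even (r + shift b)" using 3 by blast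
      then have "odd (r - 1 + shift b)" using True by (cases r) auto
      then have "thin f p (r - 1) \<notin> J b" using thin_mem[of "r - 1"] True assms by auto
      then show ?thesis using thin_pred_mem[of "r - 1" b] True by simp
    next
      case False
      then have "thin f p r - 1 = 0" using assms p_range by (auto simp: thin_def)
      then show ?thesis using J_range by fastforce
    qed
    ultimately show ?thesis using act_fix 3 by (auto simp: swap_step_def)
  qed
qed

lemma act_thin_altword:
  "even (m + 1 + shift b) \<Longrightarrow>
    act (altword u b k) (thin f p (fold_cycle M m)) = thin f p (fold_cycle M (m + k))"
  using act_altword[of M shift p u "\<lambda>_. thin f p" m b k] act_thin p_less_M
  by (auto simp: shift_def)

text \<open>The strand of rank 1 starts at phase \<open>0\<close> if the first step moves it and at
  phase \<open>2 * M - 1\<close> if the first step lets it pause. A relation makes both versions end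
  at the same rank.\<close>

lemma relation_length:
  assumes "0 < k" "k < 2 * M" "altword u b k \<approx> altword u (\<not> b) k"
  shows "k = M"
proof -
  have "k = M" if "altword u b k \<approx> altword u (\<not> b) k" "odd (shift b)" for b
  proof -
    have e: "even (0 + 1 + shift b)" "even (2 * M - 1 + 1 + shift (\<not> b))"
      using that(2) p_less_M by (auto simp: shift_def)
    have one: "fold_cycle M 0 = 1" "fold_cycle M (2 * M - 1) = 1"
      using p_less_M by (auto simp: fold_cycle_def)
    have "act (altword u b k) (thin f p 1) = act (altword u (\<not> b) k) (thin f p 1)"
      using beq_act[OF that(1)] by simp
    then have "fold_cycle M k = fold_cycle M (2 * M - 1 + k)"
      using act_thin_altword[OF e(1), of k] act_thin_altword[OF e(2), of k] one by simp
    then show ?thesis using fold_cycle_first_return assms(1,2) by blast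
  qed
  from this[of b] this[of "\<not> b"] show ?thesis
    using assms(3) beq.sym by (cases "odd (shift b)") (auto simp: shift_def split: if_splits)
qed

lemma act_fat:
  assumes "fat x" shows "fat (act (u b) x)"
proof (cases "b = c")
  case True
  have x: "p < x" "x \<le> p + f" using assms fat_iff by auto
  have "Suc (p + f) \<notin> J c" using fat_iff[of "Suc (p + f)"] K_mem unfolding fat_def by auto
  moreover have "p - 1 \<notin> J c" using fat_iff[of p] K_mem unfolding fat_def by auto
  moreover have "{p..<Suc (p + f)} \<subseteq> J c" using K by (simp add: atLeastLessThanSuc_atLeastAtMost)
  ultimately have "act (u b) x = p + Suc (p + f) - x" using True x by (intro act_block) auto
  then show ?thesis unfolding fat_iff using x by linarith
next
  case False
  have "p < x" "x \<le> p + f" using assms fat_iff by auto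
  then have "x - 1 \<in> J c" "x \<in> J c" by (auto intro!: subsetD[OF K])
  moreover have "b = (\<not> c)" using False by auto
  ultimately have "act (u b) x = x" using not_both by (intro act_fix) blast+
  then show ?thesis using assms by simp
qed

lemma crossings_thin_fat:
  assumes "1 \<le> r" "r \<le> M" "fat x"
  shows "crossings (u b) (thin f p r) x = of_bool (b = c \<and> (r = p \<or> r = Suc p))"
proof -
  have x: "p < x" "x \<le> p + f" using assms fat_iff by auto
  have pc: "p \<in> J b \<longleftrightarrow> b = c" "p + f \<in> J b \<longleftrightarrow> b = c"
    using K_mem not_both[of p c] not_both[of "p + f" c] by (cases "b = c"; auto)+
  show ?thesis
  proof (cases "r \<le> p")
    case True
    have "{r..<x} \<subseteq> J b \<longleftrightarrow> b = c \<and> r = p"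
    proof
      assume h: "{r..<x} \<subseteq> J b"
      have "r = p"
      proof (rule ccontr)
        assume "r \<noteq> p"
        then have "p - 1 \<in> {r..<x}" "p \<in> {r..<x}" using True x by auto
        then have "fat p" unfolding fat_def using h by blast
        then show False using fat_iff by simp
      qed
      moreover have "p \<in> J b" using h True x by auto
      ultimately show "b = c \<and> r = p" using pc by simp
    next
      assume "b = c \<and> r = p"
      then show "{r..<x} \<subseteq> J b" using K x by auto
    qed
    then show ?thesis using crossings_u[of "thin f p r" x b] True x by (auto simp: thin_def)
  next
    case False
    have "{x..<r + f} \<subseteq> J b \<longleftrightarrow> b = c \<and> r = Suc p"
    proof
      assume h: "{x..<r + f} \<subseteq> J b"
      have "r = Suc p"
      proof (rule ccontr)
        assume "r \<noteq> Suc p"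
        then have "p + f \<in> {x..<r + f}" "Suc (p + f) \<in> {x..<r + f}" using False x by auto
        then have "fat (Suc (p + f))" unfolding fat_def using h by (metis diff_Suc_1 subsetD)
        then show False using fat_iff by simp
      qed
      moreover have "p + f \<in> J b" using h False x by auto
      ultimately show "b = c \<and> r = Suc p" using pc by simp
    next
      assume "b = c \<and> r = Suc p"
      then show "{x..<r + f} \<subseteq> J b" using K x by auto
    qed
    then show ?thesis
      using crossings_u[of x "thin f p r" b] False x by (auto simp: thin_def crossings_commute)
  qed
qed

text \<open>The excluded phases are those from which the next step carries a strand across the gap
  \<open>p\<close>, upwards and downwards respectively.\<close>

lemma crossings_altword_zero:
  assumes "even (m + 1 + shift b)" "fat x"
    and "\<And>t. t < k \<Longrightarrow> (m + t) mod (2 * M) \<noteq> p - 1 \<and> (m + t) mod (2 * M) \<noteq> 2 * M - p - 1"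
  shows "crossings (altword u b k) (thin f p (fold_cycle M m)) x = 0"
  using assms
proof (induction k arbitrary: b m x)
  case (Suc k)
  define r where "r = fold_cycle M m"
  define i where "i = m mod (2 * M)"
  have M0: "0 < M" using p_less_M by simp
  have rr: "1 \<le> r" "r \<le> M" unfolding r_def using fold_cycle_range[OF M0] by auto
  have i: "i \<noteq> p - 1" "i \<noteq> 2 * M - p - 1" using Suc.prems(3)[of 0] by (auto simp: i_def)
  have par: "even i \<longleftrightarrow> even m" unfolding i_def by (simp add: dvd_mod_iff)
  have ilt: "i < 2 * M" using M0 by (simp add: i_def)
  \<comment> \<open>The other phases of the ranks \<open>p\<close> and \<open>Suc p\<close> are
    \<open>p\<close> and \<open>2 * M - p\<close>; by parity no step of colour \<open>c\<close>
    meets them.\<close>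
  have "\<not> (b = c \<and> (r = p \<or> r = Suc p))"
  proof
    assume h: "b = c \<and> (r = p \<or> r = Suc p)"
    then have ev: "even (i + 1 + p)" using Suc.prems(1) par by (simp add: shift_def)
    have r: "r = (if i < M then i + 1 else 2 * M - i)" by (simp add: r_def fold_cycle_def i_def)
    show False
    proof (cases "i < M")
      case True
      then have "i = p" using h r i p_range by auto
      then show False using ev by simp
    next
      case False
      then have "i = 2 * M - p" using h r i ilt by auto
      then show False using ev p_less_M by simp
    qed
  qed
  then have 1: "crossings (u b) (thin f p r) x = 0" using crossings_thin_fat[OF rr Suc.prems(2)] by simp
  have e: "even (m + 1 + 1 + shift (\<not> b))" using Suc.prems(1) by (auto simp: shift_def)
  have "(m + 1 + t) mod (2 * M) \<noteq> p - 1 \<and> (m + 1 + t) mod (2 * M) \<noteq> 2 * M - p - 1" if "t < k" for t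
    using Suc.prems(3)[of "Suc t"] that by simp
  then have "crossings (altword u (\<not> b) k) (thin f p (fold_cycle M (m + 1))) (act (u b) x) = 0"
    by (intro Suc.IH[OF e act_fat[OF Suc.prems(2)]])
  then show ?case
    using 1 act_thin[OF rr, of b] swap_step_fold_cycle[OF M0 Suc.prems(1)] by (simp add: r_def)
qed simp

text \<open>Starting with colour \<open>c\<close>, both thin neighbours cross the fat strand at
  once. Starting with the other colour, the neighbour that leaves towards the wider side does not
  come back to it within \<open>M\<close> steps.\<close>

lemma no_relation_asymmetric:
  assumes "0 < f" "M \<noteq> 2 * p"
  shows "\<not> altword u b M \<approx> altword u (\<not> b) M"
proof
  assume "altword u b M \<approx> altword u (\<not> b) M"
  then have rel: "altword u c M \<approx> altword u (\<not> c) M" using beq.sym by (cases "b = c") auto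
  have fx: "fat (Suc p)" using assms(1) fat_iff by simp
  have ev: "even (p + 1 + shift (\<not> c))" "even (2 * M - p + 1 + shift (\<not> c))"
    using p_less_M by (auto simp: shift_def)
  have "\<exists>r\<in>{p, Suc p}. crossings (altword u (\<not> c) M) (thin f p r) (Suc p) = 0"
  proof (cases "2 * p < M")
    case True
    have "fold_cycle M p = Suc p" using p_less_M by (simp add: fold_cycle_def)
    moreover have "crossings (altword u (\<not> c) M) (thin f p (fold_cycle M p)) (Suc p) = 0"
    proof (rule crossings_altword_zero[OF ev(1) fx])
      fix t assume "t < M"
      then have "(p + t) mod (2 * M) = p + t" using p_less_M by simp
      then show "(p + t) mod (2 * M) \<noteq> p - 1 \<and> (p + t) mod (2 * M) \<noteq> 2 * M - p - 1"
        using True \<open>t < M\<close> p_range by auto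
    qed
    ultimately show ?thesis by auto
  next
    case False
    have "fold_cycle M (2 * M - p) = p" using p_less_M p_range by (auto simp: fold_cycle_def)
    moreover have "crossings (altword u (\<not> c) M) (thin f p (fold_cycle M (2 * M - p))) (Suc p) = 0"
    proof (rule crossings_altword_zero[OF ev(2) fx])
      fix t assume "t < M"
      show "(2 * M - p + t) mod (2 * M) \<noteq> p - 1 \<and> (2 * M - p + t) mod (2 * M) \<noteq> 2 * M - p - 1"
      proof (cases "t < p")
        case True
        then have "(2 * M - p + t) mod (2 * M) = 2 * M - p + t" using p_less_M by simp
        then show ?thesis using True p_less_M p_range by auto
      next
        case False
        then have "2 * M - p + t = (t - p) + 2 * M" using p_less_M by simp
        then have "(2 * M - p + t) mod (2 * M) = (t - p) mod (2 * M)"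
          by (simp only: mod_add_self2)
        then have "(2 * M - p + t) mod (2 * M) = t - p" using \<open>t < M\<close> by simp
        then show ?thesis using \<open>\<not> 2 * p < M\<close> assms(2) \<open>t < M\<close> p_less_M p_range by auto
      qed
    qed
    ultimately show ?thesis by auto
  qed
  then obtain r where r: "r = p \<or> r = Suc p" "crossings (altword u (\<not> c) M) (thin f p r) (Suc p) = 0"
    by blast
  obtain M' where "M = Suc M'" using p_less_M by (cases M) auto
  then have "crossings (u c) (thin f p r) (Suc p) \<le> crossings (altword u c M) (thin f p r) (Suc p)"
    by simp
  moreover have "crossings (u c) (thin f p r) (Suc p) = 1"
    using crossings_thin_fat[OF _ _ fx, of r c] r(1) p_range p_less_M by auto
  ultimately show False using beq_crossings[OF rel] r(2) by simp
qed

end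


section \<open>Two fat strands\<close>

text \<open>The sequence in which the strand \<open>r\<close> crosses the strands \<open>p\<close> (\<open>True\<close>) and \<open>q\<close> (\<open>False\<close>)
  is an invariant of the braid as long as \<open>p\<close> and \<open>q\<close> do not cross.\<close>

primrec meets :: "nat list \<Rightarrow> nat \<Rightarrow> nat \<Rightarrow> nat \<Rightarrow> bool list" where
  "meets [] p q r = []"
| "meets (i # w) p q r =
     (if r = i \<and> p = Suc i \<or> r = Suc i \<and> p = i then [True]
      else if r = i \<and> q = Suc i \<or> r = Suc i \<and> q = i then [False] else []) @
     meets w (sw i p) (sw i q) (sw i r)"

lemma meets_append:
  "meets (u @ v) p q r = meets u p q r @ meets v (act u p) (act u q) (act u r)"
  by (induction u arbitrary: p q r) auto

lemma meets_beq:
  "u \<approx> v \<Longrightarrow> p \<noteq> q \<Longrightarrow> p \<noteq> r \<Longrightarrow> q \<noteq> r \<Longrightarrow> crossings u p q = 0 \<Longrightarrow>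
    meets u p q r = meets v p q r"
proof (induction arbitrary: p q r rule: beq.induct)
  case (far i j x y)
  have *: "act x p \<noteq> act x q" "act x p \<noteq> act x r" "act x q \<noteq> act x r" using far.prems by simp_all
  have "meets [i, j] a b c = meets [j, i] a b c" if "a \<noteq> b" "a \<noteq> c" "b \<noteq> c" for a b c
  proof -
    have "sw i z = j \<longleftrightarrow> z = j" "sw i z = Suc j \<longleftrightarrow> z = Suc j"
      "sw j z = i \<longleftrightarrow> z = i" "sw j z = Suc i \<longleftrightarrow> z = Suc i" for z
      using far.hyps by (auto simp: sw_eq)
    then show ?thesis using far.hyps by simp
  qed
  from this[OF *] show ?case
    using beq_act[OF beq.far[OF far.hyps, of "[]" "[]"]] by (simp only: meets_append append_Nil append_Nil2)
next
  case (braid x i y)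
  have *: "act x p \<noteq> act x q" "act x p \<noteq> act x r" "act x q \<noteq> act x r"
    using braid.prems by simp_all
  have **: "crossings [i, Suc i, i] (act x p) (act x q) = 0"
    using braid.prems(4) unfolding crossings_append add_is_0 by blast
  have "meets [i, Suc i, i] a b c = meets [Suc i, i, Suc i] a b c"
    if "a \<noteq> b" "a \<noteq> c" "b \<noteq> c" "crossings [i, Suc i, i] a b = 0" for a b c
  proof -
    \<comment> \<open>In a braid relation each pair of the three strands crosses. As
      \<open>a\<close> and \<open>b\<close> do not, at most one of them takes part, and no two
      entries of the list can change places.\<close>
    have "a \<notin> {i, Suc i, Suc (Suc i)} \<or> b \<notin> {i, Suc i, Suc (Suc i)}"
      using that(1,4) by (auto simp: sw_eq split: if_splits)
    moreover have fixed: "sw i z = z \<and> sw (Suc i) z = z \<and> z \<noteq> i \<and> z \<noteq> Suc i \<and> z \<noteq> Suc (Suc i)"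
      if "z \<notin> {i, Suc i, Suc (Suc i)}" for z using that by (auto simp: sw_eq)
    moreover have move: "z = i \<or> z = Suc i \<or> z = Suc (Suc i) \<or>
      sw i z = z \<and> sw (Suc i) z = z \<and> z \<noteq> i \<and> z \<noteq> Suc i \<and> z \<noteq> Suc (Suc i)" for z
      using fixed[of z] by blast
    have sws: "sw i i = Suc i" "sw i (Suc i) = i" "sw (Suc i) (Suc i) = Suc (Suc i)"
      "sw (Suc i) (Suc (Suc i)) = Suc i" "sw i (Suc (Suc i)) = Suc (Suc i)" "sw (Suc i) i = i"
      by (simp_all add: sw_eq)
    ultimately show ?thesis
    proof (elim disjE)
      assume "a \<notin> {i, Suc i, Suc (Suc i)}"
      from fixed[OF this] show ?thesis
        using that(1-3) move[of b] move[of c] by (elim disjE) (simp_all add: sws)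
    next
      assume "b \<notin> {i, Suc i, Suc (Suc i)}"
      from fixed[OF this] show ?thesis
        using that(1-3) move[of a] move[of c] by (elim disjE) (simp_all add: sws)
    qed
  qed
  from this[OF * **] show ?case
    using beq_act[OF beq.braid[of "[]" i "[]"]] by (simp only: meets_append append_Nil append_Nil2)
next
  case (sym u v)
  then show ?case using beq_crossings[OF sym.hyps] by metis
next
  case (trans u v w)
  then show ?case using beq_crossings[OF trans.hyps(1)] by metis
qed simp

lemma count_meets:
  assumes "p \<noteq> q"
  shows "count_list (meets w p q r) True = crossings w r p"
    and "count_list (meets w p q r) False = crossings w r q"
  using assms by (induction w arbitrary: p q r) auto

lemma list_eq_if_counts:
  assumes "count_list xs (\<not> b) = 0" "count_list xs b = k"
  shows "xs = replicate k b"
proof -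
  have "\<forall>x\<in>set xs. x = b"
  proof (intro ballI, rule ccontr)
    fix x assume x: "x \<in> set xs" and "x \<noteq> b"
    then have eq: "(\<not> b) = x" by blast
    have "(\<not> b) \<in> set xs" unfolding eq by (rule x)
    then show False using assms(1) unfolding count_list_0_iff by blast
  qed
  then have "replicate (length xs) b = xs" by (rule replicate_length_same)
  then obtain m where m: "xs = replicate m b" by (rule that[OF HOL.sym])
  have "count_list (replicate m b) b = m" for m by (induction m) auto
  then have "k = m" using assms(2) unfolding m by simp
  then show ?thesis using m by simp
qed

context two_half_twists
begin

lemma no_relation_two_fat:
  assumes F: "fat F" and G: "fat G" and "F + 1 < G" and thin: "\<And>y. F < y \<Longrightarrow> y < G \<Longrightarrow> \<not> fat y"
    and "0 < k"
  shows "\<not> altword u b k \<approx> altword u (\<not> b) k"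
proof
  obtain c where c: "F - 1 \<in> J c" "F \<in> J c" using F fat_def by blast
  obtain g where g: "G - 1 \<in> J g" "G \<in> J g" using G fat_def by blast
  define x where "x = F + 1"
  have mem: "y \<in> J (\<not> b) \<longleftrightarrow> y \<notin> J b" if "F \<le> y" "y \<le> G" for y b
    using cover J_range[OF c(2)] J_range[OF g(2)] that by simp
  have alt: "Suc y \<in> J (\<not> b)" if "F \<le> y" "y + 1 < G" "y \<in> J b" for y b
    using thin[of "Suc y"] mem[of "Suc y" b] that unfolding fat_def by auto
  have xc: "x \<in> J (\<not> c)" using alt[of F c] c assms(3) by (simp add: x_def)
  \<comment> \<open>regions to which the two fat strands remain confined\<close>
  define L where "L a \<longleftrightarrow> 1 \<le> a \<and> a \<le> F \<and> {a - 1..F} \<subseteq> J c" for a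
  define R where "R d \<longleftrightarrow> G \<le> d \<and> {G - 1..d} \<subseteq> J g" for d
  have two: "{z - 1..z} = {z - 1, z}" for z :: nat by auto
  have LF: "L F" using c J_range[OF c(2)] unfolding L_def two by auto
  have RG: "R G" using g unfolding R_def two by auto
  have Lact: "L (act (u b) a)" if "L a" for a b
  proof (cases "b = c")
    case True
    \<comment> \<open>The left end of the block of \<open>J c\<close> whose last letter is
      \<open>F\<close>. The reflection of this block preserves the range from \<open>Suc s\<close>
      to \<open>F\<close>, in which \<open>a\<close> lies.\<close>
    define s where "s = (LEAST s. {s..F} \<subseteq> J c)"
    have wit: "{a - 1..F} \<subseteq> J c" using that L_def by blast
    have sJ: "{s..F} \<subseteq> J c" unfolding s_def by (rule LeastI[of "\<lambda>s. {s..F} \<subseteq> J c", OF wit])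
    have sle: "s \<le> a - 1" unfolding s_def by (rule Least_le) (rule wit)
    have "s - 1 \<notin> J c"
    proof
      assume h: "s - 1 \<in> J c"
      have "1 \<le> s" using h J_range by fastforce
      then have "{s - 1..F} = insert (s - 1) {s..F}" using sle that L_def by auto
      then have "{s - 1..F} \<subseteq> J c" using sJ h by simp
      then have "s \<le> s - 1" unfolding s_def by (rule Least_le)
      then show False using h J_range[of "s - 1" c] by simp
    qed
    moreover have "{s..<F + 1} \<subseteq> J c" using sJ by auto
    moreover have "F + 1 \<notin> J c" using xc not_both[of x c] by (auto simp: x_def)
    ultimately have act: "act (u b) a = s + (F + 1) - a"
      using True that sle unfolding L_def by (intro act_block) auto
    have a1: "1 \<le> a" "a \<le> F" using that L_def by auto
    have "s \<noteq> a" using sle a1 by linarith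
    have "{act (u b) a - 1..F} \<subseteq> {s..F}" unfolding act using sle a1 by auto
    then show ?thesis unfolding L_def using act sle a1 sJ \<open>s \<noteq> a\<close> by auto
  next
    case False
    have "a - 1 \<in> {a - 1..F}" "a \<in> {a - 1..F}" using that L_def by auto
    then have "a - 1 \<in> J c" "a \<in> J c" using that L_def by blast+
    moreover have "b = (\<not> c)" using False by auto
    ultimately have "act (u b) a = a" using not_both by (intro act_fix) blast+
    then show ?thesis using that by simp
  qed
  have Ract: "R (act (u b) d)" if "R d" for d b
  proof (cases "b = g")
    case True
    have "\<exists>e. e \<notin> J g \<and> d < e" using J_range[of "n + 1 + d" g] by (intro exI[of _ "n + 1 + d"]) auto
    then obtain e where e: "e \<notin> J g" "d < e" "\<And>e'. e' \<notin> J g \<Longrightarrow> d < e' \<Longrightarrow> e \<le> e'"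
      using LeastI_ex[of "\<lambda>e. e \<notin> J g \<and> d < e"] Least_le[of "\<lambda>e. e \<notin> J g \<and> d < e"] by blast
    have sub: "{G - 1..<e} \<subseteq> J g"
    proof
      fix y assume y: "y \<in> {G - 1..<e}"
      show "y \<in> J g"
      proof (cases "y \<le> d")
        case True
        then have "y \<in> {G - 1..d}" using y by simp
        then show ?thesis using that R_def by blast
      next
        case False
        then show ?thesis using e(3)[of y] y by fastforce
      qed
    qed
    have "G - 1 - 1 \<notin> J g" using thin[of "G - 1"] g(1) assms(3) unfolding fat_def by auto
    then have act: "act (u b) d = (G - 1) + e - d"
      unfolding True using that e sub unfolding R_def by (intro act_block) auto
    have "G \<le> d" using that R_def by simp
    have "{G - 1..act (u b) d} \<subseteq> {G - 1..<e}" unfolding act using e(2) \<open>G \<le> d\<close> assms(3) by auto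
    then have "{G - 1..act (u b) d} \<subseteq> J g" using sub by blast
    moreover have "G \<le> act (u b) d" unfolding act using e(2) assms(3) \<open>G \<le> d\<close> by linarith
    ultimately show ?thesis unfolding R_def by simp
  next
    case False
    have "G \<le> d" using that R_def by simp
    then have "d - 1 \<in> {G - 1..d}" "d \<in> {G - 1..d}" by auto
    then have "d - 1 \<in> J g" "d \<in> J g" using that R_def by blast+
    moreover have "b = (\<not> g)" using False by auto
    ultimately have "act (u b) d = d" using not_both by (intro act_fix) blast+
    then show ?thesis using that by simp
  qed
  have split: "\<not> {a..<d} \<subseteq> J b" if "L a" "R d" for a d b
  proof
    assume h: "{a..<d} \<subseteq> J b"
    have "F \<in> {a..<d}" "x \<in> {a..<d}" using that assms(3) L_def R_def x_def by auto
    then have "F \<in> J b" "x \<in> J b" using h by blast+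
    then show False using not_both[OF c(2)] not_both[of x c] xc by (cases "b = c") auto
  qed
  have lt: "a < d" if "L a" "R d" for a d using that assms(3) L_def R_def by auto
  have nocross: "crossings (altword u b k) a d = 0" if "L a" "R d" for a d b k
    using that
  proof (induction k arbitrary: a d b)
    case (Suc k)
    then show ?case
      using crossings_u[OF lt[OF Suc.prems], of b] split[OF Suc.prems] Lact Ract by simp
  qed simp
  \<comment> \<open>beginning with the colour of \<open>x\<close>, the strand \<open>x\<close> moves right until it meets \<open>G\<close>\<close>
  have first: "meets (altword u b k) a d y = [] \<or>
      (\<exists>ys. meets (altword u b k) a d y = False # ys)"
    if "L a" "R d" "F < y" "y < G" "y \<in> J b" for a d y b k
    using that
  proof (induction k arbitrary: a d y b)
    case (Suc k)
    have ad: "a < y" "y < d" "a \<noteq> d" using Suc.prems L_def R_def lt by auto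
    have y1: "y - 1 \<notin> J b" using thin[of y] Suc.prems unfolding fat_def by blast
    have "y - 1 \<in> {a..<y}" using ad by auto
    then have 1: "crossings (u b) y a = 0"
      using crossings_u[OF ad(1), of b] y1 crossings_commute[of "u b" y a] by auto
    show ?case
    proof (cases "y + 1 < G")
      case True
      have y2: "Suc y \<in> J (\<not> b)" using alt[of y b] Suc.prems True by simp
      then have y2': "Suc y \<notin> J b" using not_both[of "Suc y" "\<not> b"] by simp
      have "Suc y \<in> {y..<d}" using True Suc.prems R_def by auto
      then have "\<not> {y..<d} \<subseteq> J b" using y2' by blast
      then have "crossings (u b) y d = 0" using crossings_u[OF ad(2), of b] by simp
      then have "meets (u b) a d y = []"
        using 1 count_meets[OF ad(3), of "u b" y] list_eq_if_counts[of "meets (u b) a d y" True 0] by simp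
      moreover have "act (u b) y = Suc y"
        using act_block[of y "Suc y" b y] y1 y2' Suc.prems(5) by simp
      ultimately show ?thesis
        using Suc.IH[OF Lact[OF Suc.prems(1)] Ract[OF Suc.prems(2)], of "Suc y" "\<not> b" b] y2 True Suc.prems
        by (simp add: meets_append)
    next
      case False
      then have yG: "y = G - 1" using Suc.prems by simp
      then have "b = g" using Suc.prems(5) g(1) not_both[of y g] by (cases "b = g") auto
      then have "{y..<d} \<subseteq> J b" using Suc.prems(2) yG unfolding R_def by auto
      then have "crossings (u b) y d = 1" using crossings_u[OF ad(2), of b] by simp
      then have "meets (u b) a d y = [False]"
        using 1 count_meets[OF ad(3), of "u b" y] list_eq_if_counts[of "meets (u b) a d y" False 1] by simp
      then show ?thesis by (simp add: meets_append)
    qed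
  qed simp
  have xFG: "F < x" "x < G" "F \<noteq> G" using assms(3) by (simp_all add: x_def)
  obtain k' where k': "k = Suc k'" using \<open>0 < k\<close> by (cases k) auto
  have "x \<notin> J c" using xc not_both[of x "\<not> c"] by simp
  moreover have "x \<in> {x..<G}" using xFG by simp
  ultimately have "crossings (u c) x G = 0" using crossings_u[OF xFG(2), of c] by auto
  moreover have "crossings (u c) x F = 1"
    using crossings_u[OF xFG(1), of c] c(2) crossings_commute[of "u c" x F]
    by (simp add: x_def)
  ultimately have "meets (u c) F G x = [True]"
    using count_meets[OF xFG(3), of "u c" x] list_eq_if_counts[of "meets (u c) F G x" True 1] by simp
  then have c1: "hd (meets (altword u c k) F G x) = True" "meets (altword u c k) F G x \<noteq> []"
    by (simp_all add: k' meets_append)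
  assume "altword u b k \<approx> altword u (\<not> b) k"
  then have "altword u c k \<approx> altword u (\<not> c) k" using beq.sym by (cases "b = c") auto
  then have "meets (altword u c k) F G x = meets (altword u (\<not> c) k) F G x"
    by (rule meets_beq) (use xFG nocross[OF LF RG] in auto)
  then show False using first[OF LF RG xFG(1,2) xc] c1 by fastforce
qed

end


section \<open>Words for half twists\<close>

lemma half_twist_word_self_orthogonal:
  assumes "distinct w" "self_orthogonal (set w)"
  shows "half_twist_word (set w) w"
proof -
  obtain v where v: "half_twist_word (set w) v" "half_twist (set w) = br v"
    using obtain_half_twist_word[of "set w"] by blast
  then have "v \<approx> w" using br_self_orthogonal[OF assms] by (metis br_eq_iff)
  then show ?thesis using v(1) half_twist_word_beq by blast
qed

lemma act_self_orthogonal: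
  assumes "distinct w" "self_orthogonal (set w)" "y \<in> set w"
  shows "act w y = Suc y" "act w (Suc y) = y"
proof -
  have "y = 0 \<or> y - 1 \<notin> set w" "Suc y \<notin> set w"
    using assms(2,3) unfolding self_orthogonal_def by (metis Suc_pred' gr0I One_nat_def, blast)
  note * = half_twist_word_act[OF half_twist_word_self_orthogonal[OF assms(1,2)] _ _ this]
  show "act w y = Suc y" "act w (Suc y) = y"
    using *[of y] *[of "Suc y"] assms(3) by simp_all
qed

lemma act_upt:
  "a \<le> b \<Longrightarrow> act [a..<b] x = (if x = a then b else if a < x \<and> x \<le> b then x - 1 else x)"
  by (induction b rule: dec_induct) (auto simp: sw_eq)

lemma act_rev_upt:
  "a \<le> b \<Longrightarrow> act (rev [a..<b]) x = (if x = b then a else if a \<le> x \<and> x < b then x + 1 else x)"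
  by (induction b arbitrary: x rule: dec_induct) (auto simp: sw_eq)

lemma br_commute:
  assumes "\<And>i j. i \<in> set u \<Longrightarrow> j \<in> set v \<Longrightarrow> distant i j"
  shows "br u * br v = br v * br u"
proof -
  have gen: "gen i * br v = br v * gen i" if "\<And>j. j \<in> set v \<Longrightarrow> distant i j" for i
    using that
  proof (induction v)
    case (Cons j v)
    have "gen i * br (j # v) = gen i * (gen j * br v)" by (simp only: br_Cons[of j v])
    also have "\<dots> = gen j * (gen i * br v)" using Cons.prems by (intro gen_distant') simp
    also have "\<dots> = gen j * (br v * gen i)" using Cons by simp
    also have "\<dots> = br (j # v) * gen i" by (simp only: br_Cons[of j v] mult.assoc)
    finally show ?case .
  qed simp
  show ?thesis
    using assms
  proof (induction u)
    case (Cons i u)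
    have "br (i # u) * br v = gen i * (br u * br v)" by (simp only: br_Cons[of i u] mult.assoc)
    also have "\<dots> = (gen i * br v) * br u" using Cons by (simp add: mult.assoc)
    also have "\<dots> = (br v * gen i) * br u" using Cons.prems by (subst gen) auto
    also have "\<dots> = br v * br (i # u)" by (simp only: br_Cons[of i u] mult.assoc)
    finally show ?case .
  qed simp
qed

text \<open>Inductively, one braid relation brings the lowest letter \<open>a\<close> from the two
  ends into the centre. This identity recentres the fat strand in \<open>S'_gen_S\<close>.\<close>

lemma br_palindrome:
  "a \<le> b \<Longrightarrow> br [a..<b] * gen b * br (rev [a..<b]) =
    br (rev [Suc a..<Suc b]) * gen a * br [Suc a..<Suc b]"
proof (induction a rule: inc_induct)
  case base
  then show ?case by simp
next
  case (step a)
  let ?x = "br [Suc (Suc a)..<Suc b]" and ?y = "br (rev [Suc (Suc a)..<Suc b])"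
  have e: "[a..<b] = a # [Suc a..<b]" "[Suc a..<Suc b] = Suc a # [Suc (Suc a)..<Suc b]"
    using step.hyps by (simp_all add: upt_conv_Cons del: upt_Suc)
  have c: "gen a * ?x = ?x * gen a" "gen a * ?y = ?y * gen a"
    by (rule br_commute; auto simp: distant_def)+
  have "br [a..<b] * gen b * br (rev [a..<b]) =
      gen a * (br [Suc a..<b] * gen b * br (rev [Suc a..<b])) * gen a"
    unfolding e by (simp only: rev.simps br_append br_Cons[of a "[Suc a..<b]"] mult.assoc)
  also have "\<dots> = (gen a * ?y) * gen (Suc a) * (?x * gen a)"
    unfolding step.IH by (simp only: mult.assoc)
  also have "\<dots> = ?y * (gen a * (gen (Suc a) * gen a)) * ?x"
    unfolding c(2) unfolding c(1)[symmetric] by (simp only: mult.assoc)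
  also have "\<dots> = ?y * (gen (Suc a) * (gen a * gen (Suc a))) * ?x"
    by (simp add: gen_adjacent[of a "Suc a"] adjacent_def)
  also have "\<dots> = br (rev [Suc a..<Suc b]) * gen a * br [Suc a..<Suc b]"
    unfolding e by (simp only: rev.simps br_append br_Cons[of "Suc a" "[Suc (Suc a)..<Suc b]"] mult.assoc)
  finally show ?case .
qed

text \<open>By \<open>half_twist_flip\<close> each half twist reflects the index of a generator, and
  two reflections cancel.\<close>

lemma half_twist_central:
  assumes "set w \<subseteq> {1..<N}"
  shows "half_twist {1..<N} ^ 2 * br w = br w * half_twist {1..<N} ^ 2"
  using assms
proof (induction w)
  case (Cons i w)
  let ?H = "half_twist {1..<N}"
  obtain b where N: "N = Suc b" "1 \<le> i" "i \<le> b" using Cons.prems by (cases N) auto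
  have "gen i * ?H = ?H * gen (1 + b - i)" "gen (1 + b - i) * ?H = ?H * gen i"
    using half_twist_flip[of 1 i b] half_twist_flip[of 1 "1 + b - i" b] N by auto
  note flip = this
  have "gen i * ?H ^ 2 = (gen i * ?H) * ?H" by (simp only: power2_eq_square mult.assoc)
  also have "\<dots> = ?H * (gen (1 + b - i) * ?H)" unfolding flip(1) by (simp only: mult.assoc)
  also have "\<dots> = ?H ^ 2 * gen i" unfolding flip(2) by (simp only: power2_eq_square mult.assoc)
  finally have g: "gen i * ?H ^ 2 = ?H ^ 2 * gen i" .
  have "?H ^ 2 * br (i # w) = (?H ^ 2 * gen i) * br w" by (simp only: br_Cons[of i w] mult.assoc)
  also have "\<dots> = gen i * (?H ^ 2 * br w)" unfolding g[symmetric] by (simp only: mult.assoc)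
  also have "\<dots> = br (i # w) * ?H ^ 2" using Cons by (simp only: br_Cons[of i w] mult.assoc) simp
  finally show ?case .
qed simp

lemma half_twist_word_length_Suc:
  assumes "half_twist_word {Suc p..<p + f} w"
  shows "2 * length w = f * (f - 1)"
proof (cases "f \<le> 1")
  case True
  then have "{Suc p..<p + f} = {}" by auto
  then have "set w = {}" using half_twist_word_set[OF assms] by simp
  then show ?thesis using True by (cases f) auto
next
  case False
  then have e: "p + f = Suc (p + f - 1)" "Suc p \<le> p + f - 1" by auto
  have "2 * length w = (p + f - 1 + 2 - Suc p) * (p + f - 1 + 1 - Suc p)"
    by (rule half_twist_word_length[OF _ e(2)]) (use assms e(1) in simp)
  then show ?thesis using False by (simp add: mult.commute)
qed

section \<open>Moving a fat strand\<close>

text \<open>The letters of the gaps of parity \<open>e\<close>, without the gap \<open>p\<close> of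
  the fat strand. The choice \<open>e = p\<close> gives the letters of \<open>J c\<close> outside
  \<open>K\<close>, and \<open>e = Suc p\<close> gives the whole other set
  (\<open>J_eq\<close>).\<close>

definition side_word :: "nat \<Rightarrow> nat \<Rightarrow> nat \<Rightarrow> nat \<Rightarrow> nat list" where
  "side_word f M p e = map (thin f p) (filter (\<lambda>r. even (r + e) \<and> r \<noteq> p) [1..<M])"

lemma set_side_word:
  "y \<in> set (side_word f M p e) \<longleftrightarrow>
    (\<exists>r. 1 \<le> r \<and> r < M \<and> even (r + e) \<and> r \<noteq> p \<and> y = thin f p r)"
  by (auto simp: side_word_def)

lemma thin_mem_side_word:
  "thin f p r \<in> set (side_word f M p e) \<longleftrightarrow> 1 \<le> r \<and> r < M \<and> even (r + e) \<and> r \<noteq> p"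
  by (auto simp: set_side_word)

lemma side_word_range:
  assumes "y \<in> set (side_word f M p e)"
  shows "1 \<le> y" "y < M + f" "y < p \<or> p + f < y"
proof -
  obtain r where "1 \<le> r" "r < M" "r \<noteq> p" "y = thin f p r"
    using assms unfolding set_side_word by blast
  then show "1 \<le> y" "y < M + f" "y < p \<or> p + f < y" by (auto simp: thin_def)
qed

lemma distinct_side_word: "distinct (side_word f M p e)"
  by (auto simp: side_word_def distinct_map inj_on_def)

lemma self_orthogonal_side_word: "self_orthogonal (set (side_word f M p e))"
  unfolding self_orthogonal_def
proof
  fix y assume "y \<in> set (side_word f M p e)"
  then obtain r where r: "even (r + e)" "r \<noteq> p" "y = thin f p r" unfolding set_side_word by blast
  show "Suc y \<notin> set (side_word f M p e)"
  proof
    assume "Suc y \<in> set (side_word f M p e)"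
    then obtain r' where r': "even (r' + e)" "r' \<noteq> p" "Suc y = thin f p r'"
      unfolding set_side_word by blast
    then have "r' = Suc r" using r by (auto simp: thin_def split: if_splits)
    then show False using r r' by simp
  qed
qed

lemma act_side_word:
  assumes "1 \<le> r" "r \<le> M" "1 \<le> p"
  shows "act (side_word f M p e) (thin f p r) = thin f p
    (if r < M \<and> even (r + e) \<and> r \<noteq> p then r + 1
     else if 1 < r \<and> odd (r + e) \<and> r \<noteq> Suc p then r - 1 else r)"
proof -
  note act = act_self_orthogonal[OF distinct_side_word self_orthogonal_side_word]
  have up: "thin f p (Suc r) = Suc (thin f p r)" if "r \<noteq> p" for r
    using that by (auto simp: thin_def)
  consider "r < M" "even (r + e)" "r \<noteq> p" | "1 < r" "odd (r + e)" "r \<noteq> Suc p"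
    | "\<not> (r < M \<and> even (r + e) \<and> r \<noteq> p)" "\<not> (1 < r \<and> odd (r + e) \<and> r \<noteq> Suc p)" by blast
  then show ?thesis
  proof cases
    case 1
    then show ?thesis using act(1)[of "thin f p r"] assms up by (simp add: thin_mem_side_word)
  next
    case 2
    then obtain q where q: "r = Suc q" by (cases r) auto
    then have "thin f p q \<in> set (side_word f M p e)" using 2 assms by (auto simp: thin_mem_side_word)
    from act(2)[OF this] show ?thesis using 2 q up[of q] by simp
  next
    case 3
    have "thin f p r \<notin> set (side_word f M p e)" using 3 assms by (simp add: thin_mem_side_word)
    moreover have "thin f p r = 0 \<or> thin f p r - 1 \<notin> set (side_word f M p e)"
    proof (rule ccontr)
      assume h: "\<not> ?thesis"
      then have "1 \<le> thin f p r - 1" using side_word_range(1) by blast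
      then have "1 < r" using assms by (auto simp: thin_def split: if_splits)
      then obtain q where q: "r = Suc q" "1 \<le> q" by (cases r) auto
      show False
      proof (cases "q = p")
        case True
        then have "thin f p r - 1 = p + f" using q by (simp add: thin_def)
        then show False using h side_word_range(3)[of "p + f" f M p e] by simp
      next
        case False
        then have "thin f p r - 1 = thin f p q" using q up[of q] by simp
        then show False using h 3 q False by (auto simp: thin_mem_side_word)
      qed
    qed
    ultimately have "act (side_word f M p e) (thin f p r) = thin f p r"
      by (intro act_fixed) auto
    then show ?thesis using 3 by (simp only: if_False)
  qed
qed

lemma act_side_word_fat:
  assumes "p < x" "x \<le> p + f"
  shows "act (side_word f M p e) x = x"
proof (rule act_fixed)
  show "x = 0 \<or> x - 1 \<notin> set (side_word f M p e)" "x \<notin> set (side_word f M p e)"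
    using side_word_range(3)[of "x - 1" f M p e] side_word_range(3)[of x f M p e] assms by auto
qed

lemma length_filter_remove:
  "distinct xs \<Longrightarrow> x \<in> set xs \<Longrightarrow> P x \<Longrightarrow>
    Suc (length (filter (\<lambda>r. P r \<and> r \<noteq> x) xs)) = length (filter P xs)"
proof (induction xs)
  case (Cons a xs)
  show ?case
  proof (cases "a = x")
    case True
    then have "filter (\<lambda>r. P r \<and> r \<noteq> x) xs = filter P xs" using Cons.prems by (intro filter_cong) auto
    then show ?thesis using True Cons.prems by simp
  next
    case False
    then show ?thesis using Cons by auto
  qed
qed simp

lemma length_side_words:
  assumes "1 \<le> p" "p < M"
  shows "length (side_word f M p p) + length (side_word f M p (Suc p)) + 2 = M"
proof -
  have "filter (\<lambda>r. even (r + Suc p) \<and> r \<noteq> p) [1..<M] = filter (\<lambda>r. \<not> even (r + p)) [1..<M]"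
    by (intro filter_cong) auto
  moreover have "Suc (length (filter (\<lambda>r. even (r + p) \<and> r \<noteq> p) [1..<M])) =
      length (filter (\<lambda>r. even (r + p)) [1..<M])"
    by (rule length_filter_remove) (use assms in auto)
  moreover have "length (filter (\<lambda>r. even (r + p)) [1..<M]) +
      length (filter (\<lambda>r. \<not> even (r + p)) [1..<M]) = M - 1"
    using sum_length_filter_compl[of "\<lambda>r. even (r + p)" "[1..<M]"] by simp
  ultimately show ?thesis using assms by (simp add: side_word_def del: even_add)
qed

lemma length_filter_even:
  "length (filter (\<lambda>r. even (r + e)) [1..<2 * h + 1]) = h"
proof (induction h)
  case (Suc h)
  have "[1..<2 * Suc h + 1] = [1..<2 * h + 1] @ [2 * h + 1, 2 * h + 2]"
    by (simp add: upt_Suc_append)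
  then show ?case using Suc by simp
qed simp

lemma length_side_word_odd:
  assumes "1 \<le> p" "p < M" "M = 2 * h + 1"
  shows "Suc (length (side_word f M p p)) = h" "length (side_word f M p (Suc p)) = h"
proof -
  have "Suc (length (filter (\<lambda>r. even (r + p) \<and> r \<noteq> p) [1..<M])) =
      length (filter (\<lambda>r. even (r + p)) [1..<M])"
    by (rule length_filter_remove) (use assms in auto)
  then show 1: "Suc (length (side_word f M p p)) = h"
    unfolding side_word_def length_map assms(3) length_filter_even .
  show "length (side_word f M p (Suc p)) = h"
    using 1 length_side_words[OF assms(1,2), of f] assms(3) by simp
qed

lemma length_altword:
  "length (altword v b (2 * h)) = h * (length (v b) + length (v (\<not> b)))"
  "length (altword v b (2 * h + 1)) = h * (length (v b) + length (v (\<not> b))) + length (v b)"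
proof -
  show 1: "length (altword v b (2 * h)) = h * (length (v b) + length (v (\<not> b)))" for b
    by (induction h) auto
  show "length (altword v b (2 * h + 1)) = h * (length (v b) + length (v (\<not> b))) + length (v b)"
    using 1[of "\<not> b"] by simp
qed

text \<open>A full half turn of a bouncing configuration with a fat strand at \<open>l b\<close>, which is
  completed to the half twist by a half twist of the fat strand itself.\<close>

lemma altword_half_twist:
  fixes l s :: "bool \<Rightarrow> nat"
  assumes "1 < M" "\<And>b. s (\<not> b) + s b = 2 * h + 1"
    and thin: "\<And>b r. 1 \<le> r \<Longrightarrow> r \<le> M \<Longrightarrow>
      act (v b) (thin f (l b) r) = thin f (l (\<not> b)) (swap_step M (s b) r)"
    and fat: "\<And>b i. 1 \<le> i \<Longrightarrow> i \<le> f \<Longrightarrow> act (v b) (l b + i) = l (\<not> b) + i"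
    and set: "\<And>b. set (v b) \<subseteq> {1..<M + f}"
    and l': "l' = l (b = even M)" "l b + l' = M"
    and len: "2 * length (altword v b M) + f * (f - 1) = (M + f) * (M + f - 1)"
  shows "br (altword v b M) * half_twist {Suc l'..<l' + f} = half_twist {1..<M + f}"
proof -
  obtain w where w: "half_twist_word {Suc l'..<l' + f} w" "half_twist {Suc l'..<l' + f} = br w"
      "set w = {Suc l'..<l' + f}"
    using obtain_half_twist_word by blast
  have M: "0 < M" using assms(1) by simp
  have "l' \<le> M" using l'(2) by simp
  have wfat: "act w (l' + i) = l' + (f + 1 - i)" if "1 \<le> i" "i \<le> f" for i
    using half_twist_word_act[OF w(1), of "Suc l'" "l' + f" "l' + i"] that by auto
  have wfix: "act w y = y" if "y \<le> l' \<or> l' + f < y" for y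
    by (rule act_fixed) (use w(3) that in auto)
  have step: "act (altword v b M) (thin f (l b) (fold_cycle M m)) =
      thin f l' (fold_cycle M (m + M))" if "even (m + 1 + s b)" for m
    using act_altword[of M s h v "\<lambda>b. thin f (l b)" m b M, OF M assms(2) thin that] l'(1) by simp
  have stepfat: "act (altword v b k) (l b + i) = l (b = even k) + i" if "1 \<le> i" "i \<le> f" for i b k
  proof (induction k arbitrary: b)
    case (Suc k)
    have "((\<not> b) = even k) = (b = odd k)" by auto
    then show ?case using Suc[of "\<not> b"] fat[OF that] by simp
  qed simp
  obtain N where N: "M + f = Suc N" "1 \<le> N" using assms(1) by (cases "M + f") auto
  \<comment> \<open>The inner twist \<open>w\<close> supplies the reversal within the fat strand and
    the missing \<open>f * (f - 1)\<close> ordered pairs; thin strands are reversed by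
    \<open>fold_cycle_half\<close>.\<close>
  have "half_twist_word {1..<Suc N} (altword v b M @ w)"
  proof (rule half_twist_word_intervalI)
    show "set (altword v b M @ w) \<subseteq> {1..<Suc N}"
      using set_altword[of v "{1..<M + f}" b M, OF set] w(3) N(1) \<open>l' \<le> M\<close> by auto
    show "2 * length (altword v b M @ w) \<le> (N + 2 - 1) * (N + 1 - 1)"
      using len half_twist_word_length_Suc[OF w(1)] N by simp
    fix x assume x: "1 \<le> x" "x \<le> Suc N"
    consider r where "1 \<le> r" "r \<le> M" "x = thin f (l b) r" | i where "1 \<le> i" "i \<le> f" "x = l b + i"
    proof (cases "x \<le> l b")
      case True
      then show ?thesis using that(1)[of x] x l'(2) by (simp add: thin_def)
    next
      case False
      show ?thesis
      proof (cases "x \<le> l b + f")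
        case True
        then show ?thesis using that(2)[of "x - l b"] False by simp
      next
        case False
        then show ?thesis using that(1)[of "x - f"] x N by (auto simp: thin_def)
      qed
    qed
    then show "act (altword v b M @ w) x = 1 + Suc N - x"
    proof cases
      case (1 r)
      obtain m where m: "fold_cycle M m = r" "even (m + 1 + s b)" using fold_cycle_surj 1 by blast
      have "act (altword v b M) x = thin f l' (M + 1 - r)"
        using step[OF m(2)] m(1) fold_cycle_half[OF M, of m] 1 by simp
      moreover have "act w (thin f l' (M + 1 - r)) = thin f l' (M + 1 - r)"
        by (rule wfix) (auto simp: thin_def)
      moreover have "thin f l' (M + 1 - r) = 1 + Suc N - x"
        using 1 l'(2) N by (auto simp: thin_def)
      ultimately show ?thesis by simp
    next
      case (2 i)
      then have "act (altword v b M @ w) x = l' + (f + 1 - i)"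
        using stepfat[OF 2(1,2)] wfat[OF 2(1,2)] l'(1) by simp
      then show ?thesis using 2 l'(2) N by simp
    qed
  qed (use N in simp)
  from half_twist_eqI[OF this] show ?thesis using w(2) N(1) by simp
qed


section \<open>The dihedral relation\<close>

text \<open>The strand at \<open>p + f + 1\<close> passes to \<open>p + 1\<close>, while the
  \<open>f\<close> strands before it move up by one position.\<close>

definition desc :: "nat \<Rightarrow> nat \<Rightarrow> nat list" where
  "desc f p = rev [Suc p..<Suc (p + f)]"

definition asc :: "nat \<Rightarrow> nat \<Rightarrow> nat list" where
  "asc f p = [Suc p..<Suc (p + f)]"

definition inner_twist :: "nat \<Rightarrow> nat \<Rightarrow> braid" where
  "inner_twist f p = half_twist {Suc p..<p + f}"

text \<open>The strands at \<open>p\<close> and \<open>p + f + 1\<close> change places, and the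
  \<open>f\<close> strands between them return to their positions.\<close>

definition over :: "nat \<Rightarrow> nat \<Rightarrow> nat list" where
  "over f p = desc f p @ [p] @ asc f p"

lemma swap_step_split:
  assumes "r' = (if r < M \<and> even (r + p) \<and> r \<noteq> p then r + 1
      else if 1 < r \<and> odd (r + p) \<and> r \<noteq> Suc p then r - 1 else r)"
    and "1 \<le> p" "p < M"
  shows "(if r' = p then Suc p else if r' = Suc p then p else r') = swap_step M p r"
proof -
  consider "r = p" | "r = Suc p" | "r \<noteq> p" "r \<noteq> Suc p" by blast
  then show ?thesis
  proof cases
    case 3
    then have "r' = swap_step M p r" using assms(1) by (auto simp: swap_step_def)
    moreover have "r' \<noteq> p \<and> r' \<noteq> Suc p"
    proof -
      consider "even (r + p)" "r' = r + 1" | "odd (r + p)" "r' = r - 1" "1 < r" | "r' = r"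
        using assms(1) 3 by (auto split: if_splits)
      then show ?thesis using 3 by cases (presburger+)
    qed
    ultimately show ?thesis by simp
  qed (use assms in \<open>simp_all add: swap_step_def\<close>)
qed

lemma br_over: "br (over f p) = br (desc f p) * gen p * br (asc f p)"
  by (simp only: over_def br_append mult.assoc)

lemma set_desc: "set (desc f p) = {Suc p..p + f}" "set (asc f p) = {Suc p..p + f}"
  by (auto simp: desc_def asc_def)

lemma length_desc: "length (desc f p) = f" "length (asc f p) = f"
  by (simp_all add: desc_def asc_def del: upt_Suc)

lemma act_desc: "act (desc f p) x =
    (if x = Suc (p + f) then Suc p else if p < x \<and> x \<le> p + f then x + 1 else x)"
  using act_rev_upt[of "Suc p" "Suc (p + f)" x] by (auto simp: desc_def simp del: upt_Suc)

lemma act_asc: "act (asc f p) x =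
    (if x = Suc p then Suc (p + f) else if Suc p < x \<and> x \<le> Suc (p + f) then x - 1 else x)"
  using act_upt[of "Suc p" "Suc (p + f)" x] by (auto simp: asc_def simp del: upt_Suc)

lemma obtain_inner_word:
  obtains w where "inner_twist f p = br w" "set w = {Suc p..<p + f}" "2 * length w = f * (f - 1)"
    "\<And>x. act w x = (if p < x \<and> x \<le> p + f then p + (p + f + 1) - x else x)"
proof -
  obtain w where w: "half_twist_word {Suc p..<p + f} w" "half_twist {Suc p..<p + f} = br w"
      "set w = {Suc p..<p + f}"
    using obtain_half_twist_word by blast
  have "act w x = p + (p + f + 1) - x" if "p < x" "x \<le> p + f" for x
    using half_twist_word_act[OF w(1), of "Suc p" "p + f" x] that by auto
  moreover have "act w x = x" if "\<not> (p < x \<and> x \<le> p + f)" for x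
    by (rule act_fixed) (use w(3) that in auto)
  ultimately show ?thesis
    using that[of w] w half_twist_word_length_Suc[OF w(1)] by (simp add: inner_twist_def)
qed

text \<open>All four products are half twists of the fat strand together with one thin strand: they
  reverse the same \<open>f + 1\<close> positions with the least possible length.\<close>

lemma inner_twist_desc:
  "inner_twist f p * br (desc f p) = br (desc f p) * inner_twist f (Suc p)"
  "br (asc f p) * inner_twist f p = inner_twist f (Suc p) * br (asc f p)"
proof -
  obtain v where v: "inner_twist f p = br v" "set v = {Suc p..<p + f}" "2 * length v = f * (f - 1)"
      "\<And>x. act v x = (if p < x \<and> x \<le> p + f then p + (p + f + 1) - x else x)"
    using obtain_inner_word by blast
  obtain w where w: "inner_twist f (Suc p) = br w" "set w = {Suc (Suc p)..<Suc p + f}"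
      "2 * length w = f * (f - 1)"
      "\<And>x. act w x = (if Suc p < x \<and> x \<le> Suc p + f then Suc p + (Suc p + f + 1) - x else x)"
    using obtain_inner_word by blast
  have *: "br u = half_twist {Suc p..<Suc (p + f)}"
    if "u \<in> {v @ desc f p, desc f p @ w, asc f p @ v, w @ asc f p}" "1 \<le> f" for u
  proof (rule half_twist_eqI[symmetric], rule half_twist_word_intervalI)
    show "set u \<subseteq> {Suc p..<Suc (p + f)}" using that v(2) w(2) by (auto simp: set_desc)
    have "2 * length u = f * (f - 1) + 2 * f" using that v(3) w(3) by (auto simp: length_desc)
    also have "\<dots> = (f + 1) * f" using that(2) by (cases f) auto
    finally show "2 * length u \<le> (p + f + 2 - Suc p) * (p + f + 1 - Suc p)" by simp
    show "act u x = Suc p + Suc (p + f) - x" if x: "Suc p \<le> x" "x \<le> Suc (p + f)" for x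
      using \<open>u \<in> _\<close> x v(4) w(4) by (auto simp: act_desc act_asc)
  qed (use that in simp)
  have "br (v @ desc f p) = br (desc f p @ w) \<and> br (asc f p @ v) = br (w @ asc f p)"
    if "1 \<le> f"
    using that *[of "v @ desc f p"] *[of "desc f p @ w"] *[of "asc f p @ v"] *[of "w @ asc f p"] by simp
  \<comment> \<open>For \<open>f = 0\<close> the interval of letters is empty, a case excluded in
    \<open>half_twist_word_intervalI\<close>; all words are trivial.\<close>
  moreover have "br (v @ desc f p) = br (desc f p @ w) \<and> br (asc f p @ v) = br (w @ asc f p)"
    if "f = 0" using that v(2) w(2) by (simp add: desc_def asc_def)
  ultimately show
    "inner_twist f p * br (desc f p) = br (desc f p) * inner_twist f (Suc p)"
    "br (asc f p) * inner_twist f p = inner_twist f (Suc p) * br (asc f p)"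
    using v(1) w(1) by (cases f; simp)+
qed

text \<open>In \<open>over\<close> the two thin strands cross each other and all fat ones; the inner
  twist crosses the fat ones among themselves.\<close>

lemma half_twist_over:
  "half_twist {p..<Suc (p + f)} = br (over f p) * inner_twist f p"
proof -
  obtain v where v: "inner_twist f p = br v" "set v = {Suc p..<p + f}" "2 * length v = f * (f - 1)"
      "\<And>x. act v x = (if p < x \<and> x \<le> p + f then p + (p + f + 1) - x else x)"
    using obtain_inner_word by blast
  have "half_twist_word {p..<Suc (p + f)} (over f p @ v)"
  proof (rule half_twist_word_intervalI)
    show "set (over f p @ v) \<subseteq> {p..<Suc (p + f)}" using v(2) by (auto simp: over_def set_desc)
    have "2 * length (over f p @ v) = f * (f - 1) + 2 * (2 * f + 1)"
      using v(3) by (simp add: over_def length_desc)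
    also have "\<dots> = (f + 2) * (f + 1)" by (cases f) auto
    finally show "2 * length (over f p @ v) \<le> (p + f + 2 - p) * (p + f + 1 - p)" by simp
    show "act (over f p @ v) x = p + Suc (p + f) - x" if "p \<le> x" "x \<le> Suc (p + f)" for x
      using that v(4) by (auto simp: over_def act_desc act_asc sw_eq)
  qed simp
  from half_twist_eqI[OF this] show ?thesis using v(1) by simp
qed

lemma inner_twist_commute:
  assumes "\<And>j. j \<in> set w \<Longrightarrow> j < p \<or> p + f < j"
  shows "inner_twist f p * br w = br w * inner_twist f p"
proof -
  obtain v where v: "inner_twist f p = br v" "set v = {Suc p..<p + f}"
    unfolding inner_twist_def using obtain_half_twist_word[of "{Suc p..<p + f}"] by (metis finite_atLeastLessThan)
  show ?thesis unfolding v(1)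
  proof (rule br_commute)
    fix i j assume i: "i \<in> set v" and j: "j \<in> set w"
    have "Suc p \<le> i" "i < p + f" using i v(2) by auto
    then show "distant i j" using assms[OF j] unfolding distant_def by linarith
  qed
qed

lemma inner_twist_commute_gen: "inner_twist f (Suc p) * gen p = gen p * inner_twist f (Suc p)"
  by (rule inner_twist_commute) simp

lemma inner_twist_over: "inner_twist f p * br (over f p) = br (over f p) * inner_twist f p"
proof -
  have "inner_twist f p * br (over f p) =
      (inner_twist f p * br (desc f p)) * gen p * br (asc f p)"
    by (simp only: br_over mult.assoc)
  also have "\<dots> = br (desc f p) * (inner_twist f (Suc p) * gen p) * br (asc f p)"
    unfolding inner_twist_desc by (simp only: mult.assoc)
  also have "\<dots> = br (desc f p) * gen p * (inner_twist f (Suc p) * br (asc f p))"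
    unfolding inner_twist_commute_gen by (simp only: mult.assoc)
  also have "\<dots> = br (over f p) * inner_twist f p"
    unfolding inner_twist_desc(2)[symmetric] by (simp only: br_over mult.assoc)
  finally show ?thesis .
qed

lemma alt_prod_even: "alt_prod (2 * k) x y = (x * y) ^ k"
  by (induction k) (auto simp: mult.assoc)

lemma alt_prod_double: "N = 2 * k \<Longrightarrow> alt_prod N x y = (x * y) ^ k"
  by (simp add: alt_prod_even)

lemma alt_prod_add:
  "alt_prod (k + l) x y = alt_prod k x y * (if even k then alt_prod l x y else alt_prod l y x)"
  by (induction k arbitrary: x y) (auto simp: mult.assoc)

text \<open>Needed to push an inner twist through factors that move the fat strand alternately to
  and fro.\<close>

lemma alt_prod_intertwine:
  fixes a b x y :: braid
  assumes "a * x = x * b" "b * y = y * a"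
  shows "a * alt_prod k x y = alt_prod k x y * (if even k then a else b)"
  using assms
proof (induction k arbitrary: a b x y)
  case (Suc k)
  have "a * alt_prod (Suc k) x y = x * (b * alt_prod k y x)"
    using Suc.prems(1) by (simp add: mult.assoc[symmetric])
  also have "b * alt_prod k y x = alt_prod k y x * (if even k then b else a)"
    by (rule Suc.IH) (use Suc.prems in auto)
  finally show ?case by (simp add: mult.assoc)
qed simp

lemma commute_power:
  fixes x y :: "'a::monoid_mult"
  assumes "x * y = y * x" shows "x * y ^ k = y ^ k * x"
  using power_commuting_commutes[of y x k] assms by simp

text \<open>Below, \<open>z\<close> is the full twist and \<open>x\<close> moves the fat strand.\<close>

lemma conj_iff:
  fixes e e' d d' x z :: braid
  assumes "e * x = x * e'" "d * x = x * d'" "z * x = x * z"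
  shows "e ^ k * d ^ 2 = z \<longleftrightarrow> e' ^ k * d' ^ 2 = z"
proof -
  have pow: "a ^ k * x = x * b ^ k" if "a * x = x * b" for a b and k :: nat
  proof (induction k)
    case (Suc k)
    have "a ^ Suc k * x = a * (a ^ k * x)" by (simp add: mult.assoc)
    also have "\<dots> = (a * x) * b ^ k" using Suc by (simp add: mult.assoc)
    finally show ?case using that by (simp add: mult.assoc)
  qed simp
  have "(e ^ k * d ^ 2) * x = e ^ k * (x * d' ^ 2)" using pow[OF assms(2), of 2] by (simp add: mult.assoc)
  also have "\<dots> = x * (e' ^ k * d' ^ 2)" using pow[OF assms(1), of k] by (simp flip: mult.assoc)
  finally have *: "(e ^ k * d ^ 2) * x = x * (e' ^ k * d' ^ 2)" .
  show ?thesis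
  proof
    assume "e ^ k * d ^ 2 = z"
    then have "x * (e' ^ k * d' ^ 2) = x * z" using * assms(3) by simp
    then show "e' ^ k * d' ^ 2 = z" by (rule braid_left_cancel)
  next
    assume "e' ^ k * d' ^ 2 = z"
    then have "(e ^ k * d ^ 2) * x = z * x" using * assms(3) by simp
    then show "e ^ k * d ^ 2 = z" by (rule braid_right_cancel)
  qed
qed

locale strand_words =
  fixes f M :: nat
begin

text \<open>The fat strand, \<open>f\<close> strands wide, lies between the thin strands of ranks \<open>p\<close> and \<open>p + 1\<close>.
  The braid \<open>S p\<close> carries it over to the next gap, \<open>C p\<close> exchanges its two thin neighbours, and
  \<open>D p\<close> is its inner half twist, so that the half twist of \<open>{p..p + f}\<close> is \<open>C p * D p\<close>.\<close>

definition "outer p = br (side_word f M p p)"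
definition "other p = br (side_word f M p (Suc p))"
definition "S p = br (desc f p)"
definition "S' p = br (asc f p)"
definition "C p = br (over f p)"
definition "D p = inner_twist f p"
definition "Delta = half_twist {1..<M + f}"

lemma C_eq: "C p = S p * gen p * S' p"
  by (simp only: C_def br_over S_def S'_def mult.assoc)

lemma outer_range: "y \<in> set (side_word f M p p) \<Longrightarrow> Suc y < p \<or> Suc (p + f) < y"
proof -
  assume "y \<in> set (side_word f M p p)"
  then obtain r where "even (r + p)" "r \<noteq> p" "y = thin f p r" unfolding set_side_word by blast
  moreover have "Suc r \<noteq> p" "r \<noteq> Suc p" using \<open>even (r + p)\<close> by auto
  ultimately show ?thesis by (auto simp: thin_def)
qed

lemma outer_S: "outer p * S p = S p * outer p"
  unfolding outer_def S_def
  by (rule br_commute) (use outer_range in \<open>fastforce simp: distant_def set_desc\<close>)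

lemma outer_C: "outer p * C p = C p * outer p"
  unfolding outer_def C_def
  by (rule br_commute) (use outer_range in \<open>fastforce simp: distant_def set_desc over_def\<close>)

lemma D_outer: "D p * outer p = outer p * D p"
  unfolding outer_def D_def by (rule inner_twist_commute) (use side_word_range(3) in blast)

lemma D_other: "D p * other p = other p * D p"
  unfolding other_def D_def by (rule inner_twist_commute) (use side_word_range(3) in blast)

lemma D_C: "D p * C p = C p * D p"
  unfolding D_def C_def by (rule inner_twist_over)

lemma D_S: "D p * S p = S p * D (Suc p)"
  unfolding D_def S_def by (rule inner_twist_desc)

lemma S'_D: "S' p * D p = D (Suc p) * S' p"
  unfolding D_def S'_def by (rule inner_twist_desc)

section \<open>Passing the fat strand to the next gap\<close>

lemma br_set_eqI:
  assumes "distinct u" "self_orthogonal (set u)" "distinct v" "self_orthogonal (set v)" "set u = set v"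
  shows "br u = br v"
  using br_self_orthogonal[OF assms(1,2)] br_self_orthogonal[OF assms(3,4)] assms(5) by simp

lemma thin_Suc: "r \<noteq> Suc p \<Longrightarrow> thin f (Suc p) r = thin f p r"
  by (auto simp: thin_def)

text \<open>With the fat strand in the gap \<open>Suc p\<close>, the gap \<open>p\<close> becomes an
  ordinary one, with the single letter \<open>p\<close>.\<close>

lemma outer_gen:
  assumes "1 \<le> p" "p < M" shows "outer p * gen p = other (Suc p)"
proof -
  let ?u = "side_word f M p p @ [p]" and ?v = "side_word f M (Suc p) (Suc (Suc p))"
  have "y \<in> set ?u \<longleftrightarrow> y \<in> set ?v" for y
  proof -
    have "y \<in> set ?u \<longleftrightarrow> (\<exists>r. 1 \<le> r \<and> r < M \<and> even (r + p) \<and> y = thin f p r)"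
      using assms by (auto simp: set_side_word thin_def)
    also have "\<dots> \<longleftrightarrow> y \<in> set ?v"
    proof -
      have "even (r + p) \<longleftrightarrow> even (r + Suc (Suc p)) \<and> r \<noteq> Suc p" for r by auto
      then show ?thesis unfolding set_side_word using thin_Suc[of _ p] by metis
    qed
    finally show ?thesis .
  qed
  then have "set ?u = set ?v" by blast
  moreover have "distinct ?u"
    using distinct_side_word side_word_range(3)[of p f M p p] by auto
  ultimately have "br ?u = br ?v"
    using br_set_eqI distinct_side_word self_orthogonal_side_word by metis
  then show ?thesis by (simp add: outer_def other_def)
qed

text \<open>With the fat strand in the gap \<open>p\<close>, the gap \<open>Suc p\<close> is an
  ordinary one, and its letter is shifted by \<open>f\<close>.\<close>

lemma other_eq:
  assumes "Suc p < M" shows "other p = gen (Suc (p + f)) * outer (Suc p)"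
proof -
  let ?u = "Suc (p + f) # side_word f M (Suc p) (Suc p)" and ?v = "side_word f M p (Suc p)"
  have "y \<in> set ?u \<longleftrightarrow> y \<in> set ?v" for y
  proof -
    have "y \<in> set ?v \<longleftrightarrow> (\<exists>r. 1 \<le> r \<and> r < M \<and> even (r + Suc p) \<and> y = thin f p r)"
      unfolding set_side_word by fastforce
    also have "\<dots> \<longleftrightarrow> y = thin f p (Suc p) \<or>
        (\<exists>r. 1 \<le> r \<and> r < M \<and> even (r + Suc p) \<and> r \<noteq> Suc p \<and> y = thin f (Suc p) r)"
      using assms thin_Suc[of _ p] by fastforce
    finally show ?thesis by (simp add: set_side_word thin_def)
  qed
  then have "set ?u = set ?v" by blast
  moreover have "distinct ?u"
    using distinct_side_word side_word_range(3)[of "Suc (p + f)" f M "Suc p" "Suc p"] by auto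
  ultimately have "br ?u = br ?v"
    using br_set_eqI distinct_side_word self_orthogonal_side_word by metis
  then show ?thesis using br_Cons[of "Suc (p + f)" "side_word f M (Suc p) (Suc p)"]
    by (simp add: outer_def other_def)
qed

lemma outer_Suc_S: "outer (Suc p) * S p = S p * outer (Suc p)"
  unfolding outer_def S_def
  by (rule br_commute) (use outer_range[of _ "Suc p"] in \<open>fastforce simp: distant_def set_desc\<close>)

lemma S'_gen_S: "S' p * gen (Suc (p + f)) * S p = C (Suc p)"
  using br_palindrome[of "Suc p" "Suc (p + f)"]
  by (simp add: C_def br_over S_def S'_def desc_def asc_def mult.assoc del: upt_Suc)

lemma S'_other_S:
  assumes "Suc p < M" shows "S' p * other p * S p = C (Suc p) * outer (Suc p)"
proof -
  have "S' p * other p * S p = S' p * gen (Suc (p + f)) * (outer (Suc p) * S p)"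
    unfolding other_eq[OF assms] by (simp only: mult.assoc)
  also have "\<dots> = (S' p * gen (Suc (p + f)) * S p) * outer (Suc p)"
    unfolding outer_Suc_S by (simp only: mult.assoc)
  finally show ?thesis unfolding S'_gen_S .
qed

text \<open>One period of the alternating product without the inner twist of the fat strand,
  beginning with either factor.\<close>

definition "E p = outer p * C p * other p"
definition "E' p = other p * outer p * C p"

text \<open>After \<open>S p\<close> is pulled to the front, \<open>gen p\<close> completes
  \<open>outer p\<close> to \<open>other (Suc p)\<close>, while \<open>S' p\<close> and the new
  \<open>S p\<close> conjugate \<open>other p\<close>; \<open>br_palindrome\<close> turns its letter
  next to the fat strand into \<open>C (Suc p)\<close>. The move by one gap changes the parity of
  the gap, so the two factors trade roles and \<open>E\<close> becomes \<open>E'\<close>.\<close>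

lemma E_S:
  assumes "1 \<le> p" "Suc p < M" shows "E p * S p = S p * E' (Suc p)"
proof -
  have "E p * S p = (outer p * S p) * gen p * (S' p * other p * S p)"
    by (simp only: E_def C_eq mult.assoc)
  also have "\<dots> = S p * (outer p * gen p) * (C (Suc p) * outer (Suc p))"
    unfolding outer_S S'_other_S[OF assms(2)] by (simp only: mult.assoc)
  also have "\<dots> = S p * E' (Suc p)"
    using assms by (simp add: outer_gen E'_def mult.assoc flip: outer_C)
  finally show ?thesis .
qed

lemma E'_other: "E' p * other p = other p * E p"
  by (simp add: E_def E'_def mult.assoc)

lemma Delta_central: "set w \<subseteq> {1..<M + f} \<Longrightarrow> Delta ^ 2 * br w = br w * Delta ^ 2"
  unfolding Delta_def by (rule half_twist_central)

lemma side_word_subset: "set (side_word f M p e) \<subseteq> {1..<M + f}"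
  using side_word_range by force

text \<open>In the full twist every pair of strands crosses twice. The periods \<open>E p\<close>
  never cross two fat strands, so these crossings must come from \<open>D p ^ 2\<close>.\<close>

definition "good p \<longleftrightarrow> E p ^ M * D p ^ 2 = Delta ^ 2"

lemma good_iff_good': "good p \<longleftrightarrow> E' p ^ M * D p ^ 2 = Delta ^ 2"
  unfolding good_def
  by (rule conj_iff[symmetric, OF E'_other D_other])
     (unfold other_def, rule Delta_central[OF side_word_subset])

lemma good_Suc:
  assumes "1 \<le> p" "Suc p < M" shows "good p \<longleftrightarrow> good (Suc p)"
proof -
  have "set (desc f p) \<subseteq> {1..<M + f}" using assms by (auto simp: set_desc)
  then have "Delta ^ 2 * S p = S p * Delta ^ 2" unfolding S_def by (rule Delta_central)
  from conj_iff[OF E_S[OF assms] D_S this, of M] show ?thesis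
    using good_iff_good'[of "Suc p"] by (simp add: good_def)
qed

lemma good_all:
  assumes "1 \<le> q" "q < M" "good q" "1 \<le> p" "p < M" shows "good p"
proof (cases "q \<le> p")
  case True
  then show ?thesis using assms(5)
  proof (induction p rule: dec_induct)
    case (step p)
    then show ?case using good_Suc[of p] assms(1) by simp
  qed (rule assms(3))
next
  case False
  then have "p \<le> q" by simp
  then show ?thesis using assms(4)
  proof (induction p rule: inc_induct)
    case (step p)
    then show ?case using good_Suc[of p] assms(2) by simp
  qed (rule assms(3))
qed

text \<open>The gap \<open>p\<close> is its own mirror image among \<open>2 * p\<close> thin
  strands, so \<open>altword_half_twist\<close> applies with the fat strand fixed in it.\<close>

lemma even_half:
  assumes "M = 2 * p" "1 \<le> p"
  shows "alt_prod M (outer p * C p) (other p) * D p = Delta"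
    and "alt_prod M (other p) (outer p * C p) * D p = Delta"
proof -
  define v where "v b = (if b then side_word f M p p @ over f p else side_word f M p (Suc p))" for b
  define s where "s b = (if b then p else Suc p)" for b
  have M: "1 < M" "p < M" using assms by auto
  have "br (altword v b M) * half_twist {Suc p..<p + f} = half_twist {1..<M + f}" for b
  proof (rule altword_half_twist[where l = "\<lambda>_. p" and s = s and h = p])
    show "s (\<not> b) + s b = 2 * p + 1" for b by (simp add: s_def)
    show "act (v b) (thin f p r) = thin f p (swap_step M (s b) r)" if "1 \<le> r" "r \<le> M" for b r
    proof -
      have o: "act (over f p) (thin f p r) = thin f p (if r = p then Suc p else if r = Suc p then p else r)" for r
        by (auto simp: over_def act_desc act_asc sw_eq thin_def)
      show ?thesis
      proof (cases b)
        case True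
        define r' where "r' = (if r < M \<and> even (r + p) \<and> r \<noteq> p then r + 1
          else if 1 < r \<and> odd (r + p) \<and> r \<noteq> Suc p then r - 1 else r)"
        have "act (v b) (thin f p r) = act (over f p) (act (side_word f M p p) (thin f p r))"
          using True by (simp add: v_def)
        also have "\<dots> = thin f p (swap_step M p r)"
          unfolding act_side_word[OF that assms(2)] r'_def[symmetric] o
          by (simp only: swap_step_split[OF r'_def assms(2) M(2)])
        finally show ?thesis using True by (simp add: s_def)
      next
        case False
        then show ?thesis using that M assms
          by (auto simp: v_def s_def act_side_word swap_step_def)
      qed
    qed
    show "act (v b) (p + i) = p + i" if "1 \<le> i" "i \<le> f" for b i
    proof -
      have "act (over f p) (p + i) = p + i"
        using that by (auto simp: over_def act_desc act_asc sw_eq)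
      then show ?thesis using that act_side_word_fat[of p "p + i" f M] by (auto simp: v_def)
    qed
    show "set (v b) \<subseteq> {1..<M + f}" for b
      using side_word_subset[of p p] side_word_subset[of p "Suc p"] M assms(2)
      by (auto simp: v_def over_def set_desc)
    have "length (v b) + length (v (\<not> b)) = M + 2 * f - 1"
      using length_side_words[OF assms(2) M(2), of f] M
      by (cases b) (auto simp: v_def over_def length_desc)
    then have "length (altword v b M) = p * (2 * p + 2 * f - 1)"
      unfolding assms(1) length_altword by simp
    moreover obtain q where "p = Suc q" using assms(2) by (cases p) auto
    ultimately show "2 * length (altword v b M) + f * (f - 1) = (M + f) * (M + f - 1)"
      using assms(1) by (cases f) (auto simp: algebra_simps)
  qed (use M assms in simp_all)
  from this[of True] this[of False] show
    "alt_prod M (outer p * C p) (other p) * D p = Delta"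
    "alt_prod M (other p) (outer p * C p) * D p = Delta"
    by (simp_all add: br_altword v_def Delta_def D_def inner_twist_def outer_def C_def other_def)
qed

text \<open>The mirror image of the gap \<open>p\<close> is \<open>Suc p\<close>. Cutting
  \<open>C p\<close> before \<open>S' p\<close> lets one factor carry the fat strand from
  \<open>p\<close> to \<open>Suc p\<close> and the other one carry it back; after the odd number
  \<open>M\<close> of factors it has reached the mirror gap.\<close>

lemma odd_half:
  assumes "M = 2 * p + 1" "1 \<le> p"
  shows "alt_prod M (outer p * S p * gen p) (S' p * other p) * D (Suc p) = Delta"
    and "alt_prod M (S' p * other p) (outer p * S p * gen p) * D p = Delta"
proof -
  define v where
    "v b = (if b then side_word f M p p @ desc f p @ [p] else asc f p @ side_word f M p (Suc p))" for b
  define s where "s b = (if b then p else Suc p)" for b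
  define l where "l b = (if b then p else Suc p)" for b
  have M: "1 < M" "p < M" "odd M" using assms by auto
  have "br (altword v b M) * half_twist {Suc (l (\<not> b))..<l (\<not> b) + f} = half_twist {1..<M + f}" for b
  proof (rule altword_half_twist[where l = l and s = s and h = p])
    show "s (\<not> b) + s b = 2 * p + 1" for b by (simp add: s_def)
    show "act (v b) (thin f (l b) r) = thin f (l (\<not> b)) (swap_step M (s b) r)"
      if "1 \<le> r" "r \<le> M" for b r
    proof -
      have o: "act (desc f p @ [p]) (thin f p r) =
          thin f (Suc p) (if r = p then Suc p else if r = Suc p then p else r)" for r
        by (auto simp: act_desc sw_eq thin_def)
      have o': "act (asc f p) (thin f (Suc p) r) = thin f p r" for r
        by (auto simp: act_asc thin_def)
      show ?thesis
      proof (cases b)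
        case True
        define r' where "r' = (if r < M \<and> even (r + p) \<and> r \<noteq> p then r + 1
          else if 1 < r \<and> odd (r + p) \<and> r \<noteq> Suc p then r - 1 else r)"
        have "act (v b) (thin f (l b) r) = act (desc f p @ [p]) (act (side_word f M p p) (thin f p r))"
          using True by (simp add: v_def l_def)
        also have "\<dots> = thin f (Suc p) (swap_step M p r)"
          unfolding act_side_word[OF that assms(2)] r'_def[symmetric] o
          by (simp only: swap_step_split[OF r'_def assms(2) M(2)])
        finally show ?thesis using True by (simp add: s_def l_def)
      next
        case False
        then show ?thesis using that M assms
          by (auto simp: v_def s_def l_def act_side_word o' swap_step_def)
      qed
    qed
    show "act (v b) (l b + i) = l (\<not> b) + i" if "1 \<le> i" "i \<le> f" for b i
    proof -
      have "act (desc f p @ [p]) (p + i) = Suc p + i" "act (asc f p) (Suc p + i) = p + i"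
        using that by (auto simp: act_desc act_asc sw_eq)
      then show ?thesis using that act_side_word_fat[of p "p + i" f M] by (auto simp: v_def l_def)
    qed
    show "set (v b) \<subseteq> {1..<M + f}" for b
      using side_word_subset[of p p] side_word_subset[of p "Suc p"] M assms(2)
      by (auto simp: v_def set_desc)
    show "l (\<not> b) = l (b = even M)" "l b + l (\<not> b) = M" using M assms(1) by (auto simp: l_def)
    have lv: "length (v b) = p + f" for b
      using length_side_word_odd[OF assms(2) M(2) assms(1), of f]
      by (cases b) (auto simp: v_def length_desc)
    have "length (altword v b M) = p * (2 * (p + f)) + (p + f)"
      unfolding assms(1) length_altword lv by simp
    then show "2 * length (altword v b M) + f * (f - 1) = (M + f) * (M + f - 1)"
      using assms(1) by (cases f) (auto simp: algebra_simps)
  qed (use M in simp_all)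
  from this[of True] this[of False] show
    "alt_prod M (outer p * S p * gen p) (S' p * other p) * D (Suc p) = Delta"
    "alt_prod M (S' p * other p) (outer p * S p * gen p) * D p = Delta"
    by (simp_all add: br_altword v_def l_def Delta_def D_def inner_twist_def outer_def S_def S'_def
        other_def mult.assoc)
qed

lemma D_E: "D p * E p = E p * D p"
proof -
  have "D p * E p = (D p * outer p) * C p * other p" by (simp only: E_def mult.assoc)
  also have "\<dots> = outer p * (D p * C p) * other p" unfolding D_outer by (simp only: mult.assoc)
  also have "\<dots> = outer p * C p * (D p * other p)" unfolding D_C by (simp only: mult.assoc)
  also have "\<dots> = E p * D p" unfolding D_other by (simp only: E_def mult.assoc)
  finally show ?thesis .
qed

lemma D_E': "D p * E' p = E' p * D p"
proof -
  have "D p * E' p = (D p * other p) * outer p * C p" by (simp only: E'_def mult.assoc)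
  also have "\<dots> = other p * (D p * outer p) * C p" unfolding D_other by (simp only: mult.assoc)
  also have "\<dots> = other p * outer p * (D p * C p)" unfolding D_outer by (simp only: mult.assoc)
  also have "\<dots> = E' p * D p" unfolding D_C by (simp only: E'_def mult.assoc)
  finally show ?thesis .
qed

text \<open>Two half turns make a full turn. For odd \<open>M\<close> the second half turn begins
  with the other factor, since the first one has an odd number of factors.\<close>

lemma good_middle:
  assumes "1 < M" shows "good (M div 2)"
proof (cases "even M")
  case True
  define p where "p = M div 2"
  have p: "M = 2 * p" "1 \<le> p" using True assms by (auto simp: p_def)
  have "E p ^ p * D p = Delta"
    using even_half(1)[OF p] by (simp add: E_def alt_prod_double[OF p(1)])
  then have "Delta ^ 2 = (E p ^ p * D p) * (E p ^ p * D p)" by (simp add: power2_eq_square)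
  also have "\<dots> = E p ^ p * (D p * E p ^ p) * D p" by (simp only: mult.assoc)
  also have "\<dots> = E p ^ (p + p) * D p ^ 2"
    unfolding commute_power[OF D_E] by (simp add: power2_eq_square power_add mult.assoc)
  finally show ?thesis unfolding good_def p_def[symmetric] using p(1) by (simp add: mult_2)
next
  case False
  define p where "p = M div 2"
  have p: "M = 2 * p + 1" "1 \<le> p" using False assms unfolding p_def by presburger+
  let ?Q = "outer p * S p * gen p" and ?Q' = "S' p * other p"
  let ?x = "alt_prod M ?Q ?Q'" and ?y = "alt_prod M ?Q' ?Q"
  note half = odd_half[OF p]
  have DQ: "D p * ?Q = ?Q * D (Suc p)"
  proof -
    have "D p * ?Q = (D p * outer p) * S p * gen p" by (simp only: mult.assoc)
    also have "\<dots> = outer p * (D p * S p) * gen p" unfolding D_outer by (simp only: mult.assoc)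
    also have "\<dots> = outer p * S p * (D (Suc p) * gen p)" unfolding D_S by (simp only: mult.assoc)
    also have "D (Suc p) * gen p = gen p * D (Suc p)"
      unfolding D_def by (rule inner_twist_commute_gen)
    finally show ?thesis by (simp only: mult.assoc)
  qed
  have DQ': "D (Suc p) * ?Q' = ?Q' * D p"
  proof -
    have "D (Suc p) * ?Q' = (D (Suc p) * S' p) * other p" by (simp only: mult.assoc)
    also have "\<dots> = S' p * (D p * other p)" unfolding S'_D[symmetric] by (simp only: mult.assoc)
    finally show ?thesis unfolding D_other by (simp only: mult.assoc)
  qed
  \<comment> \<open>One of the two inner twists at the end is moved back through \<open>?y\<close>,
    where it completes the first half turn \<open>?x\<close>.\<close>
  have "D (Suc p) * ?y = ?y * D p"
    using alt_prod_intertwine[OF DQ' DQ, of M] False by simp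
  have "E p ^ M = alt_prod (M + M) ?Q ?Q'"
    using alt_prod_even[of M ?Q ?Q'] by (simp add: mult_2 E_def C_eq mult.assoc)
  also have "\<dots> = ?x * ?y" unfolding alt_prod_add using False by simp
  finally have "E p ^ M * D p ^ 2 = ?x * (?y * D p) * D p"
    by (simp add: power2_eq_square mult.assoc)
  also have "\<dots> = ?x * (D (Suc p) * ?y) * D p" by (simp only: \<open>D (Suc p) * ?y = ?y * D p\<close>)
  also have "\<dots> = (?x * D (Suc p)) * (?y * D p)" by (simp only: mult.assoc)
  also have "\<dots> = Delta ^ 2" unfolding half by (simp add: power2_eq_square)
  finally show ?thesis unfolding good_def p_def[symmetric] .
qed

section \<open>The alternating relations with inner twists\<close>

lemma power_mult_D:
  assumes "D p * e = e * D p" shows "(e * D p) ^ k = e ^ k * D p ^ k"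
proof (induction k)
  case (Suc k)
  have "(e * D p) ^ Suc k = e * (D p * e ^ k) * D p ^ k" using Suc by (simp add: mult.assoc)
  then show ?case unfolding commute_power[OF assms] by (simp add: mult.assoc power_commutes)
qed simp

theorem relation_2M:
  assumes "1 \<le> p" "p < M"
  shows "alt_prod (2 * M) (outer p * (C p * D p)) (other p) =
    alt_prod (2 * M) (other p) (outer p * (C p * D p))"
proof -
  have "good p" using good_all[OF _ _ good_middle] assms by simp
  have "outer p * (C p * D p) * other p = E p * D p" "other p * (outer p * (C p * D p)) = E' p * D p"
    using D_other[of p] by (simp_all add: E_def E'_def mult.assoc)
  \<comment> \<open>Two of the \<open>M\<close> inner twists complete the full twist; the other
    \<open>k\<close> are the same on both sides.\<close>
  moreover obtain k where k: "M = 2 + k" using assms le_Suc_ex[of 2 M] by auto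
  then have "D p ^ M = D p ^ 2 * D p ^ k" by (simp only: power_add)
  ultimately show ?thesis
    using \<open>good p\<close> good_iff_good'[of p] power_mult_D[OF D_E, of p M] power_mult_D[OF D_E', of p M]
    unfolding alt_prod_even good_def by (simp flip: mult.assoc)
qed

theorem relation_M_symmetric:
  assumes "M = 2 * p" "1 \<le> p"
  shows "alt_prod M (outer p * (C p * D p)) (other p) = alt_prod M (other p) (outer p * (C p * D p))"
proof -
  have "outer p * (C p * D p) * other p = E p * D p" "other p * (outer p * (C p * D p)) = E' p * D p"
    using D_other[of p] by (simp_all add: E_def E'_def mult.assoc)
  \<comment> \<open>Here one inner twist completes the half twist, and \<open>k\<close> of them are
    common to both sides.\<close>
  moreover obtain k where k: "p = Suc k" using assms by (cases p) auto
  have "E p ^ p * D p = E' p ^ p * D p"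
    using even_half[OF assms] by (simp add: alt_prod_double[OF assms(1)] E_def E'_def mult.assoc)
  then have "E p ^ p * D p ^ p = E' p ^ p * D p ^ p"
    unfolding k power_Suc[of "D (Suc k)"] by (simp flip: mult.assoc)
  ultimately show ?thesis
    unfolding alt_prod_double[OF assms(1)]
    using power_mult_D[OF D_E, of p p] power_mult_D[OF D_E', of p p] by simp
qed

end


section \<open>The order of the dihedral relation\<close>

context two_half_twists
begin

definition rel :: "nat \<Rightarrow> bool" where
  "rel k \<longleftrightarrow> altword u True k \<approx> altword u False k"

lemma rel_iff: "rel k \<longleftrightarrow> altword u b k \<approx> altword u (\<not> b) k"
  unfolding rel_def using beq.sym by (cases b) auto

lemma rel_iff_alt_prod:
  "rel k \<longleftrightarrow> alt_prod k (br (u b)) (br (u (\<not> b))) = alt_prod k (br (u (\<not> b))) (br (u b))"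
  unfolding rel_iff[of k b] br_eq_iff[symmetric] br_altword by simp

lemma finite_fat: "finite {x. fat x}"
  by (rule finite_subset[of _ "{1..n}"]) (use J_range in \<open>auto simp: fat_def\<close>)

text \<open>The fat positions nearest to a thin \<open>y\<close> on either side would belong to two
  fat strands with only thin positions between them.\<close>

lemma fat_convex:
  assumes "rel k" "0 < k" "fat F" "fat G" "F < y" "y < G" shows "fat y"
proof (rule ccontr)
  assume y: "\<not> fat y"
  let ?L = "{x. fat x \<and> x < y}"
  define F' where "F' = Max ?L"
  define G' where "G' = (LEAST x. fat x \<and> y < x)"
  have fin: "finite ?L" "?L \<noteq> {}" using assms(3,5) by auto
  have F': "fat F'" "F' < y" using Max_in[OF fin] unfolding F'_def by auto
  have G': "fat G'" "y < G'"
    using LeastI[of "\<lambda>x. fat x \<and> y < x" G] assms(4,6) unfolding G'_def by auto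
  have thin: "\<not> fat z" if "F' < z" "z < G'" for z
  proof (cases z y rule: linorder_cases)
    case less
    then show ?thesis using Max_ge[OF fin(1), of z] that unfolding F'_def
      by (metis (no_types, lifting) mem_Collect_eq leD)
  next
    case equal
    then show ?thesis using y by simp
  next
    case greater
    then show ?thesis using not_less_Least[of z "\<lambda>x. fat x \<and> y < x"] that unfolding G'_def by blast
  qed
  show False
    using no_relation_two_fat[OF F'(1) G'(1) _ thin assms(2), of True] F' G' assms(1)
    unfolding rel_def by simp
qed

lemma fat_interval:
  assumes "rel k" "0 < k" "fat x"
  obtains p f c where "0 < f" "one_fat_strand n J u c p f"
proof -
  define a where "a = Min {x. fat x}"
  define b where "b = Max {x. fat x}"
  have ne: "{x. fat x} \<noteq> {}" using assms(3) by auto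
  have fa: "fat a" "fat b" using Min_in[OF finite_fat ne] Max_in[OF finite_fat ne]
    by (simp_all add: a_def b_def)
  have fat: "fat x \<longleftrightarrow> a \<le> x \<and> x \<le> b" for x
  proof
    assume "fat x"
    then show "a \<le> x \<and> x \<le> b" using Min_le[OF finite_fat] Max_ge[OF finite_fat]
      by (simp add: a_def b_def)
  next
    assume "a \<le> x \<and> x \<le> b"
    then show "fat x" using fat_convex[OF assms(1,2) fa, of x] fa by (cases "x = a \<or> x = b") auto
  qed
  obtain c where c: "a - 1 \<in> J c" "a \<in> J c" using fa(1) fat_def by blast
  have a: "2 \<le> a" using J_range[OF c(1)] by linarith
  have ab: "a \<le> b" using fat fa by blast
  have mem: "x \<in> J c" if "a \<le> x" "x \<le> b" for x
    using that
  proof (induction x rule: dec_induct)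
    case (step x)
    \<comment> \<open>Consecutive fat positions share a letter and therefore a colour.\<close>
    obtain d where d: "x \<in> J d" "Suc x \<in> J d" using fat[of "Suc x"] step by (auto simp: fat_def)
    then have "d = c" using step not_both[of x d] by (cases "d = c") auto
    then show ?case using d by simp
  qed (rule c(2))
  \<comment> \<open>The fat positions \<open>a\<close> to \<open>b\<close> are the interior of the
    block with letters \<open>a - 1\<close> to \<open>b\<close>; hence \<open>p = a - 1\<close> and
    \<open>f = b + 1 - a\<close>.\<close>
  have "{a - 1..a - 1 + (b + 1 - a)} \<subseteq> J c"
  proof
    fix x assume x: "x \<in> {a - 1..a - 1 + (b + 1 - a)}"
    show "x \<in> J c"
    proof (cases "x = a - 1")
      case False
      then have "a \<le> x" "x \<le> b" using x a ab by auto
      then show ?thesis by (rule mem)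
    qed (use c(1) in simp)
  qed
  then have "one_fat_strand n J u c (a - 1) (b + 1 - a)"
    by unfold_locales (use fat a ab in auto)
  then show ?thesis using that[of "b + 1 - a" c "a - 1"] ab by simp
qed

end

context one_fat_strand
begin

interpretation W: strand_words f M .

lemma M_f: "M + f = Suc n"
  using p_range by (simp add: M_def)

lemma J_eq:
  "J c = set (side_word f M p p) \<union> {p..p + f}" (is "_ = ?A \<union> _")
  "J (\<not> c) = set (side_word f M p (Suc p))" (is "_ = ?B")
proof -
  have thin_cases: "\<exists>r. 1 \<le> r \<and> r < M \<and> r \<noteq> p \<and> x = thin f p r"
    if "1 \<le> x" "x \<le> n" "x \<notin> {p..p + f}" for x
    using thin_cover[OF p_range(1) p_less_M] that M_f by simp
  have sc: "shift c = p" "shift (\<not> c) = Suc p" by (auto simp: shift_def)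
  show "J c = ?A \<union> {p..p + f}"
  proof (intro equalityI subsetI)
    fix x assume x: "x \<in> J c"
    show "x \<in> ?A \<union> {p..p + f}"
    proof (cases "x \<in> {p..p + f}")
      case False
      then obtain r where "1 \<le> r" "r < M" "r \<noteq> p" "x = thin f p r"
        using thin_cases J_range[OF x] by blast
      then show ?thesis using thin_mem[of r c] x sc by (auto simp: set_side_word)
    qed simp
  next
    fix x assume "x \<in> ?A \<union> {p..p + f}"
    then consider "x \<in> {p..p + f}" | r where "1 \<le> r" "r < M" "even (r + p)" "x = thin f p r"
      unfolding Un_iff set_side_word by blast
    then show "x \<in> J c"
    proof cases
      case 1
      then show ?thesis using K by blast
    next
      case (2 r)
      then show ?thesis using thin_mem[of r c] sc by simp
    qed
  qed
  show "J (\<not> c) = ?B"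
  proof (intro equalityI subsetI)
    fix x assume x: "x \<in> J (\<not> c)"
    have "x \<notin> {p..p + f}" using K not_both[OF x] by auto
    then obtain r where "1 \<le> r" "r < M" "r \<noteq> p" "x = thin f p r"
      using thin_cases J_range[OF x] by blast
    then show "x \<in> ?B" using thin_mem[of r "\<not> c"] x sc by (auto simp: set_side_word)
  next
    fix x assume "x \<in> ?B"
    then obtain r where "1 \<le> r" "r < M" "even (r + Suc p)" "x = thin f p r"
      unfolding set_side_word by blast
    then show "x \<in> J (\<not> c)" using thin_mem[of r "\<not> c"] sc by simp
  qed
qed

lemma br_u: "br (u c) = W.outer p * (W.C p * W.D p)" "br (u (\<not> c)) = W.other p"
proof -
  have orth: "orthogonal_sets (set (side_word f M p p)) {p..p + f}"
    unfolding orthogonal_sets_def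
  proof (intro ballI)
    fix j k assume "j \<in> set (side_word f M p p)" "k \<in> {p..p + f}"
    then show "1 < \<bar>int j - int k\<bar>" using W.outer_range[of j p] by auto
  qed
  have "br (u c) = half_twist (set (side_word f M p p) \<union> {p..p + f})"
    using half_twist_eqI[OF twist, of c] J_eq(1) by simp
  also have "\<dots> = half_twist (set (side_word f M p p)) * half_twist {p..<Suc (p + f)}"
    unfolding atLeastLessThanSuc_atLeastAtMost by (rule half_twist_Un[OF orth]) auto
  also have "\<dots> = W.outer p * (W.C p * W.D p)"
    using br_self_orthogonal[OF distinct_side_word self_orthogonal_side_word, of f M p p]
    by (simp only: half_twist_over W.outer_def W.C_def W.D_def)
  finally show "br (u c) = W.outer p * (W.C p * W.D p)" .
  show "br (u (\<not> c)) = W.other p"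
    using half_twist_eqI[OF twist, of "\<not> c"] J_eq(2)
      br_self_orthogonal[OF distinct_side_word self_orthogonal_side_word, of f M p "Suc p"]
    by (simp add: W.other_def)
qed

text \<open>The flip fixes the interval iff \<open>n + 1 = 2 * p + f\<close>, that is, iff the fat
  strand is in the middle gap. Moreover \<open>n - card K = M - 2\<close>, which accounts for both
  values.\<close>

lemma m_of_eq: "2 * m_of n {p..p + f} = (if M = 2 * p then M else 2 * M)"
proof -
  have "diagram_flip n ` {p..p + f} = {n + 1 - (p + f)..n + 1 - p}"
  proof (intro equalityI subsetI)
    fix x assume "x \<in> {n + 1 - (p + f)..n + 1 - p}"
    then show "x \<in> diagram_flip n ` {p..p + f}"
      using p_range by (intro image_eqI[of _ _ "n + 1 - x"]) (auto simp: diagram_flip_def)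
  qed (auto simp: diagram_flip_def)
  also have "\<dots> = {p..p + f} \<longleftrightarrow> M = 2 * p"
    using p_range M_f by (auto simp: Icc_eq_Icc)
  finally have "diagram_flip n ` {p..p + f} = {p..p + f} \<longleftrightarrow> M = 2 * p" .
  moreover have "n - card {p..p + f} = M - 2" using M_f by simp
  ultimately show ?thesis using p_range p_less_M by (auto simp: m_of_def)
qed

lemma least_relation:
  assumes "0 < f"
  shows "rel (2 * m_of n {p..p + f})"
    and "0 < k \<Longrightarrow> k < 2 * m_of n {p..p + f} \<Longrightarrow> \<not> rel k"
proof -
  show "rel (2 * m_of n {p..p + f})"
    unfolding m_of_eq rel_iff_alt_prod[of _ c] br_u
    using W.relation_2M[OF p_range(1) p_less_M] W.relation_M_symmetric[OF _ p_range(1)] by simp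
  assume k: "0 < k" "k < 2 * m_of n {p..p + f}"
  show "\<not> rel k"
  proof
    assume r: "rel k"
    have "k < 2 * M" using k(2) unfolding m_of_eq by (auto split: if_splits)
    then have "k = M" using relation_length[OF k(1), of True] r by (simp add: rel_def)
    then show False
      using k(2) no_relation_asymmetric[OF assms, of True] r unfolding m_of_eq
      by (auto simp: rel_def split: if_splits)
  qed
qed

text \<open>Without a fat strand \<open>S\<close>, \<open>S'\<close> and \<open>D\<close> are
  trivial, so for odd \<open>M\<close> both products in \<open>odd_half\<close> are already the
  alternating ones; for even \<open>M\<close> the symmetric relation applies.\<close>

lemma least_relation_thin:
  assumes "f = 0" "p = (n + 1) div 2"
  shows "rel (n + 1)" and "0 < k \<Longrightarrow> k < n + 1 \<Longrightarrow> \<not> rel k"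
proof -
  have M: "M = n + 1" using M_f assms(1) by simp
  have "alt_prod M (br (u c)) (br (u (\<not> c))) = alt_prod M (br (u (\<not> c))) (br (u c))"
  proof (cases "even M")
    case True
    then have "M = 2 * p" using assms(2) M by simp
    then show ?thesis unfolding br_u by (rule W.relation_M_symmetric) (rule p_range(1))
  next
    case False
    then have "M = 2 * p + 1" using assms(2) M by presburger
    note * = W.odd_half[OF this p_range(1)]
    have "W.D q = 1" "W.S q = 1" "W.S' q = 1" for q
      unfolding W.D_def W.S_def W.S'_def inner_twist_def desc_def asc_def using assms(1) by simp_all
    then show ?thesis using * unfolding br_u by (simp add: W.C_eq)
  qed
  then show "rel (n + 1)" using rel_iff_alt_prod[of "n + 1" c] M by simp
  show "\<not> rel k" if "0 < k" "k < n + 1"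
    using relation_length[OF that(1), of True] that M by (auto simp: rel_def)
qed

text \<open>An interval from \<open>a\<close> to \<open>d\<close> with \<open>a < d\<close> makes
  \<open>Suc a\<close> and \<open>d\<close> fat, which confines it to the letters from
  \<open>p\<close> to \<open>p + f\<close>.\<close>

lemma big_component_iff:
  assumes "0 < f"
  shows "is_big_component (J b) L \<longleftrightarrow> b = c \<and> L = {p..p + f}"
proof -
  have sub: "L \<subseteq> {p..p + f} \<and> b = c" if L: "is_interval_set L" "L \<subseteq> J b" "card L > 1" for L b
  proof -
    obtain a d where ad: "L = {a..d}" "a < d" using L(1,3) by (auto simp: is_interval_set_def)
    have "fat (Suc a)" "fat d" unfolding fat_def using ad L(2) by (auto intro!: exI[of _ b])
    then have "p \<le> a" "d \<le> p + f" using fat_iff by auto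
    then have "L \<subseteq> {p..p + f}" using ad by auto
    moreover have "a \<in> J b" "a \<in> J c" using ad L(2) K \<open>L \<subseteq> {p..p + f}\<close> by auto
    then have "b = c" using not_both[of a c] by (cases "b = c") auto
    ultimately show ?thesis by simp
  qed
  have KI: "is_interval_set {p..p + f}" "card {p..p + f} > 1"
    using assms by (auto simp: is_interval_set_def intro!: exI[of _ p] exI[of _ "p + f"])
  show ?thesis
  proof
    assume h: "is_big_component (J b) L"
    then have "L \<subseteq> {p..p + f} \<and> b = c" by (intro sub) (auto simp: is_big_component_def is_component_def)
    moreover from this have "{p..p + f} = L"
      using h K KI(1) unfolding is_big_component_def is_component_def by blast
    ultimately show "b = c \<and> L = {p..p + f}" by simp
  next
    assume h: "b = c \<and> L = {p..p + f}"
    have "L' = {p..p + f}" if "is_interval_set L'" "{p..p + f} \<subseteq> L'" "L' \<subseteq> J c" for L'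
    proof -
      have "finite L'" using that(1) by (auto simp: is_interval_set_def)
      then have "card L' > 1" using card_mono[OF _ that(2)] KI(2) by simp
      then show ?thesis using sub[OF that(1,3)] that(2) by blast
    qed
    then show "is_big_component (J b) L"
      using h KI K unfolding is_big_component_def is_component_def by blast
  qed
qed

end

lemma complement_partition_one_fat:
  assumes "is_complement_partition n {p..p + f} (A, B)" "{p..p + f} \<subseteq> {1..n}"
    and "half_twist_word (A \<union> {p..p + f}) v" "half_twist_word B w"
  shows "one_fat_strand n (\<lambda>b. if b then A \<union> {p..p + f} else B) (\<lambda>b. if b then v else w) True p f"
proof -
  let ?K = "{p..p + f}"
  have h: "A \<union> B = {1..n} - ?K" "A \<inter> B = {}" "self_orthogonal A" "self_orthogonal B"
    "orthogonal_sets A ?K"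
    using assms(1) unfolding is_complement_partition_def split by blast+
  interpret two_half_twists n "\<lambda>b. if b then A \<union> ?K else B" "\<lambda>b. if b then v else w"
  proof
    show "(if True then A \<union> ?K else B) \<union> (if False then A \<union> ?K else B) = {1..n}"
    proof -
      have "A \<union> ?K \<union> B = {1..n}" using h(1) assms(2) by blast
      then show ?thesis by simp
    qed
    show "(if True then A \<union> ?K else B) \<inter> (if False then A \<union> ?K else B) = {}"
      using h(1,2) by auto
    show "half_twist_word (if b then A \<union> ?K else B) (if b then v else w)" for b
      using assms(3,4) by simp
  qed
  have "A \<subseteq> {1..n}" "B \<subseteq> {1..n}" using h(1) by blast+
  \<comment> \<open>Since \<open>0\<close> is not a letter, the truncated \<open>x - 1\<close> in
    \<open>fat\<close> is a true predecessor.\<close>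
  then have K0: "0 \<notin> A" "0 \<notin> B" "1 \<le> p" using assms(2) by auto
  have "fat x \<longleftrightarrow> p < x \<and> x \<le> p + f" for x
  proof
    assume "p < x \<and> x \<le> p + f"
    then show "fat x" unfolding fat_def by (intro exI[of _ True]) auto
  next
    assume "fat x"
    then obtain b where b: "x - 1 \<in> (if b then A \<union> ?K else B)" "x \<in> (if b then A \<union> ?K else B)"
      unfolding fat_def by blast
    have x: "x = Suc (x - 1)" using b(2) K0 by (cases x) (auto split: if_splits)
    have "\<not> (x - 1 \<in> A \<and> x \<in> A)" "\<not> (x - 1 \<in> B \<and> x \<in> B)"
      using h(3,4) x unfolding self_orthogonal_def by metis+
    moreover have "\<not> (x - 1 \<in> A \<and> x \<in> ?K)" "\<not> (x \<in> A \<and> x - 1 \<in> ?K)"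
      using h(5) x unfolding orthogonal_sets_def by (metis abs_minus_commute add_diff_cancel_left'
        abs_1 of_nat_Suc less_irrefl add.commute)+
    ultimately have "x - 1 \<in> ?K \<and> x \<in> ?K" using b by (auto split: if_splits)
    then show "p < x \<and> x \<le> p + f" using x by auto
  qed
  then show ?thesis by unfold_locales auto
qed

text \<open>Uniqueness: any such partition yields a configuration with one fat strand, and there the
  colours alternate outwards from \<open>K\<close>, so \<open>J_eq\<close> determines both
  sets.\<close>

lemma complement_partition_unique:
  assumes "{p..p + f} \<subseteq> {1..n}"
  shows "\<exists>!P. is_complement_partition n {p..p + f} P"
proof -
  let ?M = "n + 1 - f"
  have pf: "1 \<le> p" "p + f \<le> n" using assms by auto
  let ?A = "set (side_word f ?M p p)" and ?B = "set (side_word f ?M p (Suc p))"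
  have "is_complement_partition n {p..p + f} (?A, ?B)"
    unfolding is_complement_partition_def split
  proof (intro conjI)
    show "?A \<union> ?B = {1..n} - {p..p + f}"
    proof (intro equalityI subsetI)
      fix x assume "x \<in> ?A \<union> ?B"
      then obtain e where "x \<in> set (side_word f ?M p e)" by blast
      from side_word_range[OF this] show "x \<in> {1..n} - {p..p + f}" using pf by  auto
    next
      fix x assume x: "x \<in> {1..n} - {p..p + f}"
      have "\<exists>r. 1 \<le> r \<and> r < ?M \<and> r \<noteq> p \<and> x = thin f p r"
        using x pf by (intro thin_cover) auto
      then obtain r where r: "1 \<le> r" "r < ?M" "r \<noteq> p" "x = thin f p r" by blast
      then show "x \<in> ?A \<union> ?B" by (cases "even (r + p)") (auto simp: set_side_word)
    qed
    show "?A \<inter> ?B = {}" by (auto simp: set_side_word)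
    show "orthogonal_sets ?A {p..p + f}"
      unfolding orthogonal_sets_def
    proof (intro ballI)
      fix j k assume "j \<in> ?A" "k \<in> {p..p + f}"
      then show "1 < \<bar>int j - int k\<bar>" using strand_words.outer_range[of j f ?M p] by auto
    qed
  qed (rule self_orthogonal_side_word)+
  moreover have "A = ?A \<and> B = ?B" if P: "is_complement_partition n {p..p + f} (A, B)" for A B
  proof -
    have AB: "A \<union> B = {1..n} - {p..p + f}" using P by (simp add: is_complement_partition_def)
    then have "finite (A \<union> B)" by simp
    then obtain v w where "half_twist_word (A \<union> {p..p + f}) v" "half_twist_word B w"
      using half_twist_word_ex[of "A \<union> {p..p + f}"] half_twist_word_ex[of B] by auto
    then interpret one_fat_strand n "\<lambda>b. if b then A \<union> {p..p + f} else B" "\<lambda>b. if b then v else w" True p f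
      using complement_partition_one_fat[OF P assms] by blast
    have "A \<union> {p..p + f} = ?A \<union> {p..p + f}" "B = ?B" using J_eq by (simp_all add: M_def)
    moreover have "?A \<inter> {p..p + f} = {}" using side_word_range(3)[of _ f ?M p p] by fastforce
    moreover have "A \<inter> {p..p + f} = {}" using AB by blast
    ultimately show ?thesis by blast
  qed
  ultimately show ?thesis by (metis surj_pair)
qed


section \<open>Standard homomorphisms\<close>

lemma hom_support_word_class:
  assumes "\<Phi> (dihedral_gen N i) = word_class n v" "set v \<subseteq> {1..n}"
  shows "hom_support N \<Phi> i = set v"
  unfolding hom_support_def assms(1) by (rule Union_word_class[OF assms(2)])

lemma interval_hom:
  assumes K: "is_interval_set K" "K \<subset> {1..n}" "card K > 1"
    and P: "is_complement_partition n K (A, B)"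
  defines "N \<equiv> 2 * m_of n K"
  shows "\<exists>\<Phi>. \<Phi> \<in> monoid_homs (dihedral_monoid N) (braid_monoid n) \<and>
    \<Phi> (dihedral_gen N 1) = braid_lift n (longest_element n (A \<union> K)) \<and>
    \<Phi> (dihedral_gen N 2) = braid_lift n (longest_element n B) \<and>
    standard_hom N n \<Phi> \<and> disjoint_hom N \<Phi> \<and> optimal_hom N n \<Phi>"
proof -
  obtain a b where ab: "K = {a..b}" "a \<le> b" using K(1) by (auto simp: is_interval_set_def)
  define f where "f = b - a"
  have Kf: "K = {a..a + f}" "0 < f" using ab K(3) by (auto simp: f_def)
  have AB: "A \<union> B = {1..n} - K" "A \<inter> B = {}"
    using P unfolding is_complement_partition_def split by blast+
  have sub: "A \<union> K \<subseteq> {1..n}" "B \<subseteq> {1..n}" using AB(1) K(2) by blast+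
  obtain v where v: "half_twist_word (A \<union> K) v" "set v = A \<union> K"
      "braid_lift n (longest_element n (A \<union> K)) = word_class n v"
    using braid_lift_longest[OF sub(1)] by blast
  obtain w where w: "half_twist_word B w" "set w = B"
      "braid_lift n (longest_element n B) = word_class n w"
    using braid_lift_longest[OF sub(2)] by blast
  have "one_fat_strand n (\<lambda>b. if b then A \<union> K else B) (\<lambda>b. if b then v else w) True a f"
    using complement_partition_one_fat[of n a f A B v w] P K(2) v(1) w(1) unfolding Kf(1) by blast
  then interpret one_fat_strand n "\<lambda>b. if b then A \<union> K else B" "\<lambda>b. if b then v else w" True a f .
  have iff: "rel k \<longleftrightarrow> alternating_relation n k (word_class n v) (word_class n w)" for k
    using rel_iff_alt_prod[of k True] alternating_relation_iff[of v n w k] sub v(2) w(2) by simp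
  have N: "rel N" "\<And>k. 0 < k \<Longrightarrow> k < N \<Longrightarrow> \<not> rel k"
    using least_relation[OF Kf(2)] unfolding N_def Kf(1) by blast+
  have "0 < N" using m_of_eq p_less_M unfolding N_def Kf(1) by (auto split: if_splits)
  have vw: "set v \<subseteq> {1..n}" "set w \<subseteq> {1..n}" using sub v(2) w(2) by simp_all
  have "alt_prod N (br v) (br w) = alt_prod N (br w) (br v)"
    using N(1) iff alternating_relation_iff[OF vw] by blast
  then obtain \<Phi> where \<Phi>: "\<Phi> \<in> monoid_homs (dihedral_monoid N) (braid_monoid n)"
      "\<Phi> (dihedral_gen N 1) = word_class n v" "\<Phi> (dihedral_gen N 2) = word_class n w"
    using dihedral_hom_ex[OF vw] by blast
  have "\<exists>J\<subseteq>{1..n}. \<Phi> (dihedral_gen N 1) = braid_lift n (longest_element n J)"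
    "\<exists>J\<subseteq>{1..n}. \<Phi> (dihedral_gen N 2) = braid_lift n (longest_element n J)"
    unfolding \<Phi>(2,3) v(3)[symmetric] w(3)[symmetric] using sub by blast+
  then have "standard_hom N n \<Phi>" unfolding standard_hom_def using \<Phi>(1) by blast
  moreover have "disjoint_hom N \<Phi>"
    unfolding disjoint_hom_def hom_support_word_class[of \<Phi> N 1 n v, OF \<Phi>(2) vw(1)]
      hom_support_word_class[of \<Phi> N 2 n w, OF \<Phi>(3) vw(2)] v(2) w(2)
    using AB by blast
  moreover have "optimal_hom N n \<Phi>"
    unfolding optimal_hom_def Let_def \<Phi>(2,3) using N iff \<open>0 < N\<close> by blast
  ultimately show ?thesis using \<Phi> v(3) w(3) by auto
qed

lemma (in two_half_twists) big_component_fat: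
  assumes "is_big_component (J b) L" shows "\<exists>x. fat x"
proof -
  have L: "is_interval_set L" "L \<subseteq> J b" "card L > 1"
    using assms by (auto simp: is_big_component_def is_component_def)
  then obtain a d where ad: "L = {a..d}" "a < d" by (auto simp: is_interval_set_def)
  then have "a \<in> L" "Suc a \<in> L" by auto
  then have "fat (Suc a)" using L(2) unfolding fat_def by (auto intro!: exI[of _ b])
  then show ?thesis by blast
qed

lemma (in two_half_twists) self_orthogonal_iff_no_fat:
  "self_orthogonal (J True) \<and> self_orthogonal (J False) \<longleftrightarrow> (\<forall>x. \<not> fat x)"
proof
  assume h: "self_orthogonal (J True) \<and> self_orthogonal (J False)"
  then have so: "self_orthogonal (J b)" for b by (cases b) auto
  show "\<forall>x. \<not> fat x"
  proof (intro allI notI)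
    fix x assume "fat x"
    then obtain b where b: "x - 1 \<in> J b" "x \<in> J b" unfolding fat_def by blast
    then have "Suc (x - 1) = x" using J_range[OF b(2)] by simp
    then show False using so[of b] b unfolding self_orthogonal_def by metis
  qed
next
  assume h: "\<forall>x. \<not> fat x"
  have "self_orthogonal (J b)" for b
    unfolding self_orthogonal_def
  proof (intro ballI notI)
    fix j assume "j \<in> J b" "Suc j \<in> J b"
    then have "fat (Suc j)" unfolding fat_def by auto
    then show False using h by blast
  qed
  then show "self_orthogonal (J True) \<and> self_orthogonal (J False)" by blast
qed

text \<open>The setting of the converse, with the colours \<open>True\<close> and \<open>False\<close> for the generators
  \<open>1\<close> and \<open>2\<close>.\<close>

lemma hom_two_half_twists:
  assumes "standard_hom N n \<Phi>" "optimal_hom N n \<Phi>" "disjoint_hom N \<Phi>" "fully_supported_hom N n \<Phi>"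
    and "\<forall>i\<in>{1, 2}. hom_support N \<Phi> i \<noteq> {}"
  obtains u where
    "two_half_twists n (\<lambda>b. hom_support N \<Phi> (if b then 1 else 2)) u"
    "\<And>b. \<Phi> (dihedral_gen N (if b then 1 else 2)) = word_class n (u b)"
    "0 < N" "two_half_twists.rel u N" "\<And>k. 0 < k \<Longrightarrow> k < N \<Longrightarrow> \<not> two_half_twists.rel u k"
proof -
  let ?i = "\<lambda>b::bool. if b then 1 else 2 :: nat"
  let ?J = "\<lambda>b. hom_support N \<Phi> (?i b)"
  have "\<exists>v. half_twist_word (?J b) v \<and> set v = ?J b \<and> ?J b \<subseteq> {1..n} \<and>
      \<Phi> (dihedral_gen N (?i b)) = word_class n v" for b
  proof -
    obtain J where J: "J \<subseteq> {1..n}" "\<Phi> (dihedral_gen N (?i b)) = braid_lift n (longest_element n J)"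
      using assms(1) unfolding standard_hom_def by (cases b) auto
    obtain v where v: "half_twist_word J v" "set v = J" "braid_lift n (longest_element n J) = word_class n v"
      using braid_lift_longest[OF J(1)] by blast
    then have "?J b = J" using hom_support_word_class[of \<Phi> N "?i b" n v] J by simp
    then show ?thesis using v J by auto
  qed
  then obtain u where u: "\<And>b. half_twist_word (?J b) (u b)" "\<And>b. set (u b) = ?J b"
      "\<And>b. ?J b \<subseteq> {1..n}" "\<And>b. \<Phi> (dihedral_gen N (?i b)) = word_class n (u b)"
    by metis
  have tw: "two_half_twists n ?J u"
    by unfold_locales
       (use assms(3,4) u(1) in \<open>simp_all add: disjoint_hom_def fully_supported_hom_def\<close>)
  interpret two_half_twists n ?J u by (rule tw)
  have s: "set (u b) \<subseteq> {1..n}" for b using u(2,3) by simp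
  \<comment> \<open>Optimality says something only for distinct images; here they have disjoint
    nonempty supports.\<close>
  have "\<Phi> (dihedral_gen N 1) \<noteq> \<Phi> (dihedral_gen N 2)"
    using assms(3,5) by (auto simp: disjoint_hom_def hom_support_def)
  then have opt: "0 < N" "alternating_relation n N (word_class n (u True)) (word_class n (u False))"
    "\<And>k. 0 < k \<Longrightarrow> k < N \<Longrightarrow> \<not> alternating_relation n k (word_class n (u True)) (word_class n (u False))"
    using assms(2) u(4)[of True] u(4)[of False] unfolding optimal_hom_def Let_def by auto
  have iff: "rel k \<longleftrightarrow> alternating_relation n k (word_class n (u True)) (word_class n (u False))" for k
    using rel_iff_alt_prod[of k True] alternating_relation_iff[OF s s] by simp
  show ?thesis using that[OF tw u(4)] opt iff by blast
qed

lemma doubleton_bool: "{i, j} = {1, 2 :: nat} \<longleftrightarrow> (\<exists>b. i = (if b then 1 else 2) \<and> j = (if b then 2 else 1))"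
  by (auto simp: doubleton_eq_iff)

theorem theorem5p4:
  fixes n :: nat
  assumes "n > 1"
  shows
    "(\<forall>K. is_interval_set K \<and> K \<subset> {1..n} \<and> card K > 1 \<longrightarrow>
        (\<exists>!P. is_complement_partition n K P) \<and>
        (\<forall>A B. is_complement_partition n K (A, B) \<longrightarrow>
          (\<exists>\<Phi>. \<Phi> \<in> monoid_homs (dihedral_monoid (2 * m_of n K)) (braid_monoid n) \<and>
               \<Phi> (dihedral_gen (2 * m_of n K) 1) = braid_lift n (longest_element n (A \<union> K)) \<and>
               \<Phi> (dihedral_gen (2 * m_of n K) 2) = braid_lift n (longest_element n B) \<and>
               standard_hom (2 * m_of n K) n \<Phi> \<and>
               disjoint_hom (2 * m_of n K) \<Phi> \<and>
               optimal_hom (2 * m_of n K) n \<Phi>)))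
     \<and>
     (\<forall>(N :: nat) \<Phi>.
        3 \<le> N \<and> standard_hom N n \<Phi> \<and> optimal_hom N n \<Phi> \<and> disjoint_hom N \<Phi> \<and>
        fully_supported_hom N n \<Phi> \<and> (\<forall>i\<in>{1, 2}. hom_support N \<Phi> i \<noteq> {}) \<longrightarrow>
          ((self_orthogonal (hom_support N \<Phi> 1) \<and> self_orthogonal (hom_support N \<Phi> 2)) \<or>
           (\<exists>i j. {i, j} = {1, 2} \<and>
              (\<exists>!K. is_big_component (hom_support N \<Phi> i) K) \<and>
              \<not> (\<exists>K. is_big_component (hom_support N \<Phi> j) K)))
          \<and>
          (self_orthogonal (hom_support N \<Phi> 1) \<and> self_orthogonal (hom_support N \<Phi> 2) \<longrightarrow>
             N = n + 1 \<and>
             (\<exists>I :: nat \<Rightarrow> nat set.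
                {I 1, I 2} = {{j \<in> {1..n}. odd j}, {j \<in> {1..n}. even j}} \<and>
                (\<forall>k\<in>{1, 2}. \<Phi> (dihedral_gen N k) =
                   list_prod (braid_monoid n) (map (braid_gen n) (sorted_list_of_set (I k))))))
          \<and>
          (\<forall>i j K. {i, j} = {1, 2} \<and>
              is_big_component (hom_support N \<Phi> i) K \<and>
              (\<forall>K'. is_big_component (hom_support N \<Phi> i) K' \<longrightarrow> K' = K) \<and>
              \<not> (\<exists>K'. is_big_component (hom_support N \<Phi> j) K') \<longrightarrow>
             N = 2 * m_of n K))"
proof (intro conjI[where P = "\<forall>K. _ K"] allI impI, goal_cases)
  case (1 K)
  then obtain a b where "K = {a..b}" "a \<le> b" by (auto simp: is_interval_set_def)
  then have K: "K = {a..a + (b - a)}" by simp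
  have "\<exists>!P. is_complement_partition n K P"
    using complement_partition_unique[of a "b - a" n] 1 unfolding K[symmetric] by blast
  then show ?case using interval_hom[of K n] 1 by blast
next
  case (2 N \<Phi>)
  then obtain u where tw: "two_half_twists n (\<lambda>b. hom_support N \<Phi> (if b then 1 else 2)) u"
    and u: "\<And>b. \<Phi> (dihedral_gen N (if b then 1 else 2)) = word_class n (u b)"
    and N: "0 < N" "two_half_twists.rel u N" "\<And>k. 0 < k \<Longrightarrow> k < N \<Longrightarrow> \<not> two_half_twists.rel u k"
    using hom_two_half_twists[of N n \<Phi>] by blast
  define J where "J b = hom_support N \<Phi> (if b then 1 else 2)" for b :: bool
  have J: "hom_support N \<Phi> 1 = J True" "hom_support N \<Phi> 2 = J False" by (simp_all add: J_def)
  have J_if: "hom_support N \<Phi> (if b then 1 else 2) = J b" "hom_support N \<Phi> (if b then 2 else 1) = J (\<not> b)" for b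
    by (simp_all add: J_def)
  interpret two_half_twists n J u using tw unfolding J_def .
  \<comment> \<open>Optimality makes \<open>N\<close> the least length of a relation, so exhibiting
    the least length determines \<open>N\<close>.\<close>
  have N_eq: "N = k" if "rel k" "0 < k" "\<And>l. 0 < l \<Longrightarrow> l < k \<Longrightarrow> \<not> rel l" for k
    using that N by (metis linorder_neqE_nat)
  show ?case
  proof (cases "\<exists>x. fat x")
    case True
    then obtain x where "fat x" by blast
    from fat_interval[OF N(2,1) this] obtain p f c where pf: "0 < f" "one_fat_strand n J u c p f" .
    interpret one_fat_strand n J u c p f by (rule pf(2))
    note big = big_component_iff[OF pf(1)]
    have pos: "0 < 2 * m_of n {p..p + f}" unfolding m_of_eq using p_less_M by simp
    have N_m: "N = 2 * m_of n {p..p + f}"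
      by (rule N_eq[OF least_relation(1)[OF pf(1)] pos]) (rule least_relation(2)[OF pf(1)])
    have notso: "\<not> (self_orthogonal (J True) \<and> self_orthogonal (J False))"
      using True self_orthogonal_iff_no_fat by blast
    have ex: "\<exists>i j. {i, j} = {1, 2} \<and>
        (\<exists>!K. is_big_component (hom_support N \<Phi> i) K) \<and>
        \<not> (\<exists>K. is_big_component (hom_support N \<Phi> j) K)"
    proof (intro exI conjI)
      show "{if c then 1 else 2, if c then 2 else 1} = {1, 2 :: nat}" by auto
      show "\<exists>!K. is_big_component (hom_support N \<Phi> (if c then 1 else 2)) K"
        unfolding J_if big by blast
      show "\<not> (\<exists>K. is_big_component (hom_support N \<Phi> (if c then 2 else 1)) K)"
        unfolding J_if big by simp
    qed
    have m: "N = 2 * m_of n K" if h: "{i, j} = {1, 2}" "is_big_component (hom_support N \<Phi> i) K" for i j K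
    proof -
      obtain b :: bool where "i = (if b then 1 else 2)" using h(1) doubleton_bool by blast
      then have "is_big_component (J b) K" using h(2) J_if(1)[of b] by simp
      then have "K = {p..p + f}" unfolding big by blast
      then show ?thesis using N_m by simp
    qed
    show ?thesis
    proof (intro conjI allI impI, goal_cases)
      case 1
      show ?case using ex by (rule disjI2)
    next
      case 2
      then show ?case using notso J by simp
    next
      case 3
      then show ?case using notso J by simp
    next
      case (4 i j K)
      then show ?case using m[of i j K] by blast
    qed
  next
    case False
    then have so: "self_orthogonal (J True) \<and> self_orthogonal (J False)"
      using self_orthogonal_iff_no_fat by blast
    have nobig: "\<not> is_big_component (J b) L" for b L using big_component_fat False by blast
    \<comment> \<open>No position is fat, so any \<open>p\<close> would serve for
      \<open>f = 0\<close>; the middle is the choice for which \<open>least_relation_thin\<close>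
      gives the relation.\<close>
    define p where "p = (n + 1) div 2"
    have p: "1 \<le> p" "p \<le> n" using assms by (auto simp: p_def)
    then obtain c where c: "p \<in> J c" using cover[of p True] by auto
    interpret one_fat_strand n J u c p 0
      by unfold_locales (use c False in auto)
    have "N = n + 1" using N_eq least_relation_thin[OF _ p_def] by auto
    have Jb: "J b = {j \<in> {1..n}. even (j + shift b)}" for b
    proof -
      have "thin 0 p r = r" for r by (simp add: thin_def)
      then have mem: "j \<in> J b \<longleftrightarrow> even (j + shift b)" if "1 \<le> j" "j \<le> n" for j
        using thin_mem[of j b] that by (simp add: M_def)
      show ?thesis
      proof (intro equalityI subsetI)
        fix j assume j: "j \<in> J b"
        then show "j \<in> {j \<in> {1..n}. even (j + shift b)}"
          using mem[of j] J_range[OF j] by (simp del: even_add)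
      next
        fix j assume "j \<in> {j \<in> {1..n}. even (j + shift b)}"
        then show "j \<in> J b" using mem[of j] by (simp del: even_add)
      qed
    qed
    have "{J True, J False} = {{j \<in> {1..n}. odd j}, {j \<in> {1..n}. even j}}"
    proof -
      have "even (shift True) \<longleftrightarrow> odd (shift False)" unfolding shift_def by (cases c) auto
      then consider "even (shift True)" "odd (shift False)" | "odd (shift True)" "even (shift False)"
        by blast
      then show ?thesis unfolding Jb by cases (auto simp only: even_add not_True_eq_False simp_thms)
    qed
    moreover have "\<Phi> (dihedral_gen N (if b then 1 else 2)) =
        list_prod (braid_monoid n) (map (braid_gen n) (sorted_list_of_set (J b)))" for b
    proof -
      have s: "set (sorted_list_of_set (J b)) = J b" using finite_J by simp
      have "self_orthogonal (J b)" using so by (cases b) auto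
      \<comment> \<open>The letters of a self-orthogonal set commute, so their product in any order,
        in particular the sorted one, is the half twist.\<close>
      then have "br (sorted_list_of_set (J b)) = half_twist (J b)"
        using br_self_orthogonal[of "sorted_list_of_set (J b)"] s by simp
      then have "u b \<approx> sorted_list_of_set (J b)"
        using half_twist_eqI[OF twist, of b] by (metis br_eq_iff)
      moreover have "J b \<subseteq> {1..n}" using J_range by auto
      ultimately show ?thesis
        using word_class_eq_iff[of "u b" n] list_prod_braid_gen[of "sorted_list_of_set (J b)" n] s set_u u
        by simp
    qed
    from this[of True] this[of False] have "\<forall>k\<in>{1, 2}. \<Phi> (dihedral_gen N k) =
        list_prod (braid_monoid n) (map (braid_gen n) (sorted_list_of_set (J (k = 1))))"
      by simp
    ultimately have I: "\<exists>I :: nat \<Rightarrow> nat set.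
        {I 1, I 2} = {{j \<in> {1..n}. odd j}, {j \<in> {1..n}. even j}} \<and>
        (\<forall>k\<in>{1, 2}. \<Phi> (dihedral_gen N k) =
          list_prod (braid_monoid n) (map (braid_gen n) (sorted_list_of_set (I k))))"
      by (intro exI[of _ "\<lambda>k. J (k = 1)"]) simp
    have none: "\<not> is_big_component (hom_support N \<Phi> i) L" if h: "{i, j} = {1, 2}" for i j L
    proof -
      obtain b :: bool where "i = (if b then 1 else 2)" using h doubleton_bool by blast
      then show ?thesis using nobig J_if by simp
    qed
    show ?thesis
    proof (intro conjI allI impI, goal_cases)
      case 1
      show ?case using so J by (intro disjI1) simp
    next
      case 2
      show ?case by (rule \<open>N = n + 1\<close>)
    next
      case 3
      show ?case by (rule I)
    next
      case (4 i j K)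
      then show ?case using none[of i j K] by blast
    qed
  qed
qed

end
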